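(* Let $F$ be either a square metric $F=\alpha+2\beta+\beta^2/\alpha$ or a Matsumoto metric $F=\alpha^2/(\alpha-\beta)$ on an $n$-dimensional manifold $M$, where $\alpha$ is a Riemannian metric and $\beta$ a 1-form on $M$. Suppose that $F$ is a generalized Douglas-Weyl metric and that $F$ has isotropic mean Berwald curvature, i.e. ${\bf E}=\frac{n+1}{2}cF^{-1}{\bf h}$ for some scalar function $c=c(x)$ on $M$. Then $F$ is a Berwald metric.
   Context: Let $(x^i,y^i)$ be induced coordinates on $TM$, $TM_0=TM\setminus\{0\}$, $\alpha=\sqrt{a_{ij}(x)y^iy^j}$, $\beta=b_i(x)y^i$. The metric $F$ is assumed to be a (regular) Finsler metric: this means $\|\beta_x\|_\alpha<1$ for all $x$ in the case of the square metric and $\|\beta_x\|_\alpha<\frac12$ for all $x$ in the case of the Matsumoto metric. With $g_{ij}=\frac12[F^2]_{y^iy^j}$, the spray coefficients are $G^i=\frac14 g^{il}\big[\frac{\partial^2(F^2)}{\partial x^k\partial y^l}y^k-\frac{\partial (F^2)}{\partial x^l}\big]$. The Berwald curvature is $B^i_{\ jkl}=\frac{\partial^3G^i}{\partial y^j\partial y^k\partial y^l}$; $F$ is a Berwald metric if $B^i_{\ jkl}=0$. The mean Berwald curvature ${\bf E}$ has components $E_{jk}=\frac12B^m_{\ jkm}$. The angular metric is ${\bf h}=h_{ij}dx^i\otimes dx^j$ with $h_{ij}=g_{ij}-F^{-2}y_iy_j$, $y_i=g_{ij}y^j$. The Douglas curvature is $D^i_{\ jkl}=\frac{\partial^3}{\partial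 y^j\partial y^k\partial y^l}\big[G^i-\frac{1}{n+1}\frac{\partial G^m}{\partial y^m}y^i\big]$. $F$ is a generalized Douglas-Weyl metric if there is some tensor $T_{jkl}$ on $TM_0$ (depending on $x$ and $y$) with $D^i_{\ jkl|m}y^m=T_{jkl}y^i$, where $|$ denotes horizontal covariant differentiation with respect to the Berwald connection of $F$; explicitly, with $N^i_j=\partial G^i/\partial y^j$, $D^i_{\ jkl|m}y^m=y^m\frac{\partial D^i_{\ jkl}}{\partial x^m}-2G^m\frac{\partial D^i_{\ jkl}}{\partial y^m}+N^i_rD^r_{\ jkl}-N^r_jD^i_{\ rkl}-N^r_kD^i_{\ jrl}-N^r_lD^i_{\ jkr}$. *)

theory Defs
  imports "HOL-Analysis.Analysis"
begin

section \<open>Smooth manifolds\<close>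

text \<open>
  Class \<open>C\<^sup>k\<close> on an open subset of a finite-dimensional space; for non-open \<open>S\<close> the
  derivative at a point of \<open>S\<close> is still the unrestricted one, so only open \<open>S\<close> is meaningful.
\<close>

primrec Ck_on :: "nat \<Rightarrow> ('a::euclidean_space \<Rightarrow> 'b::euclidean_space) \<Rightarrow> 'a set \<Rightarrow> bool" where
  "Ck_on 0 f S \<longleftrightarrow> continuous_on S f"
| "Ck_on (Suc k) f S \<longleftrightarrow>
     (\<forall>x\<in>S. f differentiable (at x)) \<and> (\<forall>v. Ck_on k (\<lambda>x. frechet_derivative f (at x) v) S)"

definition smooth_on :: "'a::euclidean_space set \<Rightarrow> ('a \<Rightarrow> 'b::euclidean_space) \<Rightarrow> bool" where
  "smooth_on S f \<longleftrightarrow> (\<forall>k. Ck_on k f S)"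

text \<open>
  A chart is a pair of a domain and a coordinate map; the values of the coordinate map
  outside the domain are irrelevant.
\<close>

type_synonym ('m, 'n) chart = "'m set \<times> ('m \<Rightarrow> real ^ 'n)"

definition chart_image :: "('m, 'n::finite) chart \<Rightarrow> (real ^ 'n) set" where
  "chart_image C = snd C ` fst C"

definition is_chart :: "'m topology \<Rightarrow> ('m, 'n::finite) chart \<Rightarrow> bool" where
  "is_chart X C \<longleftrightarrow> openin X (fst C) \<and> open (chart_image C) \<and>
     homeomorphic_map (subtopology X (fst C)) (top_of_set (chart_image C)) (snd C)"

definition transition :: "('m, 'n::finite) chart \<Rightarrow> ('m, 'n) chart \<Rightarrow> real ^ 'n \<Rightarrow> real ^ 'n" where
  "transition C D = snd D \<circ> inv_into (fst C) (snd C)"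

definition overlap :: "('m, 'n::finite) chart \<Rightarrow> ('m, 'n) chart \<Rightarrow> (real ^ 'n) set" where
  "overlap C D = snd C ` (fst C \<inter> fst D)"

definition smooth_manifold :: "'m topology \<Rightarrow> ('m, 'n::finite) chart set \<Rightarrow> bool" where
  "smooth_manifold X \<A> \<longleftrightarrow> Hausdorff_space X \<and> second_countable X \<and>
     (\<forall>C\<in>\<A>. is_chart X C) \<and> (\<Union>C\<in>\<A>. fst C) = topspace X \<and>
     (\<forall>C\<in>\<A>. \<forall>D\<in>\<A>. smooth_on (overlap C D) (transition C D))"


section \<open>Riemannian metrics and 1-forms\<close>

text \<open>
  Tensor fields are families of components, one for each chart of the atlas, related on
  overlaps by the classical transformation law. Components are only relevant on the image
  of the chart.
\<close>

definition riemannian_metric ::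
  "('m, 'n::finite) chart set \<Rightarrow> (('m, 'n) chart \<Rightarrow> real ^ 'n \<Rightarrow> real ^ 'n ^ 'n) \<Rightarrow> bool" where
  "riemannian_metric \<A> a \<longleftrightarrow>
     (\<forall>C\<in>\<A>. smooth_on (chart_image C) (a C) \<and>
        (\<forall>x\<in>chart_image C. transpose (a C x) = a C x \<and> (\<forall>v. v \<noteq> 0 \<longrightarrow> v \<bullet> (a C x *v v) > 0))) \<and>
     (\<forall>C\<in>\<A>. \<forall>D\<in>\<A>. \<forall>x\<in>overlap C D. \<forall>i j.
        (let J = jacobian (transition C D) (at x) in
          a C x $ i $ j =
            (\<Sum>p\<in>UNIV. \<Sum>q\<in>UNIV. a D (transition C D x) $ p $ q * J $ p $ i * J $ q $ j)))"

definition one_form ::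
  "('m, 'n::finite) chart set \<Rightarrow> (('m, 'n) chart \<Rightarrow> real ^ 'n \<Rightarrow> real ^ 'n) \<Rightarrow> bool" where
  "one_form \<A> b \<longleftrightarrow>
     (\<forall>C\<in>\<A>. smooth_on (chart_image C) (b C)) \<and>
     (\<forall>C\<in>\<A>. \<forall>D\<in>\<A>. \<forall>x\<in>overlap C D. \<forall>i.
        (let J = jacobian (transition C D) (at x) in
          b C x $ i = (\<Sum>p\<in>UNIV. b D (transition C D x) $ p * J $ p $ i)))"


section \<open>Square metrics and Matsumoto metrics\<close>

text \<open>Functions of the induced coordinates \<open>(x, y)\<close> on the tangent bundle.\<close>

type_synonym 'n tfun = "real ^ 'n \<Rightarrow> real ^ 'n \<Rightarrow> real"

definition alpha :: "(real ^ 'n \<Rightarrow> real ^ 'n ^ 'n) \<Rightarrow> 'n::finite tfun" where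
  "alpha a x y = sqrt (\<Sum>i\<in>UNIV. \<Sum>j\<in>UNIV. a x $ i $ j * y $ i * y $ j)"

definition beta :: "(real ^ 'n \<Rightarrow> real ^ 'n) \<Rightarrow> 'n::finite tfun" where
  "beta b x y = (\<Sum>i\<in>UNIV. b x $ i * y $ i)"

definition beta_norm ::
  "(real ^ 'n \<Rightarrow> real ^ 'n ^ 'n) \<Rightarrow> (real ^ 'n \<Rightarrow> real ^ 'n) \<Rightarrow> real ^ 'n::finite \<Rightarrow> real" where
  "beta_norm a b x = sqrt (\<Sum>i\<in>UNIV. \<Sum>j\<in>UNIV. matrix_inv (a x) $ i $ j * b x $ i * b x $ j)"

text \<open>
  The bounds on \<open>beta_norm\<close> express that \<open>F\<close> is a regular Finsler metric. At \<open>y = 0\<close> both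
  formulas give \<open>F = 0\<close> because division by zero yields zero.
\<close>

definition square_metric ::
  "('m, 'n::finite) chart set \<Rightarrow> (('m, 'n) chart \<Rightarrow> real ^ 'n \<Rightarrow> real ^ 'n ^ 'n) \<Rightarrow>
   (('m, 'n) chart \<Rightarrow> real ^ 'n \<Rightarrow> real ^ 'n) \<Rightarrow> (('m, 'n) chart \<Rightarrow> 'n tfun) \<Rightarrow> bool" where
  "square_metric \<A> a b F \<longleftrightarrow> (\<forall>C\<in>\<A>. \<forall>x\<in>chart_image C.
     beta_norm (a C) (b C) x < 1 \<and>
     (\<forall>y. F C x y = alpha (a C) x y + 2 * beta (b C) x y + (beta (b C) x y)\<^sup>2 / alpha (a C) x y))"

definition matsumoto_metric ::
  "('m, 'n::finite) chart set \<Rightarrow> (('m, 'n) chart \<Rightarrow> real ^ 'n \<Rightarrow> real ^ 'n ^ 'n) \<Rightarrow>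
   (('m, 'n) chart \<Rightarrow> real ^ 'n \<Rightarrow> real ^ 'n) \<Rightarrow> (('m, 'n) chart \<Rightarrow> 'n tfun) \<Rightarrow> bool" where
  "matsumoto_metric \<A> a b F \<longleftrightarrow> (\<forall>C\<in>\<A>. \<forall>x\<in>chart_image C.
     beta_norm (a C) (b C) x < 1 / 2 \<and>
     (\<forall>y. F C x y = (alpha (a C) x y)\<^sup>2 / (alpha (a C) x y - beta (b C) x y)))"


section \<open>Curvatures in induced coordinates\<close>

definition Dx :: "'n \<Rightarrow> 'n::finite tfun \<Rightarrow> 'n tfun" where
  "Dx i f x y = deriv (\<lambda>t. f (x + t *\<^sub>R axis i 1) y) 0"

definition Dy :: "'n \<Rightarrow> 'n::finite tfun \<Rightarrow> 'n tfun" where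
  "Dy i f x y = deriv (\<lambda>t. f x (y + t *\<^sub>R axis i 1)) 0"

definition fundamental_tensor :: "'n::finite tfun \<Rightarrow> real ^ 'n \<Rightarrow> real ^ 'n \<Rightarrow> real ^ 'n ^ 'n" where
  "fundamental_tensor F x y = (\<chi> i j. 1 / 2 * Dy j (Dy i (\<lambda>x y. (F x y)\<^sup>2)) x y)"

definition spray_coeff :: "'n::finite tfun \<Rightarrow> 'n \<Rightarrow> 'n tfun" where
  "spray_coeff F i x y = 1 / 4 * (\<Sum>l\<in>UNIV. matrix_inv (fundamental_tensor F x y) $ i $ l *
     ((\<Sum>k\<in>UNIV. Dx k (Dy l (\<lambda>x y. (F x y)\<^sup>2)) x y * y $ k) - Dx l (\<lambda>x y. (F x y)\<^sup>2) x y))"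

text \<open>In \<open>berwald_curv\<close> and \<open>douglas_curv\<close> the first index is the contravariant one.\<close>

definition berwald_curv :: "'n::finite tfun \<Rightarrow> 'n \<Rightarrow> 'n \<Rightarrow> 'n \<Rightarrow> 'n \<Rightarrow> 'n tfun" where
  "berwald_curv F i j k l = Dy j (Dy k (Dy l (spray_coeff F i)))"

definition mean_berwald_curv :: "'n::finite tfun \<Rightarrow> 'n \<Rightarrow> 'n \<Rightarrow> 'n tfun" where
  "mean_berwald_curv F j k x y = 1 / 2 * (\<Sum>m\<in>UNIV. berwald_curv F m j k m x y)"

definition angular_metric :: "'n::finite tfun \<Rightarrow> 'n \<Rightarrow> 'n \<Rightarrow> 'n tfun" where
  "angular_metric F i j x y =
     (let g = fundamental_tensor F x y; yl = (\<lambda>i. \<Sum>j\<in>UNIV. g $ i $ j * y $ j)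
      in g $ i $ j - yl i * yl j / (F x y)\<^sup>2)"

definition douglas_curv :: "'n::finite tfun \<Rightarrow> 'n \<Rightarrow> 'n \<Rightarrow> 'n \<Rightarrow> 'n \<Rightarrow> 'n tfun" where
  "douglas_curv F i j k l = Dy j (Dy k (Dy l (\<lambda>x y.
     spray_coeff F i x y
     - 1 / (real CARD('n) + 1) * (\<Sum>m\<in>UNIV. Dy m (spray_coeff F m) x y) * y $ i)))"

definition nonlinear_conn :: "'n::finite tfun \<Rightarrow> 'n \<Rightarrow> 'n \<Rightarrow> 'n tfun" where
  "nonlinear_conn F i j = Dy j (spray_coeff F i)"

text \<open>
  \<open>D\<^sup>i\<^bsub>jkl|m\<^esub> y\<^sup>m\<close>: the connection coefficients of the Berwald connection contracted with
  \<open>y\<close> are \<open>N\<^sup>i\<^bsub>j\<^esub>\<close>, and \<open>N\<^sup>r\<^bsub>m\<^esub> y\<^sup>m = 2 G\<^sup>r\<close> by homogeneity.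
\<close>

definition douglas_hderiv :: "'n::finite tfun \<Rightarrow> 'n \<Rightarrow> 'n \<Rightarrow> 'n \<Rightarrow> 'n \<Rightarrow> 'n tfun" where
  "douglas_hderiv F i j k l x y =
     (\<Sum>m\<in>UNIV. y $ m * Dx m (douglas_curv F i j k l) x y)
     - 2 * (\<Sum>m\<in>UNIV. spray_coeff F m x y * Dy m (douglas_curv F i j k l) x y)
     + (\<Sum>r\<in>UNIV. nonlinear_conn F i r x y * douglas_curv F r j k l x y)
     - (\<Sum>r\<in>UNIV. nonlinear_conn F r j x y * douglas_curv F i r k l x y)
     - (\<Sum>r\<in>UNIV. nonlinear_conn F r k x y * douglas_curv F i j r l x y)
     - (\<Sum>r\<in>UNIV. nonlinear_conn F r l x y * douglas_curv F i j k r x y)"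


section \<open>Special Finsler metrics\<close>

text \<open>
  Tensors of type \<open>T\<^bsub>jkl\<^esub>\<close> on the slit tangent bundle. The induced coordinates transform by
  \<open>(x, y) \<mapsto> (\<tau> x, J y)\<close>, where \<open>\<tau>\<close> is the transition map and \<open>J\<close> its Jacobian at \<open>x\<close>.
\<close>

definition slit_tensor3 ::
  "('m, 'n::finite) chart set \<Rightarrow> (('m, 'n) chart \<Rightarrow> 'n \<Rightarrow> 'n \<Rightarrow> 'n \<Rightarrow> 'n tfun) \<Rightarrow> bool" where
  "slit_tensor3 \<A> T \<longleftrightarrow> (\<forall>C\<in>\<A>. \<forall>D\<in>\<A>. \<forall>x\<in>overlap C D. \<forall>y. y \<noteq> 0 \<longrightarrow> (\<forall>j k l.
     (let J = jacobian (transition C D) (at x) in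
       T C j k l x y = (\<Sum>p\<in>UNIV. \<Sum>q\<in>UNIV. \<Sum>r\<in>UNIV.
         T D p q r (transition C D x) (J *v y) * J $ p $ j * J $ q $ k * J $ r $ l))))"

definition generalized_douglas_weyl ::
  "('m, 'n::finite) chart set \<Rightarrow> (('m, 'n) chart \<Rightarrow> 'n tfun) \<Rightarrow> bool" where
  "generalized_douglas_weyl \<A> F \<longleftrightarrow> (\<exists>T. slit_tensor3 \<A> T \<and>
     (\<forall>C\<in>\<A>. \<forall>x\<in>chart_image C. \<forall>y. y \<noteq> 0 \<longrightarrow> (\<forall>i j k l.
        douglas_hderiv (F C) i j k l x y = T C j k l x y * y $ i)))"

definition isotropic_mean_berwald ::
  "('m, 'n::finite) chart set \<Rightarrow> (('m, 'n) chart \<Rightarrow> 'n tfun) \<Rightarrow> bool" where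
  "isotropic_mean_berwald \<A> F \<longleftrightarrow> (\<exists>c :: 'm \<Rightarrow> real.
     \<forall>C\<in>\<A>. \<forall>p\<in>fst C. \<forall>y. y \<noteq> 0 \<longrightarrow> (\<forall>j k.
       mean_berwald_curv (F C) j k (snd C p) y =
         (real CARD('n) + 1) / 2 * c p * inverse (F C (snd C p) y) *
         angular_metric (F C) j k (snd C p) y))"

definition berwald_metric ::
  "('m, 'n::finite) chart set \<Rightarrow> (('m, 'n) chart \<Rightarrow> 'n tfun) \<Rightarrow> bool" where
  "berwald_metric \<A> F \<longleftrightarrow> (\<forall>C\<in>\<A>. \<forall>x\<in>chart_image C. \<forall>y. y \<noteq> 0 \<longrightarrow> (\<forall>i j k l.
     berwald_curv (F C) i j k l x y = 0))"

end

theory Submission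
  imports Defs
begin

text \<open>
  Write \<open>F = \<alpha> \<phi>(s)\<close> with \<open>s = \<beta>/\<alpha>\<close>. Both metrics have \<open>\<phi>(s) = (1 + \<epsilon> s)\<^sup>m\<close> where
  \<open>m (m - 1) = 2\<close>: the square metric has \<open>m = 2\<close>, \<open>\<epsilon> = 1\<close>, the Matsumoto metric \<open>m = -1\<close>,
  \<open>\<epsilon> = -1\<close>. With \<open>\<kappa> = m \<epsilon>\<close> and \<open>\<lambda> = (m - 1) \<epsilon>\<close>, so that \<open>\<kappa> \<lambda> = 2\<close> and \<open>\<epsilon> = \<kappa> - \<lambda>\<close>, the
  logarithmic derivatives of \<open>F\<close> are rational in \<open>(\<alpha>, \<beta>)\<close> with coefficients in \<open>\<kappa>, \<lambda>\<close>. This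
  lets one computation serve both metrics; \<open>\<phi>\<close> itself is needed only in a final polynomial identity.

  Let \<open>r\<^sub>i\<^sub>j\<close> and \<open>s\<^sub>i\<^sub>j\<close> be the symmetric and the skew part of the covariant derivative of \<open>\<beta>\<close>
  with respect to \<open>\<alpha>\<close>; an index \<open>0\<close> means contraction with \<open>y\<close>, and \<open>s\<^sub>0\<close> is the contraction of
  \<open>s\<^sub>i\<^sub>0\<close> with the vector \<open>b\<close> dual to \<open>\<beta>\<close>. The spray of \<open>F\<close> is that of \<open>\<alpha>\<close> plus
  \<open>P s\<^sup>i\<^sub>0 + p y\<^sup>i + \<mu> b\<^sup>i\<close>, where \<open>p\<close> and \<open>\<mu>\<close> are multiples of \<open>r\<^sub>0\<^sub>0 - 2 P s\<^sub>0\<close> (lemma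
  \<open>spray_coeff_eq\<close>). Hence \<open>F\<close> is a Berwald metric once \<open>\<beta>\<close> is parallel, and the two curvature
  hypotheses are used to kill first \<open>r\<^sub>i\<^sub>j\<close> and \<open>s\<^sub>0\<close>, then the rest of \<open>s\<^sub>i\<^sub>j\<close>.

  The mean Berwald curvature is half the fibre Hessian of the divergence \<open>\<partial>G\<^sup>m/\<partial>y\<^sup>m\<close>, and
  \<open>F\<^sup>-\<^sup>1 h\<close> is the fibre Hessian of \<open>F\<close>. So isotropy says that \<open>\<partial>G\<^sup>m/\<partial>y\<^sup>m - (n + 1) c F\<close> has
  vanishing Hessian; for \<open>n \<ge> 2\<close> the punctured fibre is connected and this function is linear in \<open>y\<close>.
  On the part \<open>\<alpha> = 1\<close> of a plane spanned by \<open>b\<close> and a vector orthogonal to it, this is an identity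
  between rational functions of \<open>s\<close>, which splits into an even and an odd part. Evaluating at the
  zeros of the common denominator \<open>q\<close> and at a few other points gives \<open>r\<^sub>0\<^sub>0 = 0\<close> and \<open>s\<^sub>0 = 0\<close>
  wherever \<open>\<beta> \<noteq> 0\<close> (\<open>isotropic_rigid\<close>).

  After that the Douglas tensor is the third fibre derivative of \<open>P s\<^sup>i\<^sub>0\<close>, so \<open>b\<^sub>i D\<^sup>i\<^sub>j\<^sub>k\<^sub>l = 0\<close>
  identically. Contracting \<open>D\<^sup>i\<^sub>j\<^sub>k\<^sub>l\<^sub>|\<^sub>m y\<^sup>m = T\<^sub>j\<^sub>k\<^sub>l y\<^sup>i\<close> with \<open>b\<^sub>i\<close> therefore leaves
  \<open>- s\<^sub>i\<^sub>0 D\<^sup>i\<^sub>j\<^sub>k\<^sub>l = T\<^sub>j\<^sub>k\<^sub>l \<beta>\<close>. If \<open>\<beta>(y) = 0\<close>, contracting \<open>j, k, l\<close> with \<open>b\<close> turns the left side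
  into a nonzero multiple of \<open>s\<^sub>i\<^sub>0 s\<^sup>i\<^sub>0\<close>, and \<open>s\<^sub>i\<^sub>j = 0\<close> follows (\<open>douglas_rigid\<close>).

  Points where \<open>\<beta>\<close> vanishes are reached by continuity, unless \<open>\<beta>\<close> vanishes nearby, when its
  derivatives vanish as well. In dimension one every spray is quadratic on each of the two rays of a
  fibre, so that the Berwald curvature vanishes.
\<close>

section \<open>Calculus of smooth functions\<close>

lemma Ck_on_SucD: "Ck_on (Suc k) f S \<Longrightarrow> Ck_on k f S"
proof (induction k arbitrary: f)
  case 0
  then show ?case
    by (auto intro!: differentiable_imp_continuous_on simp: differentiable_on_def differentiable_at_withinI)
next
  case (Suc k)
  then show ?case by simp
qed

lemma Ck_on_cong:
  assumes "open S" "\<And>x. x \<in> S \<Longrightarrow> f x = g x" "Ck_on k f S"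
  shows "Ck_on k g S"
  using assms(2,3)
proof (induction k arbitrary: f g)
  case 0
  then show ?case by (metis Ck_on.simps(1) continuous_on_cong)
next
  case (Suc k)
  have diff: "g differentiable (at x)" and fr: "frechet_derivative f (at x) = frechet_derivative g (at x)"
    if x: "x \<in> S" for x
  proof -
    have "f differentiable (at x)" using Suc.prems(2) x by simp
    then have "(f has_derivative frechet_derivative f (at x)) (at x)"
      by (simp add: frechet_derivative_works)
    then have g: "(g has_derivative frechet_derivative f (at x)) (at x)"
      using has_derivative_transform_within_open[OF _ assms(1) x] Suc.prems(1) by blast
    then show "g differentiable (at x)" by (auto simp: differentiable_def)
    show "frechet_derivative f (at x) = frechet_derivative g (at x)"
      using frechet_derivative_at[OF g] .
  qed
  have "Ck_on k (\<lambda>x. frechet_derivative g (at x) v) S" for v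
    by (rule Suc.IH[of "\<lambda>x. frechet_derivative f (at x) v"]) (use fr Suc.prems(2) in auto)
  then show ?case using diff by simp
qed

text \<open>Every closure property below is proved by exhibiting the directional derivative as an
  expression to which the induction hypothesis applies.\<close>

lemma Ck_on_SucI:
  assumes "open S" "\<And>x. x \<in> S \<Longrightarrow> (f has_derivative f' x) (at x)"
    "\<And>v. Ck_on k (\<lambda>x. f' x v) S"
  shows "Ck_on (Suc k) f S"
proof -
  have "Ck_on k (\<lambda>x. frechet_derivative f (at x) v) S" for v
    by (rule Ck_on_cong[OF assms(1) _ assms(3)[of v]])
      (simp add: frechet_derivative_at[OF assms(2), symmetric])
  then show ?thesis using assms(2) by (auto simp: differentiable_def)
qed

lemma Ck_on_SucE:
  assumes "Ck_on (Suc k) f S"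
  shows "\<And>x. x \<in> S \<Longrightarrow> (f has_derivative frechet_derivative f (at x)) (at x)"
    and "\<And>v. Ck_on k (\<lambda>x. frechet_derivative f (at x) v) S"
  using assms by (auto simp: frechet_derivative_works)

lemma Ck_on_const: "open S \<Longrightarrow> Ck_on k (\<lambda>x. c) S"
  by (induction k arbitrary: c) (auto simp: frechet_derivative_const)

lemma Ck_on_bounded_linear:
  assumes "open S" "bounded_linear h" "Ck_on k f S"
  shows "Ck_on k (\<lambda>x. h (f x)) S"
  using assms(3)
proof (induction k arbitrary: f)
  case 0
  then show ?case using assms(2) by (simp add: linear_continuous_on bounded_linear.continuous_on)
next
  case (Suc k)
  note E = Ck_on_SucE[OF Suc.prems]
  show ?case
    by (rule Ck_on_SucI[OF assms(1) bounded_linear.has_derivative[OF assms(2) E(1)]])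
      (use Suc.IH[OF E(2)] in auto)
qed

lemma Ck_on_linear: "open S \<Longrightarrow> bounded_linear h \<Longrightarrow> Ck_on k h S"
proof (induction k)
  case (Suc k)
  then show ?case
    by (intro Ck_on_SucI[where f'="\<lambda>_. h"] Ck_on_const bounded_linear_imp_has_derivative)
qed (simp add: linear_continuous_on)

lemma Ck_on_add:
  assumes "open S" "Ck_on k f S" "Ck_on k g S"
  shows "Ck_on k (\<lambda>x. f x + g x) S"
  using assms(2,3)
proof (induction k arbitrary: f g)
  case (Suc k)
  note E = Ck_on_SucE[OF Suc.prems(1)] Ck_on_SucE[OF Suc.prems(2)]
  show ?case
    by (rule Ck_on_SucI[OF assms(1) has_derivative_add[OF E(1,3)]]) (use Suc.IH E in auto)
qed (simp add: continuous_on_add)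

lemma Ck_on_mult:
  fixes f g :: "'a::euclidean_space \<Rightarrow> real"
  assumes "open S" "Ck_on k f S" "Ck_on k g S"
  shows "Ck_on k (\<lambda>x. f x * g x) S"
  using assms(2,3)
proof (induction k arbitrary: f g)
  case (Suc k)
  note E = Ck_on_SucE[OF Suc.prems(1)] Ck_on_SucE[OF Suc.prems(2)]
  show ?case
    by (rule Ck_on_SucI[OF assms(1) has_derivative_mult[OF E(1,3)]])
      (intro Ck_on_add Suc.IH assms(1) E(2,4) Ck_on_SucD[OF Suc.prems(1)] Ck_on_SucD[OF Suc.prems(2)] | assumption)+
qed (simp add: continuous_on_mult)

lemma Ck_on_inverse:
  fixes f :: "'a::euclidean_space \<Rightarrow> real"
  assumes "open S" "\<And>x. x \<in> S \<Longrightarrow> f x \<noteq> 0" "Ck_on k f S"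
  shows "Ck_on k (\<lambda>x. inverse (f x)) S"
  using assms(3)
proof (induction k)
  case (Suc k)
  note E = Ck_on_SucE[OF Suc.prems]
  have D: "((\<lambda>x. inverse (f x)) has_derivative
      (\<lambda>h. (-1) * (frechet_derivative f (at x) h * (inverse (f x) * inverse (f x))))) (at x)"
    if "x \<in> S" for x
    by (rule has_derivative_eq_rhs[OF Deriv.has_derivative_inverse[OF assms(2)[OF that] E(1)[OF that]]])
      (simp add: fun_eq_iff)
  have k: "Ck_on k (\<lambda>x. inverse (f x)) S" by (rule Suc.IH[OF Ck_on_SucD[OF Suc.prems]])
  show ?case
    by (rule Ck_on_SucI[OF assms(1) D], assumption) (intro Ck_on_mult Ck_on_const assms(1) E(2) k)
qed (use assms(2) in \<open>auto intro!: continuous_on_inverse\<close>)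

lemma Ck_on_sqrt:
  fixes f :: "'a::euclidean_space \<Rightarrow> real"
  assumes "open S" "\<And>x. x \<in> S \<Longrightarrow> f x > 0" "Ck_on k f S"
  shows "Ck_on k (\<lambda>x. sqrt (f x)) S"
  using assms(3)
proof (induction k)
  case (Suc k)
  note E = Ck_on_SucE[OF Suc.prems]
  have D: "((\<lambda>x. sqrt (f x)) has_derivative
      (\<lambda>h. 1/2 * (frechet_derivative f (at x) h * inverse (sqrt (f x))))) (at x)"
    if "x \<in> S" for x
    by (rule has_derivative_eq_rhs[OF has_derivative_real_sqrt[OF assms(2)[OF that] E(1)[OF that]]])
      (simp add: fun_eq_iff field_simps)
  have k: "Ck_on k (\<lambda>x. inverse (sqrt (f x))) S"
  proof (rule Ck_on_inverse[OF assms(1) _ Suc.IH[OF Ck_on_SucD[OF Suc.prems]]])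
    show "sqrt (f x) \<noteq> 0" if "x \<in> S" for x using assms(2)[OF that] by simp
  qed
  show ?case
    by (rule Ck_on_SucI[OF assms(1) D], assumption) (intro Ck_on_mult Ck_on_const assms(1) E(2) k)
qed (auto intro!: continuous_on_real_sqrt)

lemma Ck_on_compose_linear:
  assumes "open S" "open T" "bounded_linear h" "h ` T \<subseteq> S" "Ck_on k f S"
  shows "Ck_on k (\<lambda>x. f (h x)) T"
  using assms(5)
proof (induction k arbitrary: f)
  case 0
  then show ?case
    using continuous_on_compose2[of S f T h] linear_continuous_on[OF assms(3)] assms(4) by simp
next
  case (Suc k)
  note E = Ck_on_SucE[OF Suc.prems]
  have D: "((\<lambda>x. f (h x)) has_derivative (\<lambda>v. frechet_derivative f (at (h x)) (h v))) (at x)"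
    if "x \<in> T" for x
    using has_derivative_compose[OF bounded_linear_imp_has_derivative[OF assms(3)] E(1)] that assms(4)
    by blast
  show ?case
    by (rule Ck_on_SucI[OF assms(2) D]) (use Suc.IH[OF E(2)] in auto)
qed

lemma smooth_on_cong:
  "open S \<Longrightarrow> (\<And>x. x \<in> S \<Longrightarrow> f x = g x) \<Longrightarrow> smooth_on S f \<Longrightarrow> smooth_on S g"
  unfolding smooth_on_def using Ck_on_cong by blast

lemma smooth_on_const: "open S \<Longrightarrow> smooth_on S (\<lambda>x. c)"
  by (simp add: smooth_on_def Ck_on_const)

lemma smooth_on_add:
  "open S \<Longrightarrow> smooth_on S f \<Longrightarrow> smooth_on S g \<Longrightarrow> smooth_on S (\<lambda>x. f x + g x)"
  by (simp add: smooth_on_def Ck_on_add)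

lemma smooth_on_mult:
  fixes f g :: "'a::euclidean_space \<Rightarrow> real"
  shows "open S \<Longrightarrow> smooth_on S f \<Longrightarrow> smooth_on S g \<Longrightarrow> smooth_on S (\<lambda>x. f x * g x)"
  by (simp add: smooth_on_def Ck_on_mult)

lemma smooth_on_diff:
  fixes f g :: "'a::euclidean_space \<Rightarrow> real"
  assumes "open S" "smooth_on S f" "smooth_on S g"
  shows "smooth_on S (\<lambda>x. f x - g x)"
  using smooth_on_add[OF assms(1,2) smooth_on_mult[OF assms(1) smooth_on_const[OF assms(1)] assms(3)], of "-1"]
  by simp

lemma smooth_on_sum:
  fixes f :: "'i \<Rightarrow> 'a::euclidean_space \<Rightarrow> real"
  assumes "open S" "\<And>i. i \<in> I \<Longrightarrow> smooth_on S (f i)"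
  shows "smooth_on S (\<lambda>x. \<Sum>i\<in>I. f i x)"
  using assms(2)
  by (induction I rule: infinite_finite_induct) (auto simp: smooth_on_const smooth_on_add assms(1))

lemma smooth_on_prod:
  fixes f :: "'i \<Rightarrow> 'a::euclidean_space \<Rightarrow> real"
  assumes "open S" "\<And>i. i \<in> I \<Longrightarrow> smooth_on S (f i)"
  shows "smooth_on S (\<lambda>x. \<Prod>i\<in>I. f i x)"
  using assms(2)
  by (induction I rule: infinite_finite_induct) (auto simp: smooth_on_const smooth_on_mult assms(1))

lemma smooth_on_divide:
  fixes f g :: "'a::euclidean_space \<Rightarrow> real"
  assumes "open S" "smooth_on S f" "smooth_on S g" "\<And>x. x \<in> S \<Longrightarrow> g x \<noteq> 0"
  shows "smooth_on S (\<lambda>x. f x / g x)"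
  unfolding divide_inverse
  by (rule smooth_on_mult[OF assms(1,2)]) (use assms in \<open>simp add: smooth_on_def Ck_on_inverse\<close>)

lemma smooth_on_sqrt:
  fixes f :: "'a::euclidean_space \<Rightarrow> real"
  shows "open S \<Longrightarrow> (\<And>x. x \<in> S \<Longrightarrow> f x > 0) \<Longrightarrow> smooth_on S f \<Longrightarrow> smooth_on S (\<lambda>x. sqrt (f x))"
  by (simp add: smooth_on_def Ck_on_sqrt)

lemma smooth_on_bounded_linear:
  "open S \<Longrightarrow> bounded_linear h \<Longrightarrow> smooth_on S f \<Longrightarrow> smooth_on S (\<lambda>x. h (f x))"
  by (simp add: smooth_on_def Ck_on_bounded_linear)

lemma smooth_on_frechet:
  "smooth_on S f \<Longrightarrow> smooth_on S (\<lambda>x. frechet_derivative f (at x) v)"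
  unfolding smooth_on_def by (metis Ck_on.simps(2))

lemma smooth_on_differentiable:
  "smooth_on S f \<Longrightarrow> x \<in> S \<Longrightarrow> (f has_derivative frechet_derivative f (at x)) (at x)"
  unfolding smooth_on_def by (meson Ck_on_SucE(1))

lemma smooth_on_imp_continuous_on: "smooth_on S f \<Longrightarrow> continuous_on S f"
  unfolding smooth_on_def by (metis Ck_on.simps(1))

lemma smooth_on_subset:
  assumes "open S" "open T" "T \<subseteq> S" "smooth_on S f"
  shows "smooth_on T f"
  using Ck_on_compose_linear[OF assms(1,2) bounded_linear_ident, of _ f] assms(3,4)
  by (simp add: smooth_on_def)

lemma smooth_on_component:
  fixes f :: "'a::euclidean_space \<Rightarrow> 'b::euclidean_space ^ 'n"
  shows "open S \<Longrightarrow> smooth_on S f \<Longrightarrow> smooth_on S (\<lambda>x. f x $ i)"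
  by (rule smooth_on_bounded_linear[OF _ bounded_linear_vec_nth])

lemma matrix_inv_inverse:
  fixes A :: "real ^ 'n ^ 'n"
  assumes "det A \<noteq> 0"
  shows "A ** matrix_inv A = mat 1" "matrix_inv A ** A = mat 1"
  using assms someI_ex[of "\<lambda>A'. A ** A' = mat 1 \<and> A' ** A = mat 1"]
  by (auto simp: invertible_det_nz[symmetric] invertible_def matrix_inv_def)

text \<open>Cramer's rule writes the entries of the inverse as quotients of determinants, which are
  polynomials in the entries.\<close>

lemma matrix_inv_cramer:
  fixes A :: "real ^ 'n ^ 'n"
  assumes "det A \<noteq> 0"
  shows "matrix_inv A $ k $ l = det (\<chi> i j. if j = k then (axis l 1 :: real ^ 'n) $ i else A $ i $ j) / det A"
proof -
  have "A ** matrix_inv A = mat 1"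
    by (rule matrix_inv_inverse[OF assms])
  then have "A *v (matrix_inv A *v axis l 1) = axis l 1"
    by (simp add: matrix_vector_mul_assoc)
  then have "matrix_inv A *v axis l 1 = (\<chi> k. det (\<chi> i j. if j = k then (axis l 1 :: real ^ 'n) $ i else A $ i $ j) / det A)"
    using cramer[OF assms] by blast
  moreover have "(matrix_inv A *v axis l 1) $ k = matrix_inv A $ k $ l"
    by (simp add: matrix_vector_mult_basis column_def)
  ultimately show ?thesis by simp
qed

lemma smooth_on_det:
  fixes A :: "'a::euclidean_space \<Rightarrow> real ^ 'n ^ 'n"
  assumes "open S" "\<And>i j. smooth_on S (\<lambda>x. A x $ i $ j)"
  shows "smooth_on S (\<lambda>x. det (A x))"
  unfolding det_def
  by (intro smooth_on_sum smooth_on_mult smooth_on_prod smooth_on_const assms)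

lemma smooth_on_matrix_inv:
  fixes A :: "'a::euclidean_space \<Rightarrow> real ^ 'n ^ 'n"
  assumes "open S" "\<And>i j. smooth_on S (\<lambda>x. A x $ i $ j)" "\<And>x. x \<in> S \<Longrightarrow> det (A x) \<noteq> 0"
  shows "smooth_on S (\<lambda>x. matrix_inv (A x) $ k $ l)"
proof -
  have E: "smooth_on S (\<lambda>x. (\<chi> i j. if j = k then (axis l 1 :: real ^ 'n) $ i else A x $ i $ j) $ i $ j)" for i j
    using assms by (cases "j = k") (simp_all add: smooth_on_const)
  show ?thesis
    by (rule smooth_on_cong[OF assms(1) matrix_inv_cramer[symmetric, OF assms(3)]], assumption)
      (intro smooth_on_divide smooth_on_det assms E)
qed

section \<open>Partial derivatives on the slit tangent bundle\<close>

text \<open>A function of \<open>(x, y)\<close> is regarded as a function on the product space, so that smoothness is joint in \<open>x\<close>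
  and \<open>y\<close>; the zero section is removed because \<open>\<alpha>\<close> is not smooth there.\<close>

definition smooth_slit :: "(real ^ 'n) set \<Rightarrow> 'n::finite tfun \<Rightarrow> bool" where
  "smooth_slit U f \<longleftrightarrow> smooth_on (U \<times> (- {0})) (\<lambda>z. f (fst z) (snd z))"

lemma open_slit: "open U \<Longrightarrow> open (U \<times> (- {0 :: real ^ 'n::finite}))"
  by (intro open_Times open_Compl) auto

lemma slit_cong:
  assumes "open U" "\<And>x y. x \<in> U \<Longrightarrow> y \<noteq> 0 \<Longrightarrow> f x y = g x y" "smooth_slit U f"
  shows "smooth_slit U g"
  unfolding smooth_slit_def
proof (rule smooth_on_cong[OF open_slit[OF assms(1)] _ assms(3)[unfolded smooth_slit_def]])
  show "f (fst z) (snd z) = g (fst z) (snd z)" if "z \<in> U \<times> - {0}" for z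
    using assms(2) that by (simp add: mem_Times_iff)
qed

lemma slit_subset: "open U \<Longrightarrow> open V \<Longrightarrow> V \<subseteq> U \<Longrightarrow> smooth_slit U f \<Longrightarrow> smooth_slit V f"
  unfolding smooth_slit_def
  by (rule smooth_on_subset[OF open_slit open_slit]) auto

lemma slit_base:
  assumes "open U" "smooth_on U g"
  shows "smooth_slit U (\<lambda>x y. g x)"
  unfolding smooth_slit_def smooth_on_def
  by (intro allI Ck_on_compose_linear[OF assms(1) open_slit[OF assms(1)] bounded_linear_fst])
    (use assms(2) in \<open>auto simp: smooth_on_def\<close>)

lemma slit_fibre: "open U \<Longrightarrow> smooth_slit U (\<lambda>x y. y $ i)"
  unfolding smooth_slit_def smooth_on_def
  by (intro allI Ck_on_linear open_slit bounded_linear_compose[OF bounded_linear_vec_nth bounded_linear_snd])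

lemma slit_const: "open U \<Longrightarrow> smooth_slit U (\<lambda>x y. c)"
  by (simp add: smooth_slit_def smooth_on_const open_slit)

lemma slit_add: "open U \<Longrightarrow> smooth_slit U f \<Longrightarrow> smooth_slit U g \<Longrightarrow> smooth_slit U (\<lambda>x y. f x y + g x y)"
  and slit_diff: "open U \<Longrightarrow> smooth_slit U f \<Longrightarrow> smooth_slit U g \<Longrightarrow> smooth_slit U (\<lambda>x y. f x y - g x y)"
  and slit_mult: "open U \<Longrightarrow> smooth_slit U f \<Longrightarrow> smooth_slit U g \<Longrightarrow> smooth_slit U (\<lambda>x y. f x y * g x y)"
  by (simp_all add: smooth_slit_def smooth_on_add smooth_on_diff smooth_on_mult open_slit)

lemma slit_divide:
  "open U \<Longrightarrow> smooth_slit U f \<Longrightarrow> smooth_slit U g \<Longrightarrow> (\<And>x y. x \<in> U \<Longrightarrow> y \<noteq> 0 \<Longrightarrow> g x y \<noteq> 0) \<Longrightarrow>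
    smooth_slit U (\<lambda>x y. f x y / g x y)"
  unfolding smooth_slit_def by (rule smooth_on_divide[OF open_slit]) (auto simp: mem_Times_iff)

lemma slit_sqrt:
  "open U \<Longrightarrow> smooth_slit U f \<Longrightarrow> (\<And>x y. x \<in> U \<Longrightarrow> y \<noteq> 0 \<Longrightarrow> f x y > 0) \<Longrightarrow>
    smooth_slit U (\<lambda>x y. sqrt (f x y))"
  unfolding smooth_slit_def by (rule smooth_on_sqrt[OF open_slit]) (auto simp: mem_Times_iff)

lemma slit_sum:
  "open U \<Longrightarrow> (\<And>i. i \<in> I \<Longrightarrow> smooth_slit U (f i)) \<Longrightarrow> smooth_slit U (\<lambda>x y. \<Sum>i\<in>I. f i x y)"
  by (simp add: smooth_slit_def smooth_on_sum open_slit)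

lemmas slit_intros = slit_add slit_diff slit_mult slit_sum slit_const slit_fibre

definition grad_x :: "'n::finite tfun \<Rightarrow> real ^ 'n \<Rightarrow> real ^ 'n \<Rightarrow> real ^ 'n" where
  "grad_x f x y = (\<chi> i. Dx i f x y)"

definition grad_y :: "'n::finite tfun \<Rightarrow> real ^ 'n \<Rightarrow> real ^ 'n \<Rightarrow> real ^ 'n" where
  "grad_y f x y = (\<chi> i. Dy i f x y)"

lemma linear_eq_inner_axis:
  fixes h :: "real ^ 'n \<Rightarrow> real"
  assumes "linear h"
  shows "h u = (\<chi> i. h (axis i 1)) \<bullet> u"
proof -
  have "h u = h (\<Sum>i\<in>UNIV. u $ i *\<^sub>R axis i 1)"
    using basis_expansion[of u] by (simp add: scalar_mult_eq_scaleR)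
  also have "\<dots> = (\<Sum>i\<in>UNIV. u $ i * h (axis i 1))"
    using assms by (simp add: linear_sum linear_scale)
  finally show ?thesis by (simp add: inner_vec_def mult.commute)
qed

text \<open>The total derivative of a smooth function on the slit tangent bundle is assembled from the
  coordinatewise derivatives; through this lemma every identity between partial derivatives
  becomes an identity between derivatives along curves.\<close>

lemma slit_has_derivative:
  assumes U: "open U" "smooth_slit U f" "x \<in> U" "y \<noteq> 0"
  shows "((\<lambda>z. f (fst z) (snd z)) has_derivative
      (\<lambda>h. grad_x f x y \<bullet> fst h + grad_y f x y \<bullet> snd h)) (at (x, y))"
    and "Dx i f x y = frechet_derivative (\<lambda>z. f (fst z) (snd z)) (at (x, y)) (axis i 1, 0)"
    and "Dy i f x y = frechet_derivative (\<lambda>z. f (fst z) (snd z)) (at (x, y)) (0, axis i 1)"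
proof -
  define f' where "f' = frechet_derivative (\<lambda>z. f (fst z) (snd z)) (at (x, y))"
  have D: "((\<lambda>z. f (fst z) (snd z)) has_derivative f') (at (x, y))"
    unfolding f'_def by (rule smooth_on_differentiable[OF U(2)[unfolded smooth_slit_def]]) (use U in auto)
  have lin: "linear f'" using D has_derivative_linear by blast
  have der: "((\<lambda>t. f (x + t *\<^sub>R u) (y + t *\<^sub>R w)) has_real_derivative f' (u, w)) (at 0)" for u w
  proof -
    have "((\<lambda>t. (x + t *\<^sub>R u, y + t *\<^sub>R w)) has_derivative (\<lambda>t. (t *\<^sub>R u, t *\<^sub>R w))) (at 0)"
      by (auto intro!: derivative_eq_intros)
    then have "((\<lambda>t. f (fst (x + t *\<^sub>R u, y + t *\<^sub>R w)) (snd (x + t *\<^sub>R u, y + t *\<^sub>R w)))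
        has_derivative (\<lambda>t. f' (t *\<^sub>R u, t *\<^sub>R w))) (at 0)"
      by (rule has_derivative_compose) (use D in simp)
    moreover have "f' (t *\<^sub>R u, t *\<^sub>R w) = t * f' (u, w)" for t
      using linear_scale[OF lin, of t "(u, w)"] by simp
    ultimately show ?thesis by (simp add: has_field_derivative_def mult.commute[of _ "f' (u, w)"])
  qed
  show x: "Dx i f x y = frechet_derivative (\<lambda>z. f (fst z) (snd z)) (at (x, y)) (axis i 1, 0)" for i
    using DERIV_imp_deriv[OF der[of "axis i 1" 0]] by (simp add: Dx_def f'_def)
  show y: "Dy i f x y = frechet_derivative (\<lambda>z. f (fst z) (snd z)) (at (x, y)) (0, axis i 1)" for i
    using DERIV_imp_deriv[OF der[of 0 "axis i 1"]] by (simp add: Dy_def f'_def)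
  have "f' h = grad_x f x y \<bullet> fst h + grad_y f x y \<bullet> snd h" for h
  proof -
    have l: "linear (\<lambda>u. f' (u, 0))" "linear (\<lambda>w. f' (0, w))"
      using linear_compose[OF _ lin, of "\<lambda>u. (u, 0)"] linear_compose[OF _ lin, of "\<lambda>w. (0, w)"]
      by (auto simp: o_def linear_iff)
    have g: "grad_x f x y = (\<chi> i. f' (axis i 1, 0))" "grad_y f x y = (\<chi> i. f' (0, axis i 1))"
      by (simp_all add: grad_x_def grad_y_def x y f'_def)
    have "f' (u, 0) = grad_x f x y \<bullet> u" for u
      unfolding g by (rule linear_eq_inner_axis[OF l(1)])
    moreover have "f' (0, u) = grad_y f x y \<bullet> u" for u
      unfolding g by (rule linear_eq_inner_axis[OF l(2)])
    moreover have "f' h = f' (fst h, 0) + f' (0, snd h)"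
      using linear_add[OF lin, of "(fst h, 0)" "(0, snd h)"] by simp
    ultimately show ?thesis by simp
  qed
  then show "((\<lambda>z. f (fst z) (snd z)) has_derivative
      (\<lambda>h. grad_x f x y \<bullet> fst h + grad_y f x y \<bullet> snd h)) (at (x, y))"
    using D by presburger
qed

lemma slit_DERIV:
  assumes "open U" "smooth_slit U f" "x \<in> U" "y \<noteq> 0"
  shows "((\<lambda>t. f (x + t *\<^sub>R u) (y + t *\<^sub>R w)) has_real_derivative
      (grad_x f x y \<bullet> u + grad_y f x y \<bullet> w)) (at 0)"
proof -
  have "((\<lambda>t. (x + t *\<^sub>R u, y + t *\<^sub>R w)) has_derivative (\<lambda>t. (t *\<^sub>R u, t *\<^sub>R w))) (at 0)"
    by (auto intro!: derivative_eq_intros)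
  then have "((\<lambda>t. f (fst (x + t *\<^sub>R u, y + t *\<^sub>R w)) (snd (x + t *\<^sub>R u, y + t *\<^sub>R w)))
      has_derivative (\<lambda>t. grad_x f x y \<bullet> fst (t *\<^sub>R u, t *\<^sub>R w) + grad_y f x y \<bullet> snd (t *\<^sub>R u, t *\<^sub>R w))) (at 0)"
    by (rule has_derivative_compose) (use slit_has_derivative(1)[OF assms] in simp)
  moreover have "(\<lambda>t. grad_x f x y \<bullet> fst (t *\<^sub>R u, t *\<^sub>R w) + grad_y f x y \<bullet> snd (t *\<^sub>R u, t *\<^sub>R w))
      = (*) (grad_x f x y \<bullet> u + grad_y f x y \<bullet> w)"
    by (simp add: fun_eq_iff algebra_simps)
  ultimately show ?thesis
    by (simp add: has_field_derivative_def)
qed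

lemma slit_DERIV_y:
  assumes "open U" "smooth_slit U f" "x \<in> U" "y + s *\<^sub>R w \<noteq> 0"
  shows "((\<lambda>t. f x (y + t *\<^sub>R w)) has_real_derivative (grad_y f x (y + s *\<^sub>R w) \<bullet> w)) (at s)"
proof -
  have "((\<lambda>t. f x (y + s *\<^sub>R w + t *\<^sub>R w)) has_real_derivative (grad_y f x (y + s *\<^sub>R w) \<bullet> w)) (at (s - s))"
    using slit_DERIV[OF assms, of 0 w] by simp
  then have "((\<lambda>t. f x (y + s *\<^sub>R w + (t - s) *\<^sub>R w)) has_real_derivative (grad_y f x (y + s *\<^sub>R w) \<bullet> w) * 1) (at s)"
    by (rule DERIV_chain2) (auto intro!: derivative_eq_intros)
  moreover have "y + s *\<^sub>R w + (t - s) *\<^sub>R w = y + t *\<^sub>R w" for t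
    by (simp add: scaleR_left_diff_distrib)
  ultimately show ?thesis by simp
qed

lemma slit_Dy:
  assumes "open U" "smooth_slit U f"
  shows "smooth_slit U (Dy i f)"
  unfolding smooth_slit_def
proof (rule smooth_on_cong[OF open_slit[OF assms(1)] _
      smooth_on_frechet[OF assms(2)[unfolded smooth_slit_def], of "(0, axis i 1)"]])
  show "frechet_derivative (\<lambda>z. f (fst z) (snd z)) (at z) (0, axis i 1) = Dy i f (fst z) (snd z)"
    if "z \<in> U \<times> - {0}" for z
    using slit_has_derivative(3)[OF assms, of "fst z" "snd z"] that by (simp add: mem_Times_iff)
qed

lemma Dx_has_derivative:
  assumes "open U" "smooth_slit U f" "x \<in> U" "y \<noteq> 0"
  shows "((\<lambda>t. f (x + t *\<^sub>R axis i 1) y) has_real_derivative Dx i f x y) (at 0)"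
  using slit_DERIV[OF assms, of "axis i 1" 0] by (simp add: grad_x_def inner_axis)

lemma Dy_has_derivative:
  assumes "open U" "smooth_slit U f" "x \<in> U" "y \<noteq> 0"
  shows "((\<lambda>t. f x (y + t *\<^sub>R axis i 1)) has_real_derivative Dy i f x y) (at 0)"
  using slit_DERIV[OF assms, of 0 "axis i 1"] by (simp add: grad_y_def inner_axis)

lemma Dx_eqI: "((\<lambda>t. f (x + t *\<^sub>R axis i 1) y) has_real_derivative d) (at 0) \<Longrightarrow> Dx i f x y = d"
  unfolding Dx_def by (rule DERIV_imp_deriv)

lemma Dy_eqI: "((\<lambda>t. f x (y + t *\<^sub>R axis i 1)) has_real_derivative d) (at 0) \<Longrightarrow> Dy i f x y = d"
  unfolding Dy_def by (rule DERIV_imp_deriv)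

lemma eventually_line: 
  fixes x u :: "real ^ 'n"
  assumes "open V" "x \<in> V"
  shows "\<forall>\<^sub>F t in nhds (0::real). x + t *\<^sub>R u \<in> V"
proof -
  have "open ((\<lambda>t::real. x + t *\<^sub>R u) -` V)"
    by (intro open_vimage assms continuous_intros)
  then show ?thesis using assms(2) by (auto simp: eventually_nhds intro!: exI[of _ "(\<lambda>t::real. x + t *\<^sub>R u) -` V"])
qed

lemma deriv_cong_nhds:
  assumes "\<forall>\<^sub>F t in nhds (s::real). f t = (g t :: real)"
  shows "deriv f s = deriv g s"
  by (rule deriv_cong_ev[OF assms refl])

lemma Dx_cong:
  assumes "open U" "\<And>x y. x \<in> U \<Longrightarrow> y \<noteq> 0 \<Longrightarrow> f x y = g x y" "x \<in> U" "y \<noteq> 0"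
  shows "Dx i f x y = Dx i g x y"
  unfolding Dx_def
  by (rule deriv_cong_nhds, rule eventually_mono[OF eventually_line[OF assms(1,3)]]) (use assms in auto)

lemma Dy_cong_open:
  fixes f g :: "'n::finite tfun"
  assumes "open S" "\<And>y. y \<in> S \<Longrightarrow> f x y = g x y" "y \<in> S"
  shows "Dy i f x y = Dy i g x y"
  unfolding Dy_def
  by (rule deriv_cong_nhds, rule eventually_mono[OF eventually_line[OF assms(1,3)]]) (use assms in auto)

lemma Dy_cong:
  fixes f g :: "'n::finite tfun"
  assumes "\<And>y. y \<noteq> 0 \<Longrightarrow> f x y = g x y" "y \<noteq> 0"
  shows "Dy i f x y = Dy i g x y"
  by (rule Dy_cong_open[of "- {0}"]) (use assms in auto)

lemma grad_y_eqI:
  assumes "open U" "smooth_slit U f" "x \<in> U" "y \<noteq> 0"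
    "((\<lambda>t. f x (y + t *\<^sub>R w)) has_real_derivative d) (at 0)"
  shows "grad_y f x y \<bullet> w = d"
  using DERIV_unique[OF slit_DERIV[OF assms(1-4), of 0 w]] assms(5) by simp

lemma Dy_sum:
  assumes "open U" "x \<in> U" "y \<noteq> 0" "\<And>i. i \<in> I \<Longrightarrow> smooth_slit U (f i)"
  shows "Dy j (\<lambda>x y. \<Sum>i\<in>I. f i x y) x y = (\<Sum>i\<in>I. Dy j (f i) x y)"
  by (rule Dy_eqI) (rule DERIV_sum[OF Dy_has_derivative[OF assms(1,4,2,3)]])

lemma Dy_cmult:
  assumes "open U" "x \<in> U" "y \<noteq> 0" "smooth_slit U f"
  shows "Dy j (\<lambda>x y. c * f x y) x y = c * Dy j f x y"
  by (rule Dy_eqI) (rule DERIV_cmult[OF Dy_has_derivative[OF assms(1,4,2,3)]])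

lemma Dy_diff:
  assumes "open U" "x \<in> U" "y \<noteq> 0" "smooth_slit U f" "smooth_slit U g"
  shows "Dy j (\<lambda>x y. f x y - g x y) x y = Dy j f x y - Dy j g x y"
  by (rule Dy_eqI) (rule DERIV_diff[OF Dy_has_derivative[OF assms(1,4,2,3)] Dy_has_derivative[OF assms(1,5,2,3)]])

lemma Dy_mult:
  assumes "open U" "x \<in> U" "y \<noteq> 0" "smooth_slit U f" "smooth_slit U g"
  shows "Dy j (\<lambda>x y. f x y * g x y) x y = Dy j f x y * g x y + Dy j g x y * f x y"
  using DERIV_mult[OF Dy_has_derivative[OF assms(1,4,2,3), of j] Dy_has_derivative[OF assms(1,5,2,3), of j]]
  by (intro Dy_eqI) simp

text \<open>Subtracting one smooth function from another under three fibre derivatives is all the linearity that the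
  comparison of Douglas tensors requires.\<close>

lemma Dy3_diff:
  assumes U: "open U" "x \<in> U" and fg: "smooth_slit U f" "smooth_slit U g" and y: "y \<noteq> 0"
  shows "Dy j (Dy k (Dy l (\<lambda>x y. f x y - g x y))) x y = Dy j (Dy k (Dy l f)) x y - Dy j (Dy k (Dy l g)) x y"
proof -
  have 1: "Dy l (\<lambda>x y. f x y - g x y) x y = Dy l f x y - Dy l g x y" if "y \<noteq> 0" for y
    by (rule Dy_diff[OF U that fg])
  have 2: "Dy k (Dy l (\<lambda>x y. f x y - g x y)) x y = Dy k (Dy l f) x y - Dy k (Dy l g) x y" if "y \<noteq> 0" for y
  proof -
    have "Dy k (Dy l (\<lambda>x y. f x y - g x y)) x y = Dy k (\<lambda>x y. Dy l f x y - Dy l g x y) x y"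
      by (rule Dy_cong[OF _ that]) (rule 1)
    then show ?thesis
      using Dy_diff[OF U that slit_Dy[OF U(1) fg(1)] slit_Dy[OF U(1) fg(2)]] by simp
  qed
  have "Dy j (Dy k (Dy l (\<lambda>x y. f x y - g x y))) x y = Dy j (\<lambda>x y. Dy k (Dy l f) x y - Dy k (Dy l g) x y) x y"
    by (rule Dy_cong[OF _ y]) (rule 2)
  then show ?thesis
    using Dy_diff[OF U y slit_Dy[OF U(1) slit_Dy[OF U(1) fg(1)]] slit_Dy[OF U(1) slit_Dy[OF U(1) fg(2)]]]
    by simp
qed

text \<open>Only the fibre over \<open>x\<close> matters here, so that the matrix may depend on \<open>x\<close> in any way. This is what makes
  the spray of \<open>\<alpha>\<close> invisible to the Berwald and Douglas tensors.\<close>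

lemma Dy3_quadratic:
  fixes f :: "'n::finite tfun"
  assumes f: "\<And>y. y \<noteq> 0 \<Longrightarrow> f x y = y \<bullet> (M *v y)" and y: "y \<noteq> 0"
  shows "Dy j (Dy k (Dy l f)) x y = 0"
proof -
  define c where "c = (\<chi> p. M $ l $ p + M $ p $ l)"
  have 1: "Dy l f x y = c \<bullet> y" if "y \<noteq> 0" for y
  proof -
    have "Dy l f x y = Dy l (\<lambda>x y. y \<bullet> (M *v y)) x y"
      by (rule Dy_cong[OF _ that]) (rule f)
    also have "\<dots> = axis l 1 \<bullet> (M *v y) + y \<bullet> (M *v axis l 1)"
      by (rule Dy_eqI) (auto simp: matrix_vector_right_distrib matrix_vector_mult_scaleR inner_add_left inner_add_right
          intro!: derivative_eq_intros)
    also have "\<dots> = c \<bullet> y"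
      by (simp add: c_def inner_axis' matrix_vector_mult_basis column_def)
        (simp add: inner_vec_def matrix_vector_mult_def sum.distrib algebra_simps)
    finally show ?thesis .
  qed
  have 2: "Dy k (Dy l f) x y = c $ k" if "y \<noteq> 0" for y
  proof -
    have "Dy k (Dy l f) x y = Dy k (\<lambda>x y. c \<bullet> y) x y" by (rule Dy_cong[OF _ that]) (rule 1)
    also have "\<dots> = c $ k"
      by (rule Dy_eqI) (auto intro!: derivative_eq_intros simp: inner_add_right inner_axis)
    finally show ?thesis .
  qed
  have "Dy j (Dy k (Dy l f)) x y = Dy j (\<lambda>x y. c $ k) x y" by (rule Dy_cong[OF _ y]) (rule 2)
  then show ?thesis by (simp add: Dy_def)
qed

lemma grad_y_zero_constant:
  fixes f :: "'n::finite tfun"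
  assumes "open U" "smooth_slit U f" "x \<in> U" "CARD('n) \<ge> 2" "\<And>y j. y \<noteq> 0 \<Longrightarrow> Dy j f x y = 0"
  shows "\<exists>c. \<forall>y. y \<noteq> 0 \<longrightarrow> f x y = c"
proof -
  have D: "(f x has_derivative (\<lambda>h. 0)) (at y)" if "y \<noteq> 0" for y
  proof -
    have "((\<lambda>y. (x, y)) has_derivative (\<lambda>h. (0, h))) (at y)"
      by (auto intro!: derivative_eq_intros)
    then have "((\<lambda>y. f (fst (x, y)) (snd (x, y))) has_derivative
        (\<lambda>h. grad_x f x y \<bullet> fst (0, h) + grad_y f x y \<bullet> snd (0::real^'n, h))) (at y)"
      by (rule has_derivative_compose) (rule slit_has_derivative(1)[OF assms(1-3) that])
    moreover have "grad_y f x y = 0" using assms(5)[OF that] by (simp add: grad_y_def vec_eq_iff)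
    ultimately show ?thesis by simp
  qed
  have "f x constant_on (- {0})"
  proof (rule has_derivative_zero_connected_constant_on[of _ "{}"])
    show "connected (- {0 :: real ^ 'n})" using assms(4) by (intro connected_punctured_universe) simp
    show "continuous_on (- {0}) (f x)"
      using D by (intro continuous_at_imp_continuous_on ballI has_derivative_continuous) auto
    show "\<forall>y\<in>- {0} - {}. (f x has_derivative (\<lambda>h. 0)) (at y within - {0})"
      using D by (auto intro: has_derivative_at_withinI)
  qed auto
  then show ?thesis unfolding constant_on_def by auto
qed

text \<open>The slit fibre is connected in dimension at least two, so a vanishing fibre Hessian makes the gradient
  constant and \<open>f\<close> affine; homogeneity, of which doubling suffices, removes the constant term.\<close>

lemma hessian_zero_linear:
  fixes f :: "'n::finite tfun"
  assumes "open U" "smooth_slit U f" "x \<in> U" "CARD('n) \<ge> 2" "\<And>y j k. y \<noteq> 0 \<Longrightarrow> Dy j (Dy k f) x y = 0"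
    and hom: "\<And>y. y \<noteq> 0 \<Longrightarrow> f x (2 *\<^sub>R y) = 2 * f x y"
  shows "\<exists>e. \<forall>y. y \<noteq> 0 \<longrightarrow> f x y = e \<bullet> y"
proof -
  have "\<exists>c. \<forall>y. y \<noteq> 0 \<longrightarrow> Dy k f x y = c" for k
    by (rule grad_y_zero_constant[where f="Dy k f", OF assms(1) slit_Dy[OF assms(1,2)] assms(3,4,5)])
  then obtain c where c: "\<And>k y. y \<noteq> 0 \<Longrightarrow> Dy k f x y = c k" by metis
  define e where "e = (\<chi> k. c k)"
  have s: "smooth_slit U (\<lambda>x y. e \<bullet> y)"
    by (simp add: inner_vec_def) (intro slit_intros assms(1))
  have De: "Dy j (\<lambda>x y. e \<bullet> y) x y = c j" for j y
    by (rule Dy_eqI) (auto intro!: derivative_eq_intros simp: inner_add_right inner_axis e_def)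
  have 0: "Dy j (\<lambda>x y. f x y - e \<bullet> y) x y = 0" if "y \<noteq> 0" for j y
    by (simp add: Dy_diff[OF assms(1,3) that assms(2) s] De c[OF that])
  obtain d where d: "\<And>y. y \<noteq> 0 \<Longrightarrow> f x y - e \<bullet> y = d"
    using grad_y_zero_constant[where f="\<lambda>x y. f x y - e \<bullet> y", OF assms(1) slit_diff[OF assms(1,2) s] assms(3,4) 0]
    by blast
  have "f x y = e \<bullet> y" if "y \<noteq> 0" for y
  proof -
    have "f x (2 *\<^sub>R y) - e \<bullet> (2 *\<^sub>R y) = f x y - e \<bullet> y"
      using d[OF that] d[of "2 *\<^sub>R y"] that by simp
    then show ?thesis using hom[OF that] by simp
  qed
  then show ?thesis by blast
qed

section \<open>A Riemannian metric and a 1-form in one chart\<close>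

lemma inner_matrix_sym:
  fixes M :: "real ^ 'n ^ 'n"
  assumes "transpose M = M"
  shows "v \<bullet> (M *v w) = w \<bullet> (M *v v)"
proof -
  have "v \<bullet> (M *v w) = (v v* M) \<bullet> w" by (rule dot_lmul_matrix[symmetric])
  also have "v v* M = M *v v" by (subst transpose_matrix_vector[symmetric]) (simp only: assms)
  finally show ?thesis by (simp only: inner_commute)
qed

lemma inner_matrix_skew:
  fixes M :: "real ^ 'n ^ 'n"
  assumes "\<And>i j. M $ i $ j = - M $ j $ i"
  shows "v \<bullet> (M *v w) = - (w \<bullet> (M *v v))"
proof -
  have "transpose M = - M"
    unfolding vec_eq_iff by (auto simp: transpose_def intro: assms)
  then have "v \<bullet> (M *v w) = (- M *v v) \<bullet> w"
    using dot_lmul_matrix[of v M w] transpose_matrix_vector[of M v] by simp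
  also have "- M *v v = - (M *v v)"
    by (simp add: vec_eq_iff matrix_vector_mult_def sum_negf)
  finally show ?thesis by (simp add: inner_commute)
qed

lemma pos_def_det:
  fixes M :: "real ^ 'n ^ 'n"
  assumes "\<And>v. v \<noteq> 0 \<Longrightarrow> v \<bullet> (M *v v) > 0"
  shows "det M \<noteq> 0"
proof -
  have "\<forall>v. M *v v = 0 \<longrightarrow> v = 0" using assms by force
  then show ?thesis
    using matrix_left_invertible_ker[of M] invertible_left_inverse[of M] by (simp add: invertible_det_nz)
qed

definition pd :: "'n \<Rightarrow> (real ^ 'n::finite \<Rightarrow> real) \<Rightarrow> real ^ 'n \<Rightarrow> real" where
  "pd i g x = frechet_derivative g (at x) (axis i 1)"

lemma pd_smooth: "smooth_on U g \<Longrightarrow> smooth_on U (pd i g)"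
  unfolding pd_def by (rule smooth_on_frechet)

lemma pd_DERIV:
  assumes "smooth_on U g" "x \<in> U"
  shows "((\<lambda>t. g (x + t *\<^sub>R axis i 1)) has_real_derivative pd i g x) (at 0)"
proof -
  note D = smooth_on_differentiable[OF assms]
  have "((\<lambda>t. x + t *\<^sub>R axis i 1) has_derivative (\<lambda>t. t *\<^sub>R axis i 1)) (at 0)"
    by (auto intro!: derivative_eq_intros)
  then have "((\<lambda>t. g (x + t *\<^sub>R axis i 1)) has_derivative
      (\<lambda>t. frechet_derivative g (at x) (t *\<^sub>R axis i 1))) (at 0)"
    by (rule has_derivative_compose) (use D in simp)
  moreover have "frechet_derivative g (at x) (t *\<^sub>R axis i 1) = pd i g x * t" for t
    using linear_scale[OF has_derivative_linear[OF D], of t] by (simp add: pd_def)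
  ultimately show ?thesis by (simp add: has_field_derivative_def)
qed

lemma Dx_base: 
  assumes "smooth_on U g" "x \<in> U"
  shows "Dx i (\<lambda>x y. g x) x y = pd i g x"
  by (rule Dx_eqI[OF pd_DERIV[OF assms]])

text \<open>A chart domain with the components of \<open>\<alpha>\<^sup>2\<close> and \<open>\<beta>\<close>. In the notation of the introduction, \<open>bu\<close> is the
  vector \<open>b\<^sup>i\<close> and \<open>bb\<close> is \<open>\<parallel>\<beta>\<parallel>\<^sup>2\<close>; \<open>Gb\<close> is the spray of \<open>\<alpha>\<close>, with coefficients \<open>gam\<close> that are left
  unsymmetrised because only the quadratic form counts; \<open>rm\<close> and \<open>sm\<close> are the matrices of \<open>r\<^sub>i\<^sub>j\<close> and
  \<open>s\<^sub>i\<^sub>j\<close>, and \<open>su\<close> is \<open>s\<^sup>i\<^sub>0\<close>.\<close>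

locale riem_form =
  fixes U :: "(real ^ 'n::finite) set" and a :: "real ^ 'n \<Rightarrow> real ^ 'n ^ 'n" and b :: "real ^ 'n \<Rightarrow> real ^ 'n"
  assumes openU: "open U" and smooth_a: "smooth_on U a" and smooth_b: "smooth_on U b"
    and sym_a: "\<And>x. x \<in> U \<Longrightarrow> transpose (a x) = a x"
    and pos_a: "\<And>x v. x \<in> U \<Longrightarrow> v \<noteq> 0 \<Longrightarrow> v \<bullet> (a x *v v) > 0"
begin

definition A :: "'n tfun" where "A x y = y \<bullet> (a x *v y)"
definition al :: "'n tfun" where "al x y = sqrt (A x y)"
definition be :: "'n tfun" where "be x y = b x \<bullet> y"
definition bu :: "real ^ 'n \<Rightarrow> real ^ 'n" where "bu x = matrix_inv (a x) *v b x"
definition bb :: "real ^ 'n \<Rightarrow> real" where "bb x = b x \<bullet> bu x"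

definition gam :: "'n \<Rightarrow> 'n \<Rightarrow> 'n \<Rightarrow> real ^ 'n \<Rightarrow> real" where
  "gam i j k x = 1/4 * (\<Sum>l\<in>UNIV. matrix_inv (a x) $ i $ l *
     (2 * pd k (\<lambda>x. a x $ l $ j) x - pd l (\<lambda>x. a x $ j $ k) x))"
definition Gb :: "real ^ 'n \<Rightarrow> real ^ 'n \<Rightarrow> real ^ 'n" where
  "Gb x y = (\<chi> i. \<Sum>j\<in>UNIV. \<Sum>k\<in>UNIV. gam i j k x * y $ j * y $ k)"

definition rm :: "real ^ 'n \<Rightarrow> real ^ 'n ^ 'n" where
  "rm x = (\<chi> j k. (pd k (\<lambda>x. b x $ j) x + pd j (\<lambda>x. b x $ k) x) / 2
     - (\<Sum>i\<in>UNIV. b x $ i * (gam i j k x + gam i k j x)))"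
definition r00 :: "'n tfun" where "r00 x y = y \<bullet> (rm x *v y)"
definition sm :: "real ^ 'n \<Rightarrow> real ^ 'n ^ 'n" where
  "sm x = (\<chi> i k. (pd k (\<lambda>x. b x $ i) x - pd i (\<lambda>x. b x $ k) x) / 2)"
definition su :: "real ^ 'n \<Rightarrow> real ^ 'n \<Rightarrow> real ^ 'n" where
  "su x y = matrix_inv (a x) *v (sm x *v y)"
definition s0 :: "'n tfun" where "s0 x y = b x \<bullet> su x y"

lemma smooth_a': "smooth_on U (\<lambda>x. a x $ i $ j)"
  by (intro smooth_on_component smooth_a openU)

lemma smooth_b': "smooth_on U (\<lambda>x. b x $ i)"
  by (intro smooth_on_component smooth_b openU)

lemma det_a: "x \<in> U \<Longrightarrow> det (a x) \<noteq> 0"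
  by (rule pos_def_det[OF pos_a])

lemma a_sym: "x \<in> U \<Longrightarrow> a x $ i $ j = a x $ j $ i"
  using sym_a[of x] by (metis transpose_def vec_lambda_beta)

lemma a_inv: "x \<in> U \<Longrightarrow> a x *v (matrix_inv (a x) *v w) = w"
  using matrix_inv_inverse(1)[OF det_a] by (simp add: matrix_vector_mul_assoc)

lemma a_inner: "x \<in> U \<Longrightarrow> v \<bullet> (a x *v w) = w \<bullet> (a x *v v)"
  by (rule inner_matrix_sym[OF sym_a])

lemma inv_inner: "x \<in> U \<Longrightarrow> v \<bullet> (matrix_inv (a x) *v w) = w \<bullet> (matrix_inv (a x) *v v)"
  by (metis a_inner a_inv inner_commute)

lemma a_bu: "x \<in> U \<Longrightarrow> a x *v bu x = b x"
  by (simp add: bu_def a_inv)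

lemma a_su: "x \<in> U \<Longrightarrow> a x *v su x y = sm x *v y"
  by (simp add: su_def a_inv)

lemma smooth_inv: "smooth_on U (\<lambda>x. matrix_inv (a x) $ i $ j)"
  by (rule smooth_on_matrix_inv[OF openU smooth_a' det_a])

lemma smooth_gam: "smooth_on U (gam i j k)"
  unfolding gam_def[abs_def]
  by (intro smooth_on_mult smooth_on_const smooth_on_sum smooth_on_diff openU smooth_inv pd_smooth smooth_a')

lemma A_sum: "A x y = (\<Sum>i\<in>UNIV. \<Sum>j\<in>UNIV. a x $ i $ j * y $ i * y $ j)"
  by (simp add: A_def inner_vec_def matrix_vector_mult_def sum_distrib_left mult_ac)

lemma be_sum: "be x y = (\<Sum>i\<in>UNIV. b x $ i * y $ i)"
  by (simp add: be_def inner_vec_def)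

lemma A_pos: "x \<in> U \<Longrightarrow> y \<noteq> 0 \<Longrightarrow> A x y > 0"
  by (simp add: A_def pos_a)

lemma al_pos: "x \<in> U \<Longrightarrow> y \<noteq> 0 \<Longrightarrow> al x y > 0"
  by (simp add: al_def A_pos)

lemma al_sq: "x \<in> U \<Longrightarrow> y \<noteq> 0 \<Longrightarrow> (al x y)^2 = A x y"
  by (simp add: al_def A_pos less_imp_le)

lemma be_inner: "x \<in> U \<Longrightarrow> be x y = bu x \<bullet> (a x *v y)"
  by (metis a_bu a_inner be_def inner_commute)

lemma A_bu: "x \<in> U \<Longrightarrow> A x (bu x) = bb x"
  by (simp add: A_def a_bu bb_def inner_commute)

lemma bb_pos: "x \<in> U \<Longrightarrow> b x \<noteq> 0 \<Longrightarrow> bb x > 0"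
  by (metis A_bu A_pos a_bu matrix_vector_mult_0_right)

lemma A_add: "x \<in> U \<Longrightarrow> A x (s *\<^sub>R v + t *\<^sub>R w) = s^2 * A x v + 2 * s * t * (v \<bullet> (a x *v w)) + t^2 * A x w"
  using a_inner[of x w v]
  by (simp add: A_def matrix_vector_right_distrib matrix_vector_mult_scaleR inner_add_left inner_add_right
      power2_eq_square algebra_simps)

text \<open>The Cauchy--Schwarz inequality for \<open>\<alpha>\<close>: expand \<open>\<alpha>\<^sup>2\<close> of the vector \<open>\<alpha>\<^sup>2(y) b - \<beta>(y) y\<close>.\<close>

lemma be_sq_le:
  assumes "x \<in> U"
  shows "(be x y)^2 \<le> bb x * A x y"
proof (cases "y = 0")
  case False
  have "0 \<le> A x (A x y *\<^sub>R bu x + (- be x y) *\<^sub>R y)"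
    by (metis A_def A_pos assms inner_zero_left less_eq_real_def)
  also have "\<dots> = A x y * (bb x * A x y - (be x y)^2)"
    unfolding A_add[OF assms] A_bu[OF assms]
    by (simp add: be_inner[OF assms, symmetric] power2_eq_square algebra_simps)
  finally show ?thesis using A_pos[OF assms False] by (simp add: zero_le_mult_iff)
qed (simp add: A_def be_def)

lemma sm_skew: "sm x $ i $ j = - sm x $ j $ i"
  by (simp add: sm_def field_simps)

lemma sm_inner: "v \<bullet> (sm x *v w) = - (w \<bullet> (sm x *v v))"
  by (rule inner_matrix_skew) (rule sm_skew)

lemma rm_inner: "v \<bullet> (rm x *v w) = w \<bullet> (rm x *v v)"
  by (rule inner_matrix_sym) (simp add: rm_def transpose_def vec_eq_iff add.commute)

lemma s0_bu: "x \<in> U \<Longrightarrow> s0 x y = bu x \<bullet> (sm x *v y)"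
  by (simp add: s0_def bu_def su_def inv_inner inner_commute)

lemma y_su: "x \<in> U \<Longrightarrow> (a x *v y) \<bullet> su x y = 0"
  using sm_inner[of y x y] a_inner[of x y "su x y"] by (simp add: a_su inner_commute)

lemma s0_at_bu: "x \<in> U \<Longrightarrow> s0 x (bu x) = 0"
  using sm_inner[of "bu x" x "bu x"] by (simp add: s0_bu)

lemma smooth_A: "smooth_slit U A"
  unfolding A_sum[abs_def] by (intro slit_intros slit_base openU smooth_a')

lemma smooth_be: "smooth_slit U be"
  unfolding be_sum[abs_def] by (intro slit_intros slit_base openU smooth_b')

lemma smooth_al: "smooth_slit U al"
  unfolding al_def[abs_def] by (intro slit_sqrt openU smooth_A A_pos)

lemma smooth_Gb: "smooth_slit U (\<lambda>x y. Gb x y $ i)"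
  by (simp add: Gb_def) (intro slit_intros slit_base openU smooth_gam)

lemma smooth_rm: "smooth_on U (\<lambda>x. rm x $ i $ j)"
  by (simp add: rm_def)
    (intro smooth_on_mult smooth_on_add smooth_on_divide smooth_on_const smooth_on_sum smooth_on_diff openU
      smooth_gam pd_smooth smooth_b', simp)

lemma smooth_sm: "smooth_on U (\<lambda>x. sm x $ i $ j)"
  by (simp add: sm_def)
    (intro smooth_on_divide smooth_on_const smooth_on_diff openU pd_smooth smooth_b', simp)

lemma smooth_r00: "smooth_slit U r00"
  unfolding r00_def[abs_def] matrix_vector_mult_def inner_vec_def
  by simp (intro slit_intros slit_base openU smooth_rm)

lemma smooth_sl: "smooth_slit U (\<lambda>x y. (sm x *v y) $ i)"
  unfolding matrix_vector_mult_def
  by simp (intro slit_intros slit_base openU smooth_sm)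

lemma smooth_su: "smooth_slit U (\<lambda>x y. su x y $ i)"
  unfolding su_def matrix_vector_mult_def[of "matrix_inv _"]
  by simp (intro slit_intros slit_base openU smooth_inv smooth_sl)

lemma smooth_s0: "smooth_slit U s0"
  unfolding s0_def[abs_def] inner_vec_def
  by simp (intro slit_intros slit_base openU smooth_b' smooth_su)

lemma smooth_bu: "smooth_on U (\<lambda>x. bu x $ i)"
  unfolding bu_def matrix_vector_mult_def
  by simp (intro smooth_on_mult smooth_on_sum openU smooth_inv smooth_b')

lemma smooth_bb: "smooth_on U bb"
  unfolding bb_def[abs_def] inner_vec_def
  by simp (intro smooth_on_mult smooth_on_sum openU smooth_b' smooth_bu)

lemma grad_y_A:
  assumes "x \<in> U"
  shows "grad_y A x y = 2 *\<^sub>R (a x *v y)"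
proof -
  have "Dy i A x y = 2 * (a x *v y) $ i" for i
  proof (rule Dy_eqI)
    have "A x (y + t *\<^sub>R axis i 1) = A x y + 2 * t * (a x *v y) $ i + t^2 * A x (axis i 1)" for t
      using A_add[OF assms, of 1 y t "axis i 1"] a_inner[OF assms, of y "axis i 1"]
      by (simp add: inner_axis')
    then show "((\<lambda>t. A x (y + t *\<^sub>R axis i 1)) has_real_derivative 2 * (a x *v y) $ i) (at 0)"
      by (auto intro!: derivative_eq_intros)
  qed
  then show ?thesis by (simp add: grad_y_def vec_eq_iff)
qed

lemma grad_y_be: "grad_y be x y = b x"
proof -
  have "Dy i be x y = b x $ i" for i
    by (rule Dy_eqI) (auto intro!: derivative_eq_intros simp: be_def inner_add_right inner_axis)
  then show ?thesis by (simp add: grad_y_def vec_eq_iff)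
qed

lemma grad_x_A:
  assumes "x \<in> U"
  shows "grad_x A x y $ l = (\<Sum>i\<in>UNIV. \<Sum>j\<in>UNIV. pd l (\<lambda>x. a x $ i $ j) x * y $ i * y $ j)"
  unfolding A_sum[abs_def] grad_x_def
  by simp (rule Dx_eqI, (rule derivative_eq_intros pd_DERIV[OF smooth_a' assms] refl)+, simp)

lemma grad_x_be:
  assumes "x \<in> U"
  shows "grad_x be x y $ l = (\<Sum>i\<in>UNIV. pd l (\<lambda>x. b x $ i) x * y $ i)"
  unfolding be_sum[abs_def] grad_x_def
  by simp (rule Dx_eqI, (rule derivative_eq_intros pd_DERIV[OF smooth_b' assms] refl)+, simp)

lemma Gb_quadratic: "Gb x (t *\<^sub>R y) = t^2 *\<^sub>R Gb x y"
  by (simp add: Gb_def vec_eq_iff power2_eq_square sum_distrib_left mult_ac)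

text \<open>\<open>Gb\<close> is the spray of \<open>\<alpha>\<close>: along its integral curves the Euler--Lagrange equation
  of \<open>\<alpha>\<^sup>2\<close> holds.\<close>

lemma a_Gb:
  assumes "x \<in> U"
  shows "2 * (a x *v Gb x y) $ l = (\<Sum>j\<in>UNIV. \<Sum>k\<in>UNIV. pd k (\<lambda>x. a x $ l $ j) x * y $ j * y $ k)
     - 1/2 * grad_x A x y $ l"
proof -
  define w where "w = (\<chi> l. \<Sum>j\<in>UNIV. \<Sum>k\<in>UNIV.
      (2 * pd k (\<lambda>x. a x $ l $ j) x - pd l (\<lambda>x. a x $ j $ k) x) * y $ j * y $ k)"
  have "Gb x y = (1/4) *\<^sub>R (matrix_inv (a x) *v w)"
  proof -
    have "Gb x y $ i = 1/4 * (\<Sum>l\<in>UNIV. matrix_inv (a x) $ i $ l * w $ l)" for i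
    proof -
      have "Gb x y $ i = (\<Sum>j\<in>UNIV. \<Sum>k\<in>UNIV. \<Sum>l\<in>UNIV. 1/4 * (matrix_inv (a x) $ i $ l *
        ((2 * pd k (\<lambda>x. a x $ l $ j) x - pd l (\<lambda>x. a x $ j $ k) x) * y $ j * y $ k)))"
        by (simp add: Gb_def gam_def sum_distrib_left sum_distrib_right mult_ac)
      also have "\<dots> = (\<Sum>j\<in>UNIV. \<Sum>l\<in>UNIV. \<Sum>k\<in>UNIV. 1/4 * (matrix_inv (a x) $ i $ l *
        ((2 * pd k (\<lambda>x. a x $ l $ j) x - pd l (\<lambda>x. a x $ j $ k) x) * y $ j * y $ k)))"
        by (intro sum.cong refl sum.swap)
      also have "\<dots> = (\<Sum>l\<in>UNIV. \<Sum>j\<in>UNIV. \<Sum>k\<in>UNIV. 1/4 * (matrix_inv (a x) $ i $ l *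
        ((2 * pd k (\<lambda>x. a x $ l $ j) x - pd l (\<lambda>x. a x $ j $ k) x) * y $ j * y $ k)))"
        by (rule sum.swap)
      finally show ?thesis by (simp add: w_def sum_distrib_left mult_ac)
    qed
    then show ?thesis by (simp add: vec_eq_iff matrix_vector_mult_def)
  qed
  then have "a x *v Gb x y = (1/4) *\<^sub>R w"
    by (simp add: a_inv[OF assms] matrix_vector_mult_scaleR)
  then have "(a x *v Gb x y) $ l = w $ l / 4" by simp
  moreover have "w $ l = 2 * (\<Sum>j\<in>UNIV. \<Sum>k\<in>UNIV. pd k (\<lambda>x. a x $ l $ j) x * y $ j * y $ k) - grad_x A x y $ l"
    by (simp add: w_def grad_x_A[OF assms] sum_subtractf[symmetric] sum_distrib_left left_diff_distrib mult.assoc)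
  ultimately show ?thesis by simp
qed

text \<open>\<open>\<alpha>\<close> is constant along its own geodesics: the equation of the previous lemma is contracted with \<open>y\<close>.\<close>

lemma A_along_spray:
  assumes "x \<in> U"
  shows "grad_x A x y \<bullet> y + grad_y A x y \<bullet> (- 2 *\<^sub>R Gb x y) = 0"
proof -
  have S: "(\<Sum>l\<in>UNIV. y $ l * (\<Sum>j\<in>UNIV. \<Sum>k\<in>UNIV. pd k (\<lambda>x. a x $ l $ j) x * y $ j * y $ k)) = grad_x A x y \<bullet> y"
  proof -
    have "(\<Sum>l\<in>UNIV. y $ l * (\<Sum>j\<in>UNIV. \<Sum>k\<in>UNIV. pd k (\<lambda>x. a x $ l $ j) x * y $ j * y $ k))
      = (\<Sum>l\<in>UNIV. \<Sum>k\<in>UNIV. \<Sum>j\<in>UNIV. y $ l * (pd k (\<lambda>x. a x $ l $ j) x * y $ j * y $ k))"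
      by (simp add: sum_distrib_left) (intro sum.cong refl sum.swap)
    also have "\<dots> = (\<Sum>k\<in>UNIV. \<Sum>l\<in>UNIV. \<Sum>j\<in>UNIV. y $ l * (pd k (\<lambda>x. a x $ l $ j) x * y $ j * y $ k))"
      by (rule sum.swap)
    also have "\<dots> = grad_x A x y \<bullet> y"
      by (simp add: inner_vec_def grad_x_A[OF assms] sum_distrib_left sum_distrib_right mult_ac)
    finally show ?thesis .
  qed
  have "2 * (y \<bullet> (a x *v Gb x y)) = (\<Sum>l\<in>UNIV. y $ l * (2 * (a x *v Gb x y) $ l))"
    by (simp add: inner_vec_def sum_distrib_left mult_ac)
  also have "\<dots> = grad_x A x y \<bullet> y - 1/2 * (grad_x A x y \<bullet> y)"
    unfolding a_Gb[OF assms] right_diff_distrib sum_subtractf S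
    by (simp add: inner_vec_def sum_distrib_left mult_ac)
  finally show ?thesis
    using a_inner[OF assms, of y "Gb x y"] by (simp add: grad_y_A[OF assms] inner_commute)
qed

lemma b_Gb:
  "2 * (b x \<bullet> Gb x y) = (\<Sum>j\<in>UNIV. \<Sum>k\<in>UNIV. pd k (\<lambda>x. b x $ j) x * y $ j * y $ k) - r00 x y"
proof -
  define g where "g j k = (\<Sum>i\<in>UNIV. b x $ i * gam i j k x)" for j k
  define d where "d j k = pd k (\<lambda>x. b x $ j) x" for j k
  have "b x \<bullet> Gb x y = (\<Sum>i\<in>UNIV. \<Sum>j\<in>UNIV. \<Sum>k\<in>UNIV. b x $ i * gam i j k x * (y $ j * y $ k))"
    by (simp add: inner_vec_def Gb_def sum_distrib_left mult_ac)
  also have "\<dots> = (\<Sum>j\<in>UNIV. \<Sum>i\<in>UNIV. \<Sum>k\<in>UNIV. b x $ i * gam i j k x * (y $ j * y $ k))"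
    by (rule sum.swap)
  also have "\<dots> = (\<Sum>j\<in>UNIV. \<Sum>k\<in>UNIV. \<Sum>i\<in>UNIV. b x $ i * gam i j k x * (y $ j * y $ k))"
    by (intro sum.cong refl sum.swap)
  finally have 1: "b x \<bullet> Gb x y = (\<Sum>j\<in>UNIV. \<Sum>k\<in>UNIV. g j k * (y $ j * y $ k))"
    by (simp add: g_def sum_distrib_right)
  have "r00 x y = (\<Sum>j\<in>UNIV. \<Sum>k\<in>UNIV. ((d j k + d k j) / 2 - (g j k + g k j)) * (y $ j * y $ k))"
    by (simp add: r00_def rm_def inner_vec_def matrix_vector_mult_def sum_distrib_left g_def d_def mult_ac
        sum.distrib distrib_left)
  also have "\<dots> = (\<Sum>j\<in>UNIV. \<Sum>k\<in>UNIV. d j k * (y $ j * y $ k)) / 2 + (\<Sum>j\<in>UNIV. \<Sum>k\<in>UNIV. d k j * (y $ j * y $ k)) / 2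
    - ((\<Sum>j\<in>UNIV. \<Sum>k\<in>UNIV. g j k * (y $ j * y $ k)) + (\<Sum>j\<in>UNIV. \<Sum>k\<in>UNIV. g k j * (y $ j * y $ k)))"
    by (simp add: sum.distrib sum_subtractf left_diff_distrib distrib_right add_divide_distrib sum_divide_distrib)
  also have "(\<Sum>j\<in>UNIV. \<Sum>k\<in>UNIV. d k j * (y $ j * y $ k)) = (\<Sum>j\<in>UNIV. \<Sum>k\<in>UNIV. d j k * (y $ j * y $ k))"
    by (subst sum.swap) (simp add: mult_ac)
  also have "(\<Sum>j\<in>UNIV. \<Sum>k\<in>UNIV. g k j * (y $ j * y $ k)) = (\<Sum>j\<in>UNIV. \<Sum>k\<in>UNIV. g j k * (y $ j * y $ k))"
    by (subst sum.swap) (simp add: mult_ac)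
  finally have "r00 x y = (\<Sum>j\<in>UNIV. \<Sum>k\<in>UNIV. d j k * (y $ j * y $ k)) - 2 * (b x \<bullet> Gb x y)"
    by (simp add: 1)
  then show ?thesis by (simp add: d_def mult.assoc)
qed

text \<open>Along a geodesic of \<open>\<alpha>\<close> the function \<open>\<beta>\<close> changes at the rate \<open>r\<^sub>0\<^sub>0\<close>; no Christoffel symbols beyond the
  spray itself enter.\<close>

lemma be_along_spray:
  assumes "x \<in> U"
  shows "grad_x be x y \<bullet> y + grad_y be x y \<bullet> (- 2 *\<^sub>R Gb x y) = r00 x y"
proof -
  have "grad_x be x y \<bullet> y = (\<Sum>j\<in>UNIV. \<Sum>k\<in>UNIV. pd k (\<lambda>x. b x $ j) x * y $ j * y $ k)"
    by (subst sum.swap) (simp add: inner_vec_def grad_x_be[OF assms] sum_distrib_right)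
  then show ?thesis using b_Gb[of x y] by (simp add: grad_y_be)
qed

lemma b_curl:
  assumes "x \<in> U"
  shows "(\<Sum>k\<in>UNIV. pd k (\<lambda>x. b x $ l) x * y $ k) - grad_x be x y $ l = 2 * (sm x *v y) $ l"
  by (simp add: grad_x_be[OF assms] sm_def matrix_vector_mult_def sum_subtractf[symmetric] sum_distrib_left
      left_diff_distrib[symmetric])

end

section \<open>The spray of the metric\<close>

text \<open>The common form of the two metrics. \<open>ph p s\<close> is \<open>F\<close> as a function of \<open>p = \<alpha>\<close> and \<open>s = \<beta>\<close>, and
  the assumption \<open>ph_DERIV\<close> states its two logarithmic partial derivatives
  \<open>(p - \<lambda> s) / (p (p + \<epsilon> s))\<close> and \<open>\<kappa> / (p + \<epsilon> s)\<close>, in the form of a chain rule along a curve. The bound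
  \<open>\<lambda> \<parallel>\<beta>\<parallel> < 1\<close> is the regularity condition of either metric.\<close>

locale ab_metric = riem_form U a b
  for U :: "(real ^ 'n::finite) set" and a :: "real ^ 'n \<Rightarrow> real ^ 'n ^ 'n" and b :: "real ^ 'n \<Rightarrow> real ^ 'n" +
  fixes kp lam :: real and ph :: "real \<Rightarrow> real \<Rightarrow> real" and F :: "'n tfun"
  assumes kplam: "kp = 2 \<and> lam = 1 \<or> kp = 1 \<and> lam = 2"
    and small: "\<And>x. x \<in> U \<Longrightarrow> lam^2 * bb x < 1"
    and F_eq: "\<And>x y. x \<in> U \<Longrightarrow> F x y = ph (al x y) (be x y)"
    and F_smooth: "smooth_slit U F"
    and ph_pos: "\<And>p s. p > 0 \<Longrightarrow> lam * \<bar>s\<bar> < p \<Longrightarrow> ph p s > 0"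
    and ph_hom: "\<And>p s t. t > 0 \<Longrightarrow> ph (t * p) (t * s) = t * ph p s"
    and ph_DERIV: "\<And>f g f' g'. (f has_real_derivative f') (at 0) \<Longrightarrow> (g has_real_derivative g') (at 0) \<Longrightarrow>
      f 0 > 0 \<Longrightarrow> lam * \<bar>g 0\<bar> < f 0 \<Longrightarrow>
      ((\<lambda>t. ph (f t) (g t)) has_real_derivative
        ph (f 0) (g 0) * ((f 0 - lam * g 0) / (f 0 * (f 0 + (kp - lam) * g 0)) * f'
          + kp / (f 0 + (kp - lam) * g 0) * g')) (at 0)"
begin

text \<open>\<open>F\<close> is regular because \<open>uu\<close>, \<open>vv\<close> and \<open>qq\<close> are positive. The functions \<open>fA\<close>, \<open>fB\<close>, \<open>fAA\<close>, \<open>fAB\<close>, \<open>fBB\<close>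
  are the partial derivatives of \<open>F\<^sup>2\<close> as a function of \<open>A = \<alpha>\<^sup>2\<close> and \<open>\<beta>\<close>. Using \<open>\<alpha>\<^sup>2\<close> instead of
  \<open>\<alpha>\<close> as a variable pays off because it is constant along the spray of \<open>\<alpha>\<close>.\<close>

definition uu :: "'n tfun" where "uu x y = al x y - lam * be x y"
definition vv :: "'n tfun" where "vv x y = al x y + (kp - lam) * be x y"
definition qq :: "'n tfun" where "qq x y = uu x y * vv x y + 2 * (bb x * A x y - (be x y)^2)"
definition L :: "'n tfun" where "L x y = (F x y)^2"
definition fA :: "'n tfun" where "fA x y = L x y * uu x y / (A x y * vv x y)"
definition fB :: "'n tfun" where "fB x y = 2 * kp * L x y / vv x y"
definition fAB :: "'n tfun" where
  "fAB x y = L x y * kp * (al x y - 2 * lam * be x y) / (A x y * (vv x y)^2)"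
definition fBB :: "'n tfun" where "fBB x y = 2 * kp * (kp + lam) * L x y / (vv x y)^2"
definition fAA :: "'n tfun" where "fAA x y = - be x y * fAB x y / (2 * A x y)"

text \<open>The coefficients of the spray; in the usual notation for \<open>(\<alpha>, \<beta>)\<close>-metrics they are \<open>\<alpha> Q\<close>,
  \<open>r\<^sub>0\<^sub>0 - 2 \<alpha> Q s\<^sub>0\<close>, and \<open>\<Theta>/\<alpha>\<close> and \<open>\<Psi>\<close> times the latter.\<close>

definition PP :: "'n tfun" where "PP x y = kp * A x y / uu x y"
definition XX :: "'n tfun" where "XX x y = r00 x y - 2 * PP x y * s0 x y"
definition pp :: "'n tfun" where "pp x y = kp * (al x y - 2 * lam * be x y) * XX x y / (2 * qq x y)"
definition mm :: "'n tfun" where "mm x y = A x y * XX x y / qq x y"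
definition GG :: "real ^ 'n \<Rightarrow> real ^ 'n \<Rightarrow> real ^ 'n" where
  "GG x y = Gb x y + PP x y *\<^sub>R su x y + pp x y *\<^sub>R y + mm x y *\<^sub>R bu x"

lemma kp_lam: "kp * lam = 2" "kp > 0" "lam > 0" "\<bar>kp - lam\<bar> = 1" "lam \<ge> 1"
  using kplam by auto

lemma be_small:
  assumes "x \<in> U" "y \<noteq> 0"
  shows "lam * \<bar>be x y\<bar> < al x y"
proof -
  have "(lam * \<bar>be x y\<bar>)^2 \<le> lam^2 * bb x * A x y"
    using mult_left_mono[OF be_sq_le[OF assms(1), of y], of "lam^2"] by (simp add: power_mult_distrib mult_ac)
  also have "\<dots> < A x y"
    using small[OF assms(1)] A_pos[OF assms] by simp
  finally show ?thesis
    using al_sq[OF assms] al_pos[OF assms] by (metis less_imp_le power2_less_imp_less)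
qed

lemma pos:
  assumes "x \<in> U" "y \<noteq> 0"
  shows "uu x y > 0" "vv x y > 0" "qq x y > 0" "F x y > 0" "L x y > 0" "A x y > 0" "al x y > 0"
proof -
  note s = be_small[OF assms]
  have "lam * be x y \<le> lam * \<bar>be x y\<bar>" using kp_lam by simp
  then show u: "uu x y > 0" using s by (simp add: uu_def)
  have "\<bar>(kp - lam) * be x y\<bar> \<le> lam * \<bar>be x y\<bar>"
    unfolding abs_mult kp_lam(4) using mult_right_mono[OF kp_lam(5), of "\<bar>be x y\<bar>"] by simp
  then show v: "vv x y > 0" using s by (auto simp: vv_def abs_le_iff)
  show "qq x y > 0" using mult_pos_pos[OF u v] be_sq_le[OF assms(1), of y] by (simp add: qq_def)
  show "F x y > 0" using F_eq[OF assms(1)] ph_pos[OF al_pos[OF assms] s] by simp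
  then show "L x y > 0" by (simp add: L_def)
  show "A x y > 0" "al x y > 0" by (rule A_pos[OF assms] al_pos[OF assms])+
qed

lemma nz:
  assumes "x \<in> U" "y \<noteq> 0"
  shows "uu x y \<noteq> 0" "vv x y \<noteq> 0" "qq x y \<noteq> 0" "F x y \<noteq> 0" "A x y \<noteq> 0" "al x y \<noteq> 0"
  using pos[OF assms] by simp_all

lemma smooth_uu: "smooth_slit U uu"
  unfolding uu_def[abs_def] by (intro slit_intros openU smooth_al smooth_be)

lemma smooth_vv: "smooth_slit U vv"
  unfolding vv_def[abs_def] by (intro slit_intros openU smooth_al smooth_be)

lemma smooth_qq: "smooth_slit U qq"
  unfolding qq_def[abs_def] power2_eq_square
  by (intro slit_intros openU smooth_uu smooth_vv smooth_be smooth_A slit_base smooth_bb)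

lemma smooth_L: "smooth_slit U L"
  unfolding L_def[abs_def] power2_eq_square by (intro slit_intros openU F_smooth)

lemma smooth_PP: "smooth_slit U PP"
  unfolding PP_def[abs_def]
  by (intro slit_divide slit_intros openU smooth_A smooth_uu) (simp add: nz)

lemma smooth_XX: "smooth_slit U XX"
  unfolding XX_def[abs_def] by (intro slit_intros openU smooth_r00 smooth_PP smooth_s0)

lemma smooth_pp: "smooth_slit U pp"
  unfolding pp_def[abs_def]
  by (intro slit_divide slit_intros openU smooth_XX smooth_al smooth_be smooth_qq) (simp add: nz)

lemma smooth_mm: "smooth_slit U mm"
  unfolding mm_def[abs_def]
  by (intro slit_divide slit_intros openU smooth_XX smooth_A smooth_qq) (simp add: nz)

lemma smooth_GG: "smooth_slit U (\<lambda>x y. GG x y $ i)"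
  unfolding GG_def
  by simp (intro slit_intros openU smooth_Gb smooth_PP smooth_pp smooth_mm smooth_su slit_base smooth_bu)

text \<open>The derivatives of \<open>\<alpha>\<^sup>2\<close> and \<open>\<beta>\<close> along a curve with velocity \<open>(p, w)\<close> in the tangent bundle. All derivatives
  of \<open>F\<close> below, in \<open>x\<close> as well as in \<open>y\<close>, are read off from these.\<close>

definition dA :: "real ^ 'n \<Rightarrow> real ^ 'n \<Rightarrow> real ^ 'n \<Rightarrow> real ^ 'n \<Rightarrow> real" where
  "dA x y p w = grad_x A x y \<bullet> p + grad_y A x y \<bullet> w"
definition dB :: "real ^ 'n \<Rightarrow> real ^ 'n \<Rightarrow> real ^ 'n \<Rightarrow> real ^ 'n \<Rightarrow> real" where
  "dB x y p w = grad_x be x y \<bullet> p + grad_y be x y \<bullet> w"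

context
  fixes x y p w :: "real ^ 'n" assumes xU: "x \<in> U" and y0: "y \<noteq> 0"
begin

lemma A_curve: "((\<lambda>t. A (x + t *\<^sub>R p) (y + t *\<^sub>R w)) has_real_derivative dA x y p w) (at 0)"
  unfolding dA_def by (rule slit_DERIV[OF openU smooth_A xU y0])

lemma be_curve: "((\<lambda>t. be (x + t *\<^sub>R p) (y + t *\<^sub>R w)) has_real_derivative dB x y p w) (at 0)"
  unfolding dB_def by (rule slit_DERIV[OF openU smooth_be xU y0])

lemma al_curve: "((\<lambda>t. al (x + t *\<^sub>R p) (y + t *\<^sub>R w)) has_real_derivative dA x y p w / (2 * al x y)) (at 0)"
proof -
  have "(sqrt has_real_derivative inverse (sqrt (A x y)) / 2) (at (A (x + 0 *\<^sub>R p) (y + 0 *\<^sub>R w)))"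
    using DERIV_real_sqrt[OF A_pos[OF xU y0]] by simp
  from DERIV_chain2[OF this A_curve] show ?thesis by (simp add: al_def field_simps)
qed

lemma F_curve: "((\<lambda>t. F (x + t *\<^sub>R p) (y + t *\<^sub>R w)) has_real_derivative
    F x y * (uu x y / (2 * A x y * vv x y) * dA x y p w + kp / vv x y * dB x y p w)) (at 0)"
proof -
  note P = pos[OF xU y0]
  have 1: "((\<lambda>t. ph (al (x + t *\<^sub>R p) (y + t *\<^sub>R w)) (be (x + t *\<^sub>R p) (y + t *\<^sub>R w))) has_real_derivative
    F x y * (uu x y / (al x y * vv x y) * (dA x y p w / (2 * al x y)) + kp / vv x y * dB x y p w)) (at 0)"
    using ph_DERIV[OF al_curve be_curve] P(7) be_small[OF xU y0] F_eq[OF xU, of y] by (simp add: uu_def vv_def)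
  have 2: "uu x y / (al x y * vv x y) * (dA x y p w / (2 * al x y)) = uu x y / (2 * A x y * vv x y) * dA x y p w"
    using P by (simp add: al_sq[OF xU y0, symmetric] field_simps power2_eq_square)
  have 3: "\<forall>\<^sub>F t in nhds 0. F (x + t *\<^sub>R p) (y + t *\<^sub>R w) =
      ph (al (x + t *\<^sub>R p) (y + t *\<^sub>R w)) (be (x + t *\<^sub>R p) (y + t *\<^sub>R w))"
    by (rule eventually_mono[OF eventually_line[OF openU xU]]) (rule F_eq)
  show ?thesis using 1 unfolding 2 DERIV_cong_ev[OF refl 3 refl] .
qed

lemma L_curve: "((\<lambda>t. L (x + t *\<^sub>R p) (y + t *\<^sub>R w)) has_real_derivative
    fA x y * dA x y p w + fB x y * dB x y p w) (at 0)"
  unfolding L_def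
  by (rule derivative_eq_intros F_curve refl)+
    (use pos[OF xU y0] in \<open>simp add: fA_def fB_def L_def field_simps power2_eq_square\<close>)

lemma fB_curve: "((\<lambda>t. fB (x + t *\<^sub>R p) (y + t *\<^sub>R w)) has_real_derivative
    fAB x y * dA x y p w + fBB x y * dB x y p w) (at 0)"
proof -
  note P = pos[OF xU y0]
  define l where "l = al x y"
  define v where "v = l + (kp - lam) * be x y"
  have l: "l > 0" and v: "v > 0" and A: "A x y = l^2" and v': "vv x y = v"
    using P al_sq[OF xU y0] by (simp_all add: l_def v_def vv_def)
  have "((\<lambda>t. vv (x + t *\<^sub>R p) (y + t *\<^sub>R w)) has_real_derivative
      dA x y p w / (2 * l) + (kp - lam) * dB x y p w) (at 0)"
    unfolding vv_def l_def by (rule derivative_eq_intros al_curve be_curve refl)+ simp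
  note D = DERIV_divide[OF DERIV_cmult[OF L_curve, of "2 * kp"] this]
  have "(2 * kp * (fA x y * dA x y p w + fB x y * dB x y p w) * v
      - 2 * kp * L x y * (dA x y p w / (2 * l) + (kp - lam) * dB x y p w)) / (v * v)
    = fAB x y * dA x y p w + fBB x y * dB x y p w"
    using l v unfolding fA_def fB_def fAB_def fBB_def A v' uu_def l_def[symmetric]
    by (simp add: field_simps power2_eq_square)
  then show ?thesis using D P v' unfolding fB_def by simp
qed

lemma fA_curve: "((\<lambda>t. fA (x + t *\<^sub>R p) (y + t *\<^sub>R w)) has_real_derivative
    fAA x y * dA x y p w + fAB x y * dB x y p w) (at 0)"
proof -
  note P = pos[OF xU y0]
  define l where "l = al x y"
  define v where "v = l + (kp - lam) * be x y"
  have l: "l > 0" and v: "v > 0" and A: "A x y = l^2" and v': "vv x y = v"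
    using P al_sq[OF xU y0] by (simp_all add: l_def v_def vv_def)
  have V: "((\<lambda>t. vv (x + t *\<^sub>R p) (y + t *\<^sub>R w)) has_real_derivative
      dA x y p w / (2 * l) + (kp - lam) * dB x y p w) (at 0)"
    unfolding vv_def l_def by (rule derivative_eq_intros al_curve be_curve refl)+ simp
  have W: "((\<lambda>t. uu (x + t *\<^sub>R p) (y + t *\<^sub>R w)) has_real_derivative
      dA x y p w / (2 * l) - lam * dB x y p w) (at 0)"
    unfolding uu_def l_def by (rule derivative_eq_intros al_curve be_curve refl)+ simp
  have "((\<lambda>t. fA (x + t *\<^sub>R p) (y + t *\<^sub>R w)) has_real_derivative
     (((fA x y * dA x y p w + fB x y * dB x y p w) * uu x y + (dA x y p w / (2 * l) - lam * dB x y p w) * L x y)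
       * (A x y * vv x y) - L x y * uu x y * (dA x y p w * vv x y
         + (dA x y p w / (2 * l) + (kp - lam) * dB x y p w) * A x y)) / (A x y * vv x y * (A x y * vv x y))) (at 0)" (is "(_ has_real_derivative ?D) _")
    unfolding fA_def[of "x + _ *\<^sub>R p"]
    using DERIV_divide[OF DERIV_mult[OF L_curve W] DERIV_mult[OF A_curve V]] P by simp
  moreover have "?D
    = fAA x y * dA x y p w + fAB x y * dB x y p w"
    using l v unfolding fA_def fB_def fAB_def fAA_def A v' uu_def l_def[symmetric]
    by (simp add: field_simps power2_eq_square) (simp add: v_def algebra_simps)
  ultimately show ?thesis by simp
qed

end

lemma dA_y: "x \<in> U \<Longrightarrow> dA x y 0 w = 2 * ((a x *v y) \<bullet> w)"
  by (simp add: dA_def grad_y_A)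

lemma dB_y: "dB x y 0 w = b x \<bullet> w"
  by (simp add: dB_def grad_y_be)

lemma Dy_L: "x \<in> U \<Longrightarrow> y \<noteq> 0 \<Longrightarrow> Dy l L x y = 2 * fA x y * (a x *v y) $ l + fB x y * b x $ l"
  by (rule Dy_eqI) (use L_curve[of x y 0 "axis l 1"] in \<open>simp add: dA_y dB_y inner_axis mult_ac\<close>)

lemma Dx_L: "x \<in> U \<Longrightarrow> y \<noteq> 0 \<Longrightarrow> Dx l L x y = fA x y * grad_x A x y $ l + fB x y * grad_x be x y $ l"
  by (rule Dx_eqI) (use L_curve[of x y "axis l 1" 0] in \<open>simp add: dA_def dB_def inner_axis\<close>)

lemma Dy_F: "x \<in> U \<Longrightarrow> y \<noteq> 0 \<Longrightarrow>
    Dy l F x y = F x y * (uu x y / (A x y * vv x y) * (a x *v y) $ l + kp / vv x y * b x $ l)"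
  by (rule Dy_eqI) (use F_curve[of x y 0 "axis l 1"] in \<open>simp add: dA_y dB_y inner_axis\<close>)

text \<open>The Hessian of \<open>F\<^sup>2/2\<close> by the chain rule for a function of \<open>\<alpha>\<^sup>2\<close> and \<open>\<beta>\<close>.\<close>

definition gg :: "real ^ 'n \<Rightarrow> real ^ 'n \<Rightarrow> real ^ 'n ^ 'n" where
  "gg x y = (\<chi> i j. fA x y * a x $ i $ j + 2 * fAA x y * (a x *v y) $ i * (a x *v y) $ j
     + fAB x y * ((a x *v y) $ i * b x $ j + b x $ i * (a x *v y) $ j)
     + 1/2 * fBB x y * b x $ i * b x $ j)"

lemma Dy_Dy_L:
  assumes "x \<in> U" "y \<noteq> 0"
  shows "Dy j (Dy i L) x y = 2 * gg x y $ i $ j"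
proof -
  have "Dy j (Dy i L) x y = Dy j (\<lambda>x y. 2 * fA x y * (a x *v y) $ i + fB x y * b x $ i) x y"
    by (rule Dy_cong) (use assms in \<open>simp_all add: Dy_L\<close>)
  also have "\<dots> = 2 * gg x y $ i $ j"
  proof (rule Dy_eqI)
    have a: "((\<lambda>t. (a x *v (y + t *\<^sub>R axis j 1)) $ i) has_real_derivative a x $ i $ j) (at 0)"
      by (auto simp: matrix_vector_right_distrib matrix_vector_mult_scaleR matrix_vector_mult_basis column_def
          intro!: derivative_eq_intros)
    have A: "((\<lambda>t. fA x (y + t *\<^sub>R axis j 1)) has_real_derivative
        fAA x y * (2 * (a x *v y) $ j) + fAB x y * b x $ j) (at 0)"
      using fA_curve[OF assms, of 0 "axis j 1"] assms by (simp add: dA_y dB_y inner_axis)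
    have B: "((\<lambda>t. fB x (y + t *\<^sub>R axis j 1)) has_real_derivative
        fAB x y * (2 * (a x *v y) $ j) + fBB x y * b x $ j) (at 0)"
      using fB_curve[OF assms, of 0 "axis j 1"] assms by (simp add: dA_y dB_y inner_axis)
    show "((\<lambda>t. 2 * fA x (y + t *\<^sub>R axis j 1) * (a x *v (y + t *\<^sub>R axis j 1)) $ i +
        fB x (y + t *\<^sub>R axis j 1) * b x $ i) has_real_derivative 2 * gg x y $ i $ j) (at 0)"
      by (rule derivative_eq_intros a A B refl)+ (simp add: gg_def algebra_simps)
  qed
  finally show ?thesis .
qed

lemma L_eq: "L = (\<lambda>x y. (F x y)\<^sup>2)"
  by (simp add: L_def fun_eq_iff)

lemma fundamental_tensor_eq:
  assumes "x \<in> U" "y \<noteq> 0"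
  shows "fundamental_tensor F x y = gg x y"
  using Dy_Dy_L[OF assms] unfolding fundamental_tensor_def L_eq[symmetric] by (simp add: vec_eq_iff)

lemma gg_sym: "x \<in> U \<Longrightarrow> gg x y $ i $ j = gg x y $ j $ i"
  using a_sym[of x i j] by (simp add: gg_def mult_ac add_ac)

lemma gg_mult:
  "gg x y *v w = fA x y *\<^sub>R (a x *v w)
     + (2 * fAA x y * ((a x *v y) \<bullet> w) + fAB x y * (b x \<bullet> w)) *\<^sub>R (a x *v y)
     + (fAB x y * ((a x *v y) \<bullet> w) + 1/2 * fBB x y * (b x \<bullet> w)) *\<^sub>R b x"
proof -
  have "(gg x y *v w) $ i = (\<Sum>j\<in>UNIV. fA x y * (a x $ i $ j * w $ j)
     + 2 * fAA x y * (a x *v y) $ i * ((a x *v y) $ j * w $ j)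
     + fAB x y * (a x *v y) $ i * (b x $ j * w $ j) + fAB x y * b x $ i * ((a x *v y) $ j * w $ j)
     + 1/2 * fBB x y * b x $ i * (b x $ j * w $ j))" for i
    by (simp add: matrix_vector_mult_def gg_def[unfolded matrix_vector_mult_def] algebra_simps)
  also have "\<dots> i = fA x y * (a x *v w) $ i
     + 2 * fAA x y * (a x *v y) $ i * ((a x *v y) \<bullet> w)
     + fAB x y * (a x *v y) $ i * (b x \<bullet> w) + fAB x y * b x $ i * ((a x *v y) \<bullet> w)
     + 1/2 * fBB x y * b x $ i * (b x \<bullet> w)" for i
    unfolding sum.distrib sum_distrib_left[symmetric]
    by (simp add: inner_vec_def matrix_vector_mult_def)
  finally show ?thesis by (simp add: vec_eq_iff algebra_simps)
qed

text \<open>\<open>F\<^sup>2\<close> is homogeneous of degree two in \<open>(\<alpha>, \<beta>)\<close>, so its derivatives with respect to \<open>A = \<alpha>\<^sup>2\<close>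
  and \<open>\<beta>\<close> have degree zero and one; these are their Euler relations.\<close>

lemma euler:
  assumes "x \<in> U" "y \<noteq> 0"
  shows "2 * A x y * fAA x y + be x y * fAB x y = 0"
    and "2 * A x y * fAB x y + be x y * fBB x y = fB x y"
proof -
  note P = pos[OF assms]
  show "2 * A x y * fAA x y + be x y * fAB x y = 0"
    using P by (simp add: fAA_def)
  have "2 * (al x y - 2 * lam * be x y) + 2 * be x y * (kp + lam) = 2 * vv x y"
    by (simp add: vv_def algebra_simps)
  moreover have "2 * A x y * fAB x y + be x y * fBB x y
      = L x y * kp / (vv x y)^2 * (2 * (al x y - 2 * lam * be x y) + 2 * be x y * (kp + lam))"
    using P by (simp add: fAB_def fBB_def divide_simps) (simp add: algebra_simps)
  moreover have "L x y * kp / (vv x y)^2 * (2 * vv x y) = fB x y"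
    using P by (simp add: fB_def power2_eq_square)
  ultimately show "2 * A x y * fAB x y + be x y * fBB x y = fB x y" by simp
qed

text \<open>The equations that determine the coefficients of \<open>y\<close>, \<open>b\<close> and \<open>s\<^sup>i\<^sub>0\<close> in the spray. Divided by \<open>F\<^sup>2\<close> they are
  rational identities in \<open>\<alpha>, \<beta>\<close>; the second one rests on \<open>\<kappa> \<lambda> = 2\<close>.\<close>

lemma spray_scalars:
  assumes "x \<in> U" "y \<noteq> 0"
  shows "2 * kp * (al x y - 2 * lam * be x y) * fA x y
      + 4 * A x y * (2 * fAA x y * be x y + fAB x y * bb x) = 2 * fAB x y * qq x y" (is ?E1)
    and "kp * (al x y - 2 * lam * be x y) * fB x y
      + 4 * A x y * (fA x y + fAB x y * be x y + 1/2 * fBB x y * bb x) = fBB x y * qq x y" (is ?E2)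
    and "2 * fA x y * PP x y = fB x y" (is ?E3)
proof -
  note P = pos[OF assms]
  define K where "K = L x y / (vv x y)^2"
  define l where "l = al x y"
  define s where "s = be x y"
  define u where "u = uu x y"
  define v where "v = vv x y"
  have u: "u = l - lam * s" and v: "v = l + (kp - lam) * s" by (simp_all add: u_def v_def l_def s_def uu_def vv_def)
  have ne: "l > 0" "u > 0" "v > 0" "A x y = l^2"
    using P al_sq[OF assms] by (auto simp: l_def u_def v_def)
  have c: "fA x y = K * (u * v / l^2)" "fB x y = K * (2 * kp * v)" "fAB x y = K * (kp * (l - 2 * lam * s) / l^2)"
    "fBB x y = K * (2 * kp * (kp + lam))" "fAA x y = K * (- s * kp * (l - 2 * lam * s) / (2 * l^2 * l^2))"
    "qq x y = u * v + 2 * (bb x * l^2 - s^2)"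
    using ne unfolding K_def fA_def fB_def fAB_def fBB_def fAA_def qq_def l_def[symmetric] s_def[symmetric]
      u_def[symmetric] v_def[symmetric] ne(4)
    by (simp_all add: field_simps power2_eq_square)
  show ?E1
    unfolding c l_def[symmetric] s_def[symmetric] ne(4) using ne by (simp add: field_simps power2_eq_square)
  have "kp * (l - 2 * lam * s) * (2 * kp * v) + 4 * u * v + 4 * kp * (l - 2 * lam * s) * s
      + 4 * l^2 * kp * (kp + lam) * bb x = 2 * kp * (kp + lam) * (u * v + 2 * (bb x * l^2 - s^2))"
    using kplam unfolding u v by (elim disjE conjE) (simp_all add: algebra_simps power2_eq_square)
  then have "K * (kp * (l - 2 * lam * s) * (2 * kp * v) + 4 * u * v + 4 * kp * (l - 2 * lam * s) * s
      + 4 * l^2 * kp * (kp + lam) * bb x) = K * (2 * kp * (kp + lam) * (u * v + 2 * (bb x * l^2 - s^2)))"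
    by simp
  moreover have "kp * (l - 2 * lam * s) * (K * (2 * kp * v))
      + 4 * l^2 * (K * (u * v / l^2) + K * (kp * (l - 2 * lam * s) / l^2) * s + 1/2 * (K * (2 * kp * (kp + lam))) * bb x)
     = K * (kp * (l - 2 * lam * s) * (2 * kp * v) + 4 * u * v + 4 * kp * (l - 2 * lam * s) * s
      + 4 * l^2 * kp * (kp + lam) * bb x)"
    using ne by (simp add: field_simps)
  ultimately show ?E2
    unfolding c l_def[symmetric] s_def[symmetric] ne(4) by (simp add: mult_ac)
  show ?E3 unfolding c PP_def u_def[symmetric] ne(4) using ne by (simp add: field_simps)
qed

text \<open>Pairing \<open>g w = 0\<close> with \<open>y\<close> and with \<open>b\<close> gives two linear equations for the numbers \<open>y\<^sub>i w\<^sup>i\<close> and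
  \<open>b\<^sub>i w\<^sup>i\<close>. Their determinant is a positive multiple of \<open>q\<close>, so both numbers vanish, and what remains of
  \<open>g w = 0\<close> is \<open>a w = 0\<close>.\<close>

lemma det_gg:
  assumes "x \<in> U" "y \<noteq> 0"
  shows "det (gg x y) \<noteq> 0"
proof -
  note P = pos[OF assms] and E = euler[OF assms] and S = spray_scalars[OF assms]
  have "w = 0" if w: "gg x y *v w = 0" for w
  proof -
    define Y where "Y = (a x *v y) \<bullet> w"
    define Z where "Z = b x \<bullet> w"
    \<comment> \<open>the coefficients of \<open>y\<^sub>i\<close> and \<open>b\<^sub>i\<close> in \<open>g w\<close>\<close>
    define k1 where "k1 = 2 * fAA x y * Y + fAB x y * Z"
    define k2 where "k2 = fAB x y * Y + 1/2 * fBB x y * Z"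
    have g: "fA x y *\<^sub>R (a x *v w) + k1 *\<^sub>R (a x *v y) + k2 *\<^sub>R b x = 0"
      using w unfolding gg_mult Y_def Z_def k1_def k2_def .
    have "y \<bullet> (fA x y *\<^sub>R (a x *v w) + k1 *\<^sub>R (a x *v y) + k2 *\<^sub>R b x) = fA x y * Y + k1 * A x y + k2 * be x y"
      using a_inner[OF assms(1), of y w]
      by (simp add: inner_add_right Y_def A_def be_def inner_commute)
    then have "fA x y * Y + k1 * A x y + k2 * be x y = 0" by (simp add: g)
    moreover have "fA x y * Y + k1 * A x y + k2 * be x y = fA x y * Y + 1/2 * fB x y * Z"
    proof -
      have "k1 * A x y + k2 * be x y = (2 * A x y * fAA x y + be x y * fAB x y) * Y
          + 1/2 * (2 * A x y * fAB x y + be x y * fBB x y) * Z"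
        by (simp add: k1_def k2_def algebra_simps)
      then show ?thesis by (simp add: E)
    qed
    ultimately have "fA x y * Y + 1/2 * fB x y * Z = 0" by simp
    then have "fA x y * (Y + PP x y * Z) = 0" unfolding S(3)[symmetric] by (simp add: algebra_simps)
    moreover have fA: "fA x y > 0" using P by (simp add: fA_def)
    ultimately have Y: "Y = - PP x y * Z" by simp
    have "bu x \<bullet> (fA x y *\<^sub>R (a x *v w) + k1 *\<^sub>R (a x *v y) + k2 *\<^sub>R b x) = fA x y * Z + k1 * be x y + k2 * bb x"
      using a_inner[OF assms(1), of "bu x" w]
      by (simp add: inner_add_right Z_def be_inner[OF assms(1)] bb_def a_bu[OF assms(1)] inner_commute)
    then have 0: "fA x y * Z + k1 * be x y + k2 * bb x = 0" by (simp add: g)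
    have "0 = 4 * A x y * (fA x y * Z + k1 * be x y + k2 * bb x)" by (simp add: 0)
    also have "\<dots> = Z * (4 * A x y * (fA x y + fAB x y * be x y + 1/2 * fBB x y * bb x)
        - PP x y * (4 * A x y * (2 * fAA x y * be x y + fAB x y * bb x)))"
      by (simp add: k1_def k2_def Y algebra_simps)
    also have "\<dots> = Z * (fBB x y * qq x y - kp * (al x y - 2 * lam * be x y) * fB x y
        - PP x y * (2 * fAB x y * qq x y - 2 * kp * (al x y - 2 * lam * be x y) * fA x y))"
    proof -
      have 1: "4 * A x y * (2 * fAA x y * be x y + fAB x y * bb x)
          = 2 * fAB x y * qq x y - 2 * kp * (al x y - 2 * lam * be x y) * fA x y" using S(1) by linarith
      have 2: "4 * A x y * (fA x y + fAB x y * be x y + 1/2 * fBB x y * bb x)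
          = fBB x y * qq x y - kp * (al x y - 2 * lam * be x y) * fB x y" using S(2) by linarith
      show ?thesis unfolding 1 2 ..
    qed
    also have "\<dots> = Z * (qq x y * (fBB x y - 2 * PP x y * fAB x y))"
      unfolding S(3)[symmetric] by (simp add: algebra_simps)
    also have "fBB x y - 2 * PP x y * fAB x y = 4 * L x y / (uu x y * vv x y)"
    proof -
      have "(kp + lam) * uu x y - kp * (al x y - 2 * lam * be x y) = lam * vv x y"
        by (simp add: uu_def vv_def algebra_simps)
      then have 1: "2 * kp * L x y / ((vv x y)^2 * uu x y) * ((kp + lam) * uu x y - kp * (al x y - 2 * lam * be x y))
        = 2 * kp * L x y / ((vv x y)^2 * uu x y) * (lam * vv x y)" by simp
      have 2: "2 * kp * L x y / ((vv x y)^2 * uu x y) * (lam * vv x y) = 4 * L x y / (uu x y * vv x y)"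
        using P kp_lam(1) by (simp add: field_simps power2_eq_square)
      have 3: "fBB x y - 2 * PP x y * fAB x y
        = 2 * kp * L x y / ((vv x y)^2 * uu x y) * ((kp + lam) * uu x y - kp * (al x y - 2 * lam * be x y))"
        using P by (simp add: fBB_def PP_def fAB_def field_simps power2_eq_square)
      show ?thesis by (rule trans[OF 3 trans[OF 1 2]])
    qed
    finally have "Z = 0" using P by simp
    then have "Y = 0" "k1 = 0" "k2 = 0" by (simp_all add: Y k1_def k2_def)
    then have "a x *v w = 0" using g fA by simp
    then show "w = 0" using pos_a[OF assms(1), of w] by force
  qed
  then show ?thesis
    using matrix_left_invertible_ker[of "gg x y"] invertible_left_inverse[of "gg x y"] by (simp add: invertible_det_nz)
qed

text \<open>Apart from the contribution of the spray of \<open>\<alpha>\<close>, only the covariant derivative of \<open>\<beta>\<close> enters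
  the Euler--Lagrange expression of \<open>F\<^sup>2\<close>: along that spray \<open>\<alpha>\<close> is constant and \<open>y\<^sub>i\<close> obeys the
  geodesic equation.\<close>

lemma euler_lagrange:
  assumes "x \<in> U" "y \<noteq> 0"
  shows "(\<Sum>k\<in>UNIV. Dx k (Dy l L) x y * y $ k) - Dx l L x y =
    4 * (gg x y *v Gb x y) $ l
    + 2 * fAB x y * r00 x y * (a x *v y) $ l + fBB x y * r00 x y * b x $ l + 2 * fB x y * (sm x *v y) $ l"
proof -
  \<comment> \<open>\<open>(y, w)\<close> is the spray vector field of \<open>\<alpha>\<close>\<close>
  define w where "w = - 2 *\<^sub>R Gb x y"
  have dA: "dA x y y w = 0" and dB: "dB x y y w = r00 x y"
    using A_along_spray[OF assms(1), of y] be_along_spray[OF assms(1), of y] by (simp_all add: dA_def dB_def w_def)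
  have 1: "((\<lambda>t. Dy l L (x + t *\<^sub>R y) (y + t *\<^sub>R w)) has_real_derivative
      (grad_x (Dy l L) x y \<bullet> y + grad_y (Dy l L) x y \<bullet> w)) (at 0)"
    by (rule slit_DERIV[OF openU slit_Dy[OF openU smooth_L] assms])
  have 2: "((\<lambda>t. 2 * fA (x + t *\<^sub>R y) (y + t *\<^sub>R w) * (\<Sum>j\<in>UNIV. a (x + t *\<^sub>R y) $ l $ j * (y + t *\<^sub>R w) $ j)
        + fB (x + t *\<^sub>R y) (y + t *\<^sub>R w) * b (x + t *\<^sub>R y) $ l) has_real_derivative
      2 * fAB x y * r00 x y * (a x *v y) $ l
      + 2 * fA x y * (\<Sum>j\<in>UNIV. (\<Sum>k\<in>UNIV. pd k (\<lambda>x. a x $ l $ j) x * y $ k) * y $ j + a x $ l $ j * w $ j)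
      + fBB x y * r00 x y * b x $ l + fB x y * (\<Sum>k\<in>UNIV. pd k (\<lambda>x. b x $ l) x * y $ k)) (at 0)"
  proof -
    have a: "((\<lambda>t. a (x + t *\<^sub>R y) $ l $ j) has_real_derivative (\<Sum>k\<in>UNIV. pd k (\<lambda>x. a x $ l $ j) x * y $ k)) (at 0)" for j
      using slit_DERIV[OF openU slit_base[OF openU smooth_a'[of l j]] assms, where u=y and w=0]
      by (simp add: grad_x_def inner_vec_def Dx_base[OF smooth_a' assms(1)])
    have b: "((\<lambda>t. b (x + t *\<^sub>R y) $ l) has_real_derivative (\<Sum>k\<in>UNIV. pd k (\<lambda>x. b x $ l) x * y $ k)) (at 0)"
      using slit_DERIV[OF openU slit_base[OF openU smooth_b'[of l]] assms, where u=y and w=0]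
      by (simp add: grad_x_def inner_vec_def Dx_base[OF smooth_b' assms(1)])
    have y: "((\<lambda>t. (y + t *\<^sub>R w) $ j) has_real_derivative w $ j) (at 0)" for j
      by (auto intro!: derivative_eq_intros)
    show ?thesis
      by (rule derivative_eq_intros a b y fA_curve[OF assms] fB_curve[OF assms] refl)+
        (simp add: dA dB matrix_vector_mult_def algebra_simps)
  qed
  have "\<forall>\<^sub>F t in nhds 0. Dy l L (x + t *\<^sub>R y) (y + t *\<^sub>R w) =
     2 * fA (x + t *\<^sub>R y) (y + t *\<^sub>R w) * (\<Sum>j\<in>UNIV. a (x + t *\<^sub>R y) $ l $ j * (y + t *\<^sub>R w) $ j)
        + fB (x + t *\<^sub>R y) (y + t *\<^sub>R w) * b (x + t *\<^sub>R y) $ l"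
  proof (rule eventually_mono[OF eventually_conj[OF eventually_line[OF openU assms(1), of y]
        eventually_line[of "- {0}" y w]]])
    fix t :: real
    assume "x + t *\<^sub>R y \<in> U \<and> y + t *\<^sub>R w \<in> - {0}"
    then show "Dy l L (x + t *\<^sub>R y) (y + t *\<^sub>R w) =
     2 * fA (x + t *\<^sub>R y) (y + t *\<^sub>R w) * (\<Sum>j\<in>UNIV. a (x + t *\<^sub>R y) $ l $ j * (y + t *\<^sub>R w) $ j)
        + fB (x + t *\<^sub>R y) (y + t *\<^sub>R w) * b (x + t *\<^sub>R y) $ l"
      using Dy_L[of "x + t *\<^sub>R y" "y + t *\<^sub>R w" l] by (simp add: matrix_vector_mult_def)
  qed (use assms(2) in auto)
  then have "grad_x (Dy l L) x y \<bullet> y + grad_y (Dy l L) x y \<bullet> w = 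
      2 * fAB x y * r00 x y * (a x *v y) $ l
      + 2 * fA x y * (\<Sum>j\<in>UNIV. (\<Sum>k\<in>UNIV. pd k (\<lambda>x. a x $ l $ j) x * y $ k) * y $ j + a x $ l $ j * w $ j)
      + fBB x y * r00 x y * b x $ l + fB x y * (\<Sum>k\<in>UNIV. pd k (\<lambda>x. b x $ l) x * y $ k)"
    using DERIV_unique[OF 1] 2 by (simp add: DERIV_cong_ev)
  also have "(\<Sum>j\<in>UNIV. (\<Sum>k\<in>UNIV. pd k (\<lambda>x. a x $ l $ j) x * y $ k) * y $ j + a x $ l $ j * w $ j)
      = 1/2 * grad_x A x y $ l"
  proof -
    have "(\<Sum>j\<in>UNIV. a x $ l $ j * w $ j) = - 2 * (a x *v Gb x y) $ l"
      by (simp add: w_def matrix_vector_mult_def sum_distrib_left mult_ac sum_negf)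
    then show ?thesis using a_Gb[OF assms(1), of y l]
      by (simp add: sum.distrib sum_distrib_left sum_distrib_right mult_ac)
  qed
  finally have "grad_x (Dy l L) x y \<bullet> y = 2 * fAB x y * r00 x y * (a x *v y) $ l + fA x y * grad_x A x y $ l
      + fBB x y * r00 x y * b x $ l + fB x y * (\<Sum>k\<in>UNIV. pd k (\<lambda>x. b x $ l) x * y $ k)
      - grad_y (Dy l L) x y \<bullet> w"
    by simp
  moreover have "grad_y (Dy l L) x y \<bullet> w = - 4 * (gg x y *v Gb x y) $ l"
    by (simp add: grad_y_def inner_vec_def Dy_Dy_L[OF assms] w_def matrix_vector_mult_def sum_distrib_left
        mult_ac sum_negf)
  moreover have "grad_x (Dy l L) x y \<bullet> y = (\<Sum>k\<in>UNIV. Dx k (Dy l L) x y * y $ k)"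
    by (simp add: grad_x_def inner_vec_def)
  moreover have "fB x y * (\<Sum>k\<in>UNIV. pd k (\<lambda>x. b x $ l) x * y $ k) = fB x y * grad_x be x y $ l + 2 * fB x y * (sm x *v y) $ l"
    using b_curl[OF assms(1), of l y] by (simp add: algebra_simps)
  ultimately show ?thesis unfolding Dx_L[OF assms] by linarith
qed

lemma gg_y:
  assumes "x \<in> U" "y \<noteq> 0"
  shows "gg x y *v y = fA x y *\<^sub>R (a x *v y) + (1/2 * fB x y) *\<^sub>R b x"
proof -
  have "2 * fAA x y * A x y + fAB x y * be x y = 0" "fAB x y * A x y + 1/2 * fBB x y * be x y = 1/2 * fB x y"
    using euler[OF assms] by (simp_all add: mult_ac)
  then show ?thesis by (simp add: gg_mult inner_commute[of "a x *v y"] A_def[symmetric] be_def[symmetric])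
qed

text \<open>The right-hand side is a combination of the three covectors \<open>y\<^sub>i\<close>, \<open>b\<^sub>i\<close> and \<open>s\<^sub>i\<^sub>0\<close>, and so is
  \<open>g\<close> applied to the proposed correction of the spray; the scalar equations above match the coefficients.\<close>

lemma gg_GG:
  assumes "x \<in> U" "y \<noteq> 0"
  shows "4 *\<^sub>R (gg x y *v GG x y) = 4 *\<^sub>R (gg x y *v Gb x y)
    + (2 * fAB x y * r00 x y) *\<^sub>R (a x *v y) + (fBB x y * r00 x y) *\<^sub>R b x + (2 * fB x y) *\<^sub>R (sm x *v y)"
proof -
  note P = pos[OF assms] and S = spray_scalars[OF assms]
  have su: "gg x y *v su x y = fA x y *\<^sub>R (sm x *v y) + (fAB x y * s0 x y) *\<^sub>R (a x *v y)
      + (1/2 * fBB x y * s0 x y) *\<^sub>R b x"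
    by (simp add: gg_mult a_su[OF assms(1)] y_su[OF assms(1)] s0_def)
  have bu: "gg x y *v bu x = fA x y *\<^sub>R b x + (2 * fAA x y * be x y + fAB x y * bb x) *\<^sub>R (a x *v y)
      + (fAB x y * be x y + 1/2 * fBB x y * bb x) *\<^sub>R b x"
    by (simp add: gg_mult a_bu[OF assms(1)] be_inner[OF assms(1)] bb_def inner_commute)
  define p' where "p' = kp * (al x y - 2 * lam * be x y)"
  define X where "X = XX x y"
  define q where "q = qq x y"
  have q: "q > 0" using P by (simp add: q_def)
  have p: "pp x y = p' * X / (2 * q)" and m: "mm x y = A x y * X / q"
    by (simp_all add: pp_def mm_def p'_def X_def q_def)
  have E1: "4 * (pp x y * fA x y + mm x y * (2 * fAA x y * be x y + fAB x y * bb x)) = 2 * fAB x y * X"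
  proof -
    have "4 * (pp x y * fA x y + mm x y * (2 * fAA x y * be x y + fAB x y * bb x))
      = X / q * (2 * p' * fA x y + 4 * A x y * (2 * fAA x y * be x y + fAB x y * bb x))"
      using q by (simp add: p m field_simps)
    also have "\<dots> = X / q * (2 * fAB x y * q)" using S(1) by (simp add: p'_def q_def mult_ac)
    finally show ?thesis using q by simp
  qed
  have E2: "4 * (1/2 * pp x y * fB x y + mm x y * (fA x y + fAB x y * be x y + 1/2 * fBB x y * bb x)) = fBB x y * X"
  proof -
    have "4 * (1/2 * pp x y * fB x y + mm x y * (fA x y + fAB x y * be x y + 1/2 * fBB x y * bb x))
      = X / q * (p' * fB x y + 4 * A x y * (fA x y + fAB x y * be x y + 1/2 * fBB x y * bb x))"
      using q by (simp add: p m field_simps)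
    also have "\<dots> = X / q * (fBB x y * q)" using S(2) by (simp add: p'_def q_def mult_ac)
    finally show ?thesis using q by simp
  qed
  have "4 *\<^sub>R (gg x y *v GG x y) = 4 *\<^sub>R (gg x y *v Gb x y)
     + (4 * PP x y * fA x y) *\<^sub>R (sm x *v y)
     + (4 * PP x y * fAB x y * s0 x y
        + 4 * (pp x y * fA x y + mm x y * (2 * fAA x y * be x y + fAB x y * bb x))) *\<^sub>R (a x *v y)
     + (2 * PP x y * fBB x y * s0 x y
        + 4 * (1/2 * pp x y * fB x y + mm x y * (fA x y + fAB x y * be x y + 1/2 * fBB x y * bb x))) *\<^sub>R b x"
    by (simp add: GG_def matrix_vector_right_distrib matrix_vector_mult_scaleR su gg_y[OF assms] bu)
      (simp add: vec_eq_iff algebra_simps)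
  also have "4 * PP x y * fA x y = 2 * fB x y" using S(3) by (simp add: mult_ac)
  also have "4 * PP x y * fAB x y * s0 x y
        + 4 * (pp x y * fA x y + mm x y * (2 * fAA x y * be x y + fAB x y * bb x)) = 2 * fAB x y * r00 x y"
    unfolding E1 X_def XX_def by (simp add: algebra_simps)
  also have "2 * PP x y * fBB x y * s0 x y
        + 4 * (1/2 * pp x y * fB x y + mm x y * (fA x y + fAB x y * be x y + 1/2 * fBB x y * bb x)) = fBB x y * r00 x y"
    unfolding E2 X_def XX_def by (simp add: algebra_simps)
  finally show ?thesis by (simp add: add_ac)
qed

text \<open>No inverse of \<open>g\<close> is computed: the proposed spray satisfies the equation that defines it, and \<open>g\<close> is
  injective.\<close>

theorem spray_coeff_eq:
  assumes "x \<in> U" "y \<noteq> 0"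
  shows "spray_coeff F i x y = GG x y $ i"
proof -
  have "(\<Sum>k\<in>UNIV. Dx k (Dy l L) x y * y $ k) - Dx l L x y = 4 * (gg x y *v GG x y) $ l" for l
    unfolding euler_lagrange[OF assms] using arg_cong[OF gg_GG[OF assms], of "\<lambda>v. v $ l"] by simp
  then have "spray_coeff F i x y = (matrix_inv (gg x y) *v (gg x y *v GG x y)) $ i"
    unfolding spray_coeff_def L_eq[symmetric] fundamental_tensor_eq[OF assms]
    by (simp add: matrix_vector_mult_def[of "matrix_inv (gg x y)"] sum_distrib_left)
  then show ?thesis
    using matrix_inv_inverse(2)[OF det_gg[OF assms]] by (simp add: matrix_vector_mul_assoc)
qed

end

section \<open>Polynomial identities\<close>

lemma poly_zero_on_interval:
  fixes p :: "real poly"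
  assumes "B > 0" "\<And>s. s^2 < B \<Longrightarrow> poly p s = 0"
  shows "poly p s = 0"
proof (cases "p = 0")
  case False
  have "{- sqrt B <..< sqrt B} \<subseteq> {s. poly p s = 0}"
  proof
    fix s assume "s \<in> {- sqrt B <..< sqrt B}"
    then have "\<bar>s\<bar> < sqrt B" by auto
    then have "s^2 < B" using real_sqrt_abs real_sqrt_less_iff by (metis (no_types))
    then show "s \<in> {s. poly p s = 0}" using assms(2) by simp
  qed
  moreover have "infinite {- sqrt B <..< sqrt B}" using assms(1) by simp
  ultimately show ?thesis using poly_roots_finite[OF False] finite_subset by blast
qed simp

text \<open>Here \<open>q = 1 + 2 B - 3 s\<^sup>2\<close> with \<open>B = \<parallel>\<beta>\<parallel>\<^sup>2\<close>, and \<open>n\<close> is the dimension plus one. At \<open>s = 0\<close> and at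
  the zeros of \<open>q\<close> the equation determines \<open>rv\<close> and \<open>rb\<close> as multiples of \<open>c\<close>. With these values the
  polynomial is divisible by \<open>q\<^sup>2\<close>, and the values of the quotient at \<open>1\<close> and \<open>-1\<close> force \<open>c = 0\<close>.\<close>

lemma square_even:
  fixes n B c :: real
  assumes B: "0 < B" "B < 1" and n: "n > 0"
    and eq: "\<And>s. s^2 < B \<Longrightarrow> 2 * s * B * rb * (1 + 2 * B - 3 * s^2)
      + (n * (1 - 2 * s) * (1 + 2 * B - 3 * s^2) + 6 * s * (B - s^2)) * (B^2 * rv - s^2 * B * rv + s^2 * rb)
      - B^2 * n * c * (1 + s)^2 * (1 + 2 * B - 3 * s^2)^2 - s * B * eb * (1 + 2 * B - 3 * s^2)^2 = 0"
  shows "rv = 0 \<and> rb = 0"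
proof -
  define q where "q = [:1 + 2 * B, 0, -3:]"
  define p where "p = [:0, 2 * B * rb:] * q
     + ([:n, - 2 * n:] * q + [:0, 6:] * [:B, 0, -1:]) * [:B^2 * rv, 0, rb - B * rv:]
     - [:B^2 * n * c:] * [:1, 1:]^2 * q^2 - [:0, B * eb:] * q^2"
  have q: "poly q s = 1 + 2 * B - 3 * s^2" for s by (simp add: q_def power2_eq_square)
  have p: "poly p s = 2 * s * B * rb * (1 + 2 * B - 3 * s^2)
      + (n * (1 - 2 * s) * (1 + 2 * B - 3 * s^2) + 6 * s * (B - s^2)) * (B^2 * rv - s^2 * B * rv + s^2 * rb)
      - B^2 * n * c * (1 + s)^2 * (1 + 2 * B - 3 * s^2)^2 - s * B * eb * (1 + 2 * B - 3 * s^2)^2" (is "_ = ?E s") for s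
    unfolding p_def by (simp add: q) (simp add: algebra_simps power2_eq_square)
  have all: "?E s = 0" for s
    unfolding p[symmetric] by (rule poly_zero_on_interval[OF B(1)]) (simp only: p eq)
  have "B^2 * n * (1 + 2 * B) * (rv - c * (1 + 2 * B)) = 0"
    using all[of 0] by (simp add: algebra_simps power2_eq_square)
  then have rv: "rv = c * (1 + 2 * B)" using B n by simp
  \<comment> \<open>a zero of \<open>q\<close>; it may exceed \<open>\<parallel>\<beta>\<parallel>\<close>, which is why the identity was extended to all \<open>s\<close>\<close>
  define s0 where "s0 = sqrt ((1 + 2 * B) / 3)"
  have s0: "s0^2 = (1 + 2 * B) / 3" "s0 > 0" using B by (simp_all add: s0_def)
  have q0: "1 + 2 * B - 3 * ((1 + 2 * B) / 3) = 0" by simp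
  have "6 * s0 * (B - (1 + 2 * B) / 3) * (B^2 * rv - (1 + 2 * B) / 3 * B * rv + (1 + 2 * B) / 3 * rb) = 0"
    using all[of s0] unfolding s0(1) q0 by simp
  moreover have "B - (1 + 2 * B) / 3 \<noteq> 0" using B by (simp add: field_simps)
  ultimately have "B^2 * rv - (1 + 2 * B) / 3 * B * rv + (1 + 2 * B) / 3 * rb = 0" using s0(2) by simp
  then have "(1 + 2 * B) * (rb - B * c * (1 - B)) = 0"
    unfolding rv by (simp add: field_simps power2_eq_square)
  then have rb: "rb = B * c * (1 - B)" using B by simp
  \<comment> \<open>\<open>q = 2 B - 2 \<noteq> 0\<close> at \<open>s = 1\<close> and \<open>s = -1\<close>\<close>
  have "B * (2 * B - 2)^2 * (B * c * (2 - 5 * n) - eb) = 0"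
    using all[of 1] B(1) unfolding rv rb by (simp add: field_simps power2_eq_square)
  moreover have "B * (2 * B - 2)^2 * (B * c * (3 * n - 2) + eb) = 0"
    using all[of "-1"] B(1) unfolding rv rb by (simp add: field_simps power2_eq_square)
  ultimately have "B * c * (2 - 5 * n) - eb = 0" "B * c * (3 * n - 2) + eb = 0" using B by auto
  then have "B * c * (2 - 5 * n) + B * c * (3 * n - 2) = 0" by linarith
  moreover have "B * c * (2 - 5 * n) + B * c * (3 * n - 2) = - 2 * (B * c * n)" by (simp add: algebra_simps)
  ultimately have "c = 0" using B n by simp
  then show ?thesis using rv rb by simp
qed

text \<open>At the two zeros of \<open>q\<close> only the middle term survives, which leaves two linear
  equations for \<open>rm\<close> and \<open>sg\<close>.\<close>

lemma square_odd:
  fixes n B :: real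
  assumes B: "0 < B" "B < 1"
    and eq: "\<And>s. s^2 < B \<Longrightarrow> 2 * (1 + 2 * B - 3 * s^2) * (1 - s) * B * (rm + sg)
      + (n * (1 - 2 * s) * (1 + 2 * B - 3 * s^2) + 6 * s * (B - s^2)) * (2 * s * rm * (1 - s) - 4 * B * sg)
      - ev * (1 + 2 * B - 3 * s^2)^2 * (1 - s) * B = 0"
  shows "rm = 0 \<and> sg = 0"
proof -
  define q where "q = [:1 + 2 * B, 0, -3:]"
  define p where "p = [:2 * B * (rm + sg):] * q * [:1, -1:]
     + ([:n, - 2 * n:] * q + [:0, 6:] * [:B, 0, -1:]) * [:- 4 * B * sg, 2 * rm, - 2 * rm:]
     - [:ev * B:] * q^2 * [:1, -1:]"
  have q: "poly q s = 1 + 2 * B - 3 * s^2" for s by (simp add: q_def power2_eq_square)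
  have p: "poly p s = 2 * (1 + 2 * B - 3 * s^2) * (1 - s) * B * (rm + sg)
      + (n * (1 - 2 * s) * (1 + 2 * B - 3 * s^2) + 6 * s * (B - s^2)) * (2 * s * rm * (1 - s) - 4 * B * sg)
      - ev * (1 + 2 * B - 3 * s^2)^2 * (1 - s) * B" (is "_ = ?E s") for s
    unfolding p_def by (simp add: q) (simp add: algebra_simps power2_eq_square)
  have all: "?E s = 0" for s
    unfolding p[symmetric] by (rule poly_zero_on_interval[OF B(1)]) (simp only: p eq)
  \<comment> \<open>a zero of \<open>q\<close>; it may exceed \<open>\<parallel>\<beta>\<parallel>\<close>, which is why the identity was extended to all \<open>s\<close>\<close>
  define s0 where "s0 = sqrt ((1 + 2 * B) / 3)"
  have s0: "s0^2 = (1 + 2 * B) / 3" "s0 > 0" using B by (simp_all add: s0_def)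
  have q0: "1 + 2 * B - 3 * ((1 + 2 * B) / 3) = 0" by simp
  have w: "B - (1 + 2 * B) / 3 \<noteq> 0" using B by (simp add: field_simps)
  have "6 * s0 * (B - (1 + 2 * B) / 3) * (2 * s0 * rm * (1 - s0) - 4 * B * sg) = 0"
    using all[of s0] unfolding s0(1) q0 by simp
  then have 1: "2 * s0 * rm * (1 - s0) - 4 * B * sg = 0" using s0(2) w by simp
  have "6 * (- s0) * (B - (1 + 2 * B) / 3) * (2 * (- s0) * rm * (1 - (- s0)) - 4 * B * sg) = 0"
    using all[of "- s0"] unfolding power2_minus s0(1) q0 by simp
  then have 2: "2 * (- s0) * rm * (1 - (- s0)) - 4 * B * sg = 0" using s0(2) w by simp
  have "4 * s0 * rm = (2 * s0 * rm * (1 - s0) - 4 * B * sg) - (2 * (- s0) * rm * (1 - (- s0)) - 4 * B * sg)"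
    by (simp add: algebra_simps)
  then have "4 * s0 * rm = 0" unfolding 1 2 by simp
  then have "rm = 0" using s0(2) by simp
  then show ?thesis using 1 B by simp
qed

text \<open>Here \<open>q = 1 + 2 B - 3 s\<close> is linear. The factor \<open>1 - s\<close> clears the denominator of \<open>F\<close>, so that
  \<open>s = 1\<close> isolates \<open>c\<close>; then \<open>s = 0\<close> isolates \<open>rv\<close> and the zero of \<open>q\<close> isolates \<open>rb\<close>.\<close>

lemma matsumoto_even:
  fixes n B c :: real
  assumes B: "0 < B" "B < 1/4" and n: "n > 0"
    and eq: "\<And>s. s^2 < B \<Longrightarrow> (2 * s * B * rb * (1 + 2 * B - 3 * s)
      + (n * (1 - 4 * s) * (1 + 2 * B - 3 * s) / 2 + 3 * (B - s^2)) * (B^2 * rv - s^2 * B * rv + s^2 * rb)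
      - s * B * eb * (1 + 2 * B - 3 * s)^2) * (1 - s) - B^2 * n * c * (1 + 2 * B - 3 * s)^2 = 0"
  shows "rv = 0 \<and> rb = 0"
proof -
  define q where "q = [:1 + 2 * B, -3:]"
  define p where "p = ([:0, 2 * B * rb:] * q
     + ([:n / 2, - 2 * n:] * q + [:3 * B, 0, -3:]) * [:B^2 * rv, 0, rb - B * rv:]
     - [:0, B * eb:] * q^2) * [:1, -1:] - [:B^2 * n * c:] * q^2"
  have q: "poly q s = 1 + 2 * B - 3 * s" for s by (simp add: q_def)
  have p: "poly p s = (2 * s * B * rb * (1 + 2 * B - 3 * s)
      + (n * (1 - 4 * s) * (1 + 2 * B - 3 * s) / 2 + 3 * (B - s^2)) * (B^2 * rv - s^2 * B * rv + s^2 * rb)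
      - s * B * eb * (1 + 2 * B - 3 * s)^2) * (1 - s) - B^2 * n * c * (1 + 2 * B - 3 * s)^2" (is "_ = ?E s") for s
    unfolding p_def by (simp add: q) (simp add: field_simps power2_eq_square)
  have all: "?E s = 0" for s
    unfolding p[symmetric] by (rule poly_zero_on_interval[OF B(1)]) (simp only: p eq)
  have c: "c = 0" using all[of 1] B n by simp
  have "(n * (1 + 2 * B) / 2 + 3 * B) * (B^2 * rv) = 0" using all[of 0] by (simp add: c)
  moreover have "n * (1 + 2 * B) / 2 + 3 * B > 0" using B n by (simp add: add_pos_pos)
  ultimately have rv: "rv = 0" using B by auto
  define s0 where "s0 = (1 + 2 * B) / 3"
  have s0: "1 + 2 * B - 3 * s0 = 0" "s0 > 0" "1 - s0 \<noteq> 0" using B by (simp_all add: s0_def field_simps)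
  have "B - s0^2 = - ((1 - 4 * B) * (1 - B)) / 9" by (simp add: s0_def field_simps power2_eq_square)
  moreover have "(1 - 4 * B) * (1 - B) > 0" using B by (intro mult_pos_pos) auto
  ultimately have w: "B - s0^2 \<noteq> 0" by linarith
  have "3 * (B - s0^2) * (s0^2 * rb) * (1 - s0) = 0" using all[of s0] unfolding s0(1) rv c by simp
  then show ?thesis using w s0 rv by simp
qed

text \<open>The zero of \<open>q\<close> supplies only one equation for \<open>rm\<close> and \<open>sg\<close>; the leading coefficient supplies the
  other. The more obvious point \<open>s = 1/2\<close>, where \<open>1 - 2 s = 0\<close>, is uninformative in dimension two.\<close>

lemma matsumoto_odd:
  fixes n B :: real
  assumes B: "0 < B" "B < 1/4" and n: "n > 1"
    and eq: "\<And>s. s^2 < B \<Longrightarrow> 2 * (1 + 2 * B - 3 * s) * (1 - 2 * s) * B * (rm + sg)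
      + (n * (1 - 4 * s) * (1 + 2 * B - 3 * s) / 2 + 3 * (B - s^2)) * (2 * s * rm * (1 - 2 * s) - 2 * B * sg)
      - ev * (1 + 2 * B - 3 * s)^2 * (1 - 2 * s) * B = 0"
  shows "rm = 0 \<and> sg = 0"
proof -
  define q where "q = [:1 + 2 * B, -3:]"
  define p where "p = [:2 * B * (rm + sg):] * q * [:1, -2:]
     + ([:n / 2, - 2 * n:] * q + [:3 * B, 0, -3:]) * [:- 2 * B * sg, 2 * rm, - 4 * rm:]
     - [:ev * B:] * q^2 * [:1, -2:]"
  have q: "poly q s = 1 + 2 * B - 3 * s" for s by (simp add: q_def)
  have p: "poly p s = 2 * (1 + 2 * B - 3 * s) * (1 - 2 * s) * B * (rm + sg)
      + (n * (1 - 4 * s) * (1 + 2 * B - 3 * s) / 2 + 3 * (B - s^2)) * (2 * s * rm * (1 - 2 * s) - 2 * B * sg)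
      - ev * (1 + 2 * B - 3 * s)^2 * (1 - 2 * s) * B" (is "_ = ?E s") for s
    unfolding p_def by (simp add: q) (simp add: field_simps power2_eq_square)
  have all: "?E s = 0" for s
    unfolding p[symmetric] by (rule poly_zero_on_interval[OF B(1)]) (simp only: p eq)
  \<comment> \<open>The fourth difference of a polynomial of degree 4 isolates its leading coefficient.\<close>
  have "poly p 2 - 4 * poly p 1 + 6 * poly p 0 - 4 * poly p (-1) + poly p (-2) = - 288 * (rm * (2 * n - 1))"
    unfolding p by (simp add: field_simps power2_eq_square)
  then have "rm * (2 * n - 1) = 0" unfolding p all by simp
  then have rm: "rm = 0" using n by simp
  define s0 where "s0 = (1 + 2 * B) / 3"
  have s0: "1 + 2 * B - 3 * s0 = 0" by (simp add: s0_def)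
  have "B - s0^2 = - ((1 - 4 * B) * (1 - B)) / 9" by (simp add: s0_def field_simps power2_eq_square)
  moreover have "(1 - 4 * B) * (1 - B) > 0" using B by (intro mult_pos_pos) auto
  ultimately have w: "B - s0^2 \<noteq> 0" by linarith
  have "3 * (B - s0^2) * (2 * B * sg) = 0" using all[of s0] unfolding s0(1) rm by simp
  then show ?thesis using w B rm by simp
qed

section \<open>The divergence of the spray\<close>

context ab_metric begin

lemma su_linear: "su x (y + t *\<^sub>R w) = su x y + t *\<^sub>R su x w" "su x (t *\<^sub>R y) = t *\<^sub>R su x y"
  by (simp_all add: su_def matrix_vector_right_distrib matrix_vector_mult_scaleR)

lemma s0_linear: "s0 x (y + t *\<^sub>R w) = s0 x y + t * s0 x w" "s0 x (t *\<^sub>R y) = t * s0 x y"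
  by (simp_all add: s0_def su_linear inner_add_right)

lemma homogeneous:
  assumes x: "x \<in> U" and t: "t > 0" and y: "y \<noteq> 0"
  shows "A x (t *\<^sub>R y) = t^2 * A x y" "al x (t *\<^sub>R y) = t * al x y" "be x (t *\<^sub>R y) = t * be x y"
    "F x (t *\<^sub>R y) = t * F x y" "PP x (t *\<^sub>R y) = t * PP x y" "pp x (t *\<^sub>R y) = t * pp x y"
    "mm x (t *\<^sub>R y) = t^2 * mm x y"
proof -
  show A: "A x (t *\<^sub>R y) = t^2 * A x y"
    by (simp add: A_def matrix_vector_mult_scaleR power2_eq_square)
  show al: "al x (t *\<^sub>R y) = t * al x y" using t by (simp add: al_def A real_sqrt_mult)
  show be: "be x (t *\<^sub>R y) = t * be x y" by (simp add: be_def)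
  show "F x (t *\<^sub>R y) = t * F x y" by (simp add: F_eq[OF x] al be ph_hom[OF t])
  have uv: "uu x (t *\<^sub>R y) = t * uu x y" "vv x (t *\<^sub>R y) = t * vv x y"
    by (simp_all add: uu_def vv_def al be algebra_simps)
  have q: "qq x (t *\<^sub>R y) = t^2 * qq x y"
    by (simp add: qq_def uv A be algebra_simps power2_eq_square)
  show P: "PP x (t *\<^sub>R y) = t * PP x y"
    using t nz[OF x y] by (simp add: PP_def A uv power2_eq_square)
  have X: "XX x (t *\<^sub>R y) = t^2 * XX x y"
    by (simp add: XX_def P s0_linear r00_def matrix_vector_mult_scaleR power2_eq_square algebra_simps)
  show "pp x (t *\<^sub>R y) = t * pp x y"
    using t nz[OF x y] by (simp add: pp_def al be X q field_simps power2_eq_square)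
  show "mm x (t *\<^sub>R y) = t^2 * mm x y"
    using t nz[OF x y] by (simp add: mm_def A X q field_simps power2_eq_square)
qed

lemma GG_homogeneous:
  assumes "x \<in> U" "t > 0" "y \<noteq> 0"
  shows "GG x (t *\<^sub>R y) = t^2 *\<^sub>R GG x y"
  by (simp add: GG_def homogeneous[OF assms] Gb_quadratic su_linear scaleR_right_distrib power2_eq_square mult_ac)

text \<open>The trace of a symmetric matrix times a skew one.\<close>

lemma trace_su: "x \<in> U \<Longrightarrow> (\<Sum>m\<in>UNIV. su x (axis m 1) $ m) = 0"
proof -
  assume x: "x \<in> U"
  define T where "T = (\<Sum>m\<in>UNIV. \<Sum>l\<in>UNIV. matrix_inv (a x) $ m $ l * sm x $ l $ m)"
  have sym: "matrix_inv (a x) $ m $ l = matrix_inv (a x) $ l $ m" for m l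
    using inv_inner[OF x, of "axis m 1" "axis l 1"]
    by (simp add: matrix_vector_mult_basis column_def inner_axis')
  have "T = (\<Sum>l\<in>UNIV. \<Sum>m\<in>UNIV. matrix_inv (a x) $ m $ l * sm x $ l $ m)"
    unfolding T_def by (rule sum.swap)
  also have "\<dots> = (\<Sum>l\<in>UNIV. \<Sum>m\<in>UNIV. - (matrix_inv (a x) $ l $ m * sm x $ m $ l))"
  proof (intro sum.cong refl)
    show "matrix_inv (a x) $ m $ l * sm x $ l $ m = - (matrix_inv (a x) $ l $ m * sm x $ m $ l)" for l m
      by (subst sym, subst sm_skew) simp
  qed
  also have "\<dots> = - T" by (simp add: T_def sum_negf)
  finally have "T = 0" by simp
  then show ?thesis
    by (simp add: T_def su_def matrix_vector_mult_def[of "matrix_inv (a x)"] matrix_vector_mult_basis column_def)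
qed

lemma Gb_div_linear:
  obtains g where "\<And>y. (\<Sum>m\<in>UNIV. Dy m (\<lambda>x y. Gb x y $ m) x y) = g \<bullet> y"
proof -
  have D: "Dy m (\<lambda>x y. Gb x y $ m) x y
      = (\<Sum>j\<in>UNIV. \<Sum>k\<in>UNIV. gam m j k x * (axis m 1 $ j * y $ k + y $ j * axis m 1 $ k))" for m y
    by (rule Dy_eqI) (auto simp: Gb_def algebra_simps intro!: derivative_eq_intros sum.cong)
  have "linear (\<lambda>y. \<Sum>m\<in>UNIV. Dy m (\<lambda>x y. Gb x y $ m) x y)"
    unfolding D by (rule linearI) (simp_all add: algebra_simps sum.distrib sum_distrib_left)
  from linear_eq_inner_axis[OF this] show ?thesis by (rule that)
qed

lemma PP_curve:
  assumes "x \<in> U" "y \<noteq> 0"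
  shows "((\<lambda>t. PP x (y + t *\<^sub>R w)) has_real_derivative
    kp * (dA x y 0 w * uu x y - A x y * (dA x y 0 w / (2 * al x y) - lam * dB x y 0 w)) / (uu x y)^2) (at 0)"
proof -
  have A: "((\<lambda>t. A x (y + t *\<^sub>R w)) has_real_derivative dA x y 0 w) (at 0)"
    using A_curve[OF assms, of 0 w] by simp
  have U: "((\<lambda>t. uu x (y + t *\<^sub>R w)) has_real_derivative dA x y 0 w / (2 * al x y) - lam * dB x y 0 w) (at 0)"
    unfolding uu_def using al_curve[OF assms, of 0 w] be_curve[OF assms, of 0 w]
    by (auto intro!: derivative_eq_intros)
  show ?thesis
    unfolding PP_def using DERIV_divide[OF DERIV_cmult[OF A, of kp] U] nz[OF assms]
    by (simp add: power2_eq_square right_diff_distrib mult.assoc)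
qed

lemma grad_PP_su:
  assumes "x \<in> U" "y \<noteq> 0"
  shows "grad_y PP x y \<bullet> su x y = 2 * A x y / (uu x y)^2 * s0 x y"
proof -
  have "dA x y 0 (su x y) = 0" "dB x y 0 (su x y) = s0 x y"
    using y_su[OF assms(1), of y] by (simp_all add: dA_y[OF assms(1)] dB_y s0_def)
  then have "grad_y PP x y \<bullet> su x y = kp * lam * A x y * s0 x y / (uu x y)^2"
    by (intro grad_y_eqI[OF openU smooth_PP assms]) (use PP_curve[OF assms, of "su x y"] in \<open>simp add: mult_ac\<close>)
  then show ?thesis by (simp add: kp_lam(1))
qed

text \<open>Euler's relation for a function that is homogeneous of degree one.\<close>

lemma grad_pp_y:
  assumes "x \<in> U" "y \<noteq> 0"
  shows "grad_y pp x y \<bullet> y = pp x y"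
proof -
  have "\<forall>\<^sub>F t in nhds (0::real). t \<in> {-1<..}"
    by (rule eventually_nhds_in_open) auto
  then have ev: "\<forall>\<^sub>F t in nhds 0. pp x (y + t *\<^sub>R y) = (1 + t) * pp x y"
  proof (rule eventually_mono)
    fix t :: real
    assume "t \<in> {-1<..}"
    then have "pp x ((1 + t) *\<^sub>R y) = (1 + t) * pp x y" by (intro homogeneous(6) assms) auto
    then show "pp x (y + t *\<^sub>R y) = (1 + t) * pp x y" by (simp add: scaleR_left_distrib)
  qed
  have "((\<lambda>t. (1 + t) * pp x y) has_real_derivative pp x y) (at 0)"
    by (auto intro!: derivative_eq_intros)
  then have "((\<lambda>t. pp x (y + t *\<^sub>R y)) has_real_derivative pp x y) (at 0)"
    unfolding DERIV_cong_ev[OF refl ev refl] .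
  then show ?thesis by (rule grad_y_eqI[OF openU smooth_pp assms])
qed

text \<open>The divergence of \<open>p y\<close> is \<open>(n + 1) p\<close> by Euler's relation, and that of \<open>P s\<^sup>i\<^sub>0\<close> only sees the dependence of
  \<open>P\<close> on \<open>\<beta>\<close>, because \<open>y\<^sub>i s\<^sup>i\<^sub>0 = 0\<close> and \<open>s\<^sup>i\<^sub>i = 0\<close>.\<close>

lemma div_GG:
  assumes "x \<in> U" "y \<noteq> 0"
  shows "(\<Sum>m\<in>UNIV. Dy m (\<lambda>x y. GG x y $ m) x y) = (\<Sum>m\<in>UNIV. Dy m (\<lambda>x y. Gb x y $ m) x y)
    + 2 * A x y / (uu x y)^2 * s0 x y + (real CARD('n) + 1) * pp x y + grad_y mm x y \<bullet> bu x"
proof -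
  have "Dy m (\<lambda>x y. GG x y $ m) x y = Dy m (\<lambda>x y. Gb x y $ m) x y
     + (Dy m PP x y * su x y $ m + PP x y * su x (axis m 1) $ m) + (Dy m pp x y * y $ m + pp x y)
     + Dy m mm x y * bu x $ m" (is "_ = ?D") for m
  proof (rule Dy_eqI)
    have 1: "((\<lambda>t. su x (y + t *\<^sub>R axis m 1) $ m) has_real_derivative su x (axis m 1) $ m) (at 0)"
      by (auto simp: su_linear intro!: derivative_eq_intros)
    have 2: "((\<lambda>t. (y + t *\<^sub>R axis m 1) $ m) has_real_derivative 1) (at 0)"
      by (auto intro!: derivative_eq_intros)
    note D = Dy_has_derivative[OF openU smooth_Gb[of m] assms] Dy_has_derivative[OF openU smooth_PP assms]
      Dy_has_derivative[OF openU smooth_pp assms] Dy_has_derivative[OF openU smooth_mm assms]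
    have "((\<lambda>t. Gb x (y + t *\<^sub>R axis m 1) $ m + PP x (y + t *\<^sub>R axis m 1) * su x (y + t *\<^sub>R axis m 1) $ m
        + pp x (y + t *\<^sub>R axis m 1) * (y + t *\<^sub>R axis m 1) $ m + mm x (y + t *\<^sub>R axis m 1) * bu x $ m)
      has_real_derivative ?D) (at 0)"
      by (rule derivative_eq_intros D 1 2 refl)+ simp
    then show "((\<lambda>t. GG x (y + t *\<^sub>R axis m 1) $ m) has_real_derivative ?D) (at 0)"
      by (simp add: GG_def)
  qed
  then have "(\<Sum>m\<in>UNIV. Dy m (\<lambda>x y. GG x y $ m) x y) = (\<Sum>m\<in>UNIV. Dy m (\<lambda>x y. Gb x y $ m) x y)
     + (grad_y PP x y \<bullet> su x y + PP x y * (\<Sum>m\<in>UNIV. su x (axis m 1) $ m))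
     + (grad_y pp x y \<bullet> y + real CARD('n) * pp x y) + grad_y mm x y \<bullet> bu x"
    by (simp add: sum.distrib sum_distrib_left grad_y_def inner_vec_def)
  then show ?thesis
    by (simp add: grad_PP_su[OF assms] grad_pp_y[OF assms] trace_su[OF assms(1)] algebra_simps)
qed

text \<open>With \<open>n\<close> the dimension plus one, this is \<open>- q\<^sup>2 \<Phi> / (2 \<Delta>\<^sup>2)\<close> in the notation \<open>\<Phi>, \<Delta>\<close> that is
  customary in the formula for the S-curvature of an \<open>(\<alpha>, \<beta>)\<close>-metric.\<close>

definition NN :: "real \<Rightarrow> real \<Rightarrow> real \<Rightarrow> real" where
  "NN n B s = (let u = 1 - lam * s; v = 1 + (kp - lam) * s; q = u * v + 2 * (B - s^2) in
     n * kp * (1 - 2 * lam * s) / 2 * q + 2 * s * q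
       - ((s - lam * B) * v + u * (s + (kp - lam) * B)))"

text \<open>On the unit sphere of \<open>\<alpha>\<close> the divergence becomes a rational function of \<open>s = \<beta>\<close>; the terms in \<open>s\<^sub>0\<close>
  combine because \<open>q\<close> is \<open>u\<^sup>2\<close> times one plus the derivative of \<open>P\<close> along \<open>b\<close>.\<close>

lemma div_normalised:
  assumes "x \<in> U" "y \<noteq> 0" "al x y = 1"
  shows "2 * A x y / (uu x y)^2 * s0 x y + (real CARD('n) + 1) * pp x y + grad_y mm x y \<bullet> bu x
    = 2 / qq x y * (bu x \<bullet> (rm x *v y) + s0 x y) + NN (real CARD('n) + 1) (bb x) (be x y) / (qq x y)^2 * XX x y"
proof -
  note P = pos[OF assms(1,2)]
  define s where "s = be x y"
  define B where "B = bb x"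
  define u where "u = 1 - lam * s"
  define v where "v = 1 + (kp - lam) * s"
  define q where "q = u * v + 2 * (B - s^2)"
  define X where "X = XX x y"
  define S where "S = s0 x y"
  define r where "r = bu x \<bullet> (rm x *v y)"
  define P' where "P' = kp * (2 * s * u - (s - lam * B)) / u^2"
  define q' where "q' = (s - lam * B) * v + u * (s + (kp - lam) * B)"
  have A1: "A x y = 1" using al_sq[OF assms(1,2)] assms(3) by simp
  have e: "be x y = s" "bb x = B" "uu x y = u" "vv x y = v" "qq x y = q"
    by (simp_all add: s_def B_def u_def v_def q_def uu_def vv_def qq_def assms(3) A1)
  have ne: "u > 0" "v > 0" "q > 0" using P by (simp_all add: e)
  have dA: "dA x y 0 (bu x) = 2 * s" and dB: "dB x y 0 (bu x) = B"
    by (simp_all add: dA_y[OF assms(1)] dB_y inner_commute[of "a x *v y"] be_inner[OF assms(1), symmetric] e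
        bb_def[symmetric])
  have DA: "((\<lambda>t. A x (y + t *\<^sub>R bu x)) has_real_derivative 2 * s) (at 0)"
    using A_curve[OF assms(1,2), of 0 "bu x"] dA by simp
  have Dal: "((\<lambda>t. al x (y + t *\<^sub>R bu x)) has_real_derivative s) (at 0)"
    using al_curve[OF assms(1,2), of 0 "bu x"] dA assms(3) by simp
  have Dbe: "((\<lambda>t. be x (y + t *\<^sub>R bu x)) has_real_derivative B) (at 0)"
    using be_curve[OF assms(1,2), of 0 "bu x"] dB by simp
  have DP: "((\<lambda>t. PP x (y + t *\<^sub>R bu x)) has_real_derivative P') (at 0)"
    using PP_curve[OF assms(1,2), of "bu x"] dA dB by (simp add: A1 e assms(3) P'_def)
  have DS: "s0 x (y + t *\<^sub>R bu x) = S" for t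
    by (simp add: s0_linear s0_at_bu[OF assms(1)] S_def)
  have Dr: "((\<lambda>t. r00 x (y + t *\<^sub>R bu x)) has_real_derivative 2 * r) (at 0)"
  proof -
    have "r00 x (y + t *\<^sub>R bu x) = r00 x y + 2 * t * r + t^2 * r00 x (bu x)" for t
      using rm_inner[of y x "bu x"]
      by (simp add: r00_def r_def matrix_vector_right_distrib matrix_vector_mult_scaleR inner_add_left inner_add_right
          power2_eq_square algebra_simps)
    then show ?thesis by (auto intro!: derivative_eq_intros)
  qed
  have DX: "((\<lambda>t. XX x (y + t *\<^sub>R bu x)) has_real_derivative 2 * r - 2 * P' * S) (at 0)"
    unfolding XX_def DS by (rule derivative_eq_intros Dr DP refl)+ simp
  have Dq: "((\<lambda>t. qq x (y + t *\<^sub>R bu x)) has_real_derivative q') (at 0)"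
    unfolding qq_def uu_def vv_def
    by (rule derivative_eq_intros DA Dal Dbe refl)+
      (simp add: assms(3) A1 e, simp add: q'_def u_def v_def power2_eq_square algebra_simps)
  have "((\<lambda>t. mm x (y + t *\<^sub>R bu x)) has_real_derivative
      ((2 * s * X + (2 * r - 2 * P' * S)) * q - X * q') / q^2) (at 0)"
    unfolding mm_def
    using DERIV_divide[OF DERIV_mult[OF DA DX] Dq] ne by (simp add: A1 e X_def power2_eq_square)
  then have mm: "grad_y mm x y \<bullet> bu x = ((2 * s * X + (2 * r - 2 * P' * S)) * q - X * q') / q^2"
    by (rule grad_y_eqI[OF openU smooth_mm assms(1,2)])
  have "u^2 + kp * (2 * s * u - (s - lam * B)) = q + (kp * lam - 2) * (B - s^2)"
    by (simp add: q_def u_def v_def power2_eq_square algebra_simps)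
  then have key: "u^2 + kp * (2 * s * u - (s - lam * B)) = q" by (simp add: kp_lam(1))
  have "P' = q / u^2 - 1" using ne unfolding key[symmetric] by (simp add: P'_def field_simps)
  moreover have "2 / u^2 * S - 2 * (q / u^2 - 1) * S / q = 2 / q * S"
    using ne by (simp add: field_simps)
  ultimately have 1: "2 / u^2 * S - 2 * P' * S / q = 2 / q * S" by simp
  have N: "NN (real CARD('n) + 1) B s = (real CARD('n) + 1) * kp * (1 - 2 * lam * s) / 2 * q + 2 * s * q - q'"
    by (simp add: NN_def Let_def u_def v_def q_def q'_def)
  have "2 * A x y / (uu x y)^2 * s0 x y + (real CARD('n) + 1) * pp x y + grad_y mm x y \<bullet> bu x
    = 2 / u^2 * S + (real CARD('n) + 1) * (kp * (1 - 2 * lam * s) * X / (2 * q))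
      + ((2 * s * X + (2 * r - 2 * P' * S)) * q - X * q') / q^2"
    by (simp add: mm A1 e pp_def assms(3) S_def X_def)
  also have "\<dots> = (2 / u^2 * S - 2 * P' * S / q) + 2 / q * r + NN (real CARD('n) + 1) B s / q^2 * X"
    unfolding N using ne by (simp add: divide_simps) (simp add: algebra_simps power2_eq_square)
  also have "\<dots> = 2 / q * (r + S) + NN (real CARD('n) + 1) B s / q^2 * X"
    unfolding 1 by (simp add: algebra_simps add_divide_distrib)
  finally show ?thesis by (simp add: e r_def S_def X_def)
qed

end

section \<open>Isotropic mean Berwald curvature\<close>

context ab_metric begin

text \<open>Since \<open>y\<^sub>j = F F\<^sub>j\<close> by Euler's relation and \<open>g\<^sub>j\<^sub>k = F\<^sub>j F\<^sub>k + F F\<^sub>j\<^sub>k\<close>, where subscripts of \<open>F\<close>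
  are fibre derivatives, the angular metric is \<open>F F\<^sub>j\<^sub>k\<close>.\<close>

lemma angular_metric_eq:
  assumes "x \<in> U" "y \<noteq> 0"
  shows "inverse (F x y) * angular_metric F j k x y = Dy j (Dy k F) x y"
proof -
  have y_lower: "(\<Sum>k\<in>UNIV. gg x y $ j $ k * y $ k) = F x y * Dy j F x y" for j
  proof -
    have "(\<Sum>k\<in>UNIV. gg x y $ j $ k * y $ k) = (gg x y *v y) $ j"
      by (simp add: matrix_vector_mult_def)
    also have "\<dots> = F x y * Dy j F x y"
      by (simp add: gg_y[OF assms] Dy_F[OF assms] fA_def fB_def L_def power2_eq_square algebra_simps)
    finally show ?thesis .
  qed
  have DL: "Dy k L x y = 2 * (Dy k F x y * F x y)" if "y \<noteq> 0" for y k
    using Dy_mult[OF openU assms(1) that F_smooth F_smooth, of k]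
    by (simp add: L_def[abs_def] power2_eq_square)
  have "2 * gg x y $ k $ j = Dy j (Dy k L) x y" by (rule Dy_Dy_L[OF assms, symmetric])
  also have "\<dots> = Dy j (\<lambda>x y. 2 * (Dy k F x y * F x y)) x y"
    by (rule Dy_cong[OF _ assms(2)]) (rule DL)
  also have "\<dots> = 2 * (Dy j (Dy k F) x y * F x y + Dy j F x y * Dy k F x y)"
    by (simp add: Dy_cmult[OF openU assms] Dy_mult[OF openU assms] slit_mult slit_Dy openU F_smooth)
  finally have g: "gg x y $ j $ k = Dy j (Dy k F) x y * F x y + Dy j F x y * Dy k F x y"
    using gg_sym[OF assms(1), of y j k] by simp
  have "angular_metric F j k x y = gg x y $ j $ k - (F x y * Dy j F x y) * (F x y * Dy k F x y) / (F x y)^2"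
    unfolding angular_metric_def Let_def fundamental_tensor_eq[OF assms] y_lower ..
  also have "\<dots> = Dy j (Dy k F) x y * F x y"
    using nz(4)[OF assms] by (simp add: g power2_eq_square)
  finally show ?thesis using nz(4)[OF assms] by simp
qed

lemma smooth_spray: "smooth_slit U (spray_coeff F i)"
  by (rule slit_cong[OF openU _ smooth_GG[of i]]) (simp add: spray_coeff_eq)

text \<open>Both sides of the isotropy condition are fibre Hessians, so the condition says that the difference of the
  two functions has none.\<close>

lemma isotropic_divergence_linear:
  assumes x: "x \<in> U" and n: "CARD('n) \<ge> 2"
    and iso: "\<And>y j k. y \<noteq> 0 \<Longrightarrow> mean_berwald_curv F j k x y
      = (real CARD('n) + 1) / 2 * c * inverse (F x y) * angular_metric F j k x y"
  shows "\<exists>e. \<forall>y. y \<noteq> 0 \<longrightarrow>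
    (\<Sum>m\<in>UNIV. Dy m (spray_coeff F m) x y) - (real CARD('n) + 1) * c * F x y = e \<bullet> y"
proof -
  define C where "C = (real CARD('n) + 1) * c"
  have s: "smooth_slit U (\<lambda>x y. \<Sum>m\<in>UNIV. Dy m (spray_coeff F m) x y)"
    by (intro slit_sum openU slit_Dy smooth_spray)
  have sF: "smooth_slit U (\<lambda>x y. C * F x y)" by (intro slit_intros openU F_smooth)
  have dk: "Dy k (\<lambda>x y. \<Sum>m\<in>UNIV. Dy m (spray_coeff F m) x y) x y
      = (\<Sum>m\<in>UNIV. Dy k (Dy m (spray_coeff F m)) x y)" if "y \<noteq> 0" for k y
    by (intro Dy_sum[OF openU x that] slit_Dy openU smooth_spray)
  have djk: "Dy j (Dy k (\<lambda>x y. \<Sum>m\<in>UNIV. Dy m (spray_coeff F m) x y)) x y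
      = (\<Sum>m\<in>UNIV. Dy j (Dy k (Dy m (spray_coeff F m))) x y)" if "y \<noteq> 0" for j k y
  proof -
    have "Dy j (Dy k (\<lambda>x y. \<Sum>m\<in>UNIV. Dy m (spray_coeff F m) x y)) x y
      = Dy j (\<lambda>x y. \<Sum>m\<in>UNIV. Dy k (Dy m (spray_coeff F m)) x y) x y"
      by (rule Dy_cong[OF _ that]) (rule dk)
    also have "\<dots> = (\<Sum>m\<in>UNIV. Dy j (Dy k (Dy m (spray_coeff F m))) x y)"
      by (intro Dy_sum[OF openU x that] slit_Dy openU smooth_spray)
    finally show ?thesis .
  qed
  have H: "Dy j (Dy k (\<lambda>x y. (\<Sum>m\<in>UNIV. Dy m (spray_coeff F m) x y) - C * F x y)) x y = 0" if y: "y \<noteq> 0" for j k y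
  proof -
    have "Dy j (Dy k (\<lambda>x y. (\<Sum>m\<in>UNIV. Dy m (spray_coeff F m) x y) - C * F x y)) x y
      = Dy j (\<lambda>x y. Dy k (\<lambda>x y. \<Sum>m\<in>UNIV. Dy m (spray_coeff F m) x y) x y - C * Dy k F x y) x y"
      by (rule Dy_cong[OF _ y]) (simp add: Dy_diff[OF openU x _ s sF] Dy_cmult[OF openU x _ F_smooth])
    also have "\<dots> = (\<Sum>m\<in>UNIV. Dy j (Dy k (Dy m (spray_coeff F m))) x y) - C * Dy j (Dy k F) x y"
      by (simp add: Dy_diff[OF openU x y slit_Dy[OF openU s] slit_mult[OF openU slit_const[OF openU] slit_Dy[OF openU F_smooth]]]
          Dy_cmult[OF openU x y slit_Dy[OF openU F_smooth]] djk[OF y])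
    also have "(\<Sum>m\<in>UNIV. Dy j (Dy k (Dy m (spray_coeff F m))) x y) = 2 * mean_berwald_curv F j k x y"
      by (simp add: mean_berwald_curv_def berwald_curv_def)
    also have "\<dots> = C * (inverse (F x y) * angular_metric F j k x y)"
      by (simp add: iso[OF y] C_def)
    also have "\<dots> = C * Dy j (Dy k F) x y" by (simp only: angular_metric_eq[OF x y])
    finally show ?thesis by simp
  qed
  \<comment> \<open>the spray has degree two, its divergence degree one\<close>
  have h: "(\<Sum>m\<in>UNIV. Dy m (spray_coeff F m) x (2 *\<^sub>R y)) - C * F x (2 *\<^sub>R y)
      = 2 * ((\<Sum>m\<in>UNIV. Dy m (spray_coeff F m) x y) - C * F x y)" if y: "y \<noteq> 0" for y
  proof -
    have "Dy m (spray_coeff F m) x (2 *\<^sub>R y) = 2 * Dy m (spray_coeff F m) x y" for m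
    proof -
      have "((\<lambda>t. spray_coeff F m x (y + t *\<^sub>R axis m 1)) has_real_derivative Dy m (spray_coeff F m) x y) (at (0 / 2))"
        using Dy_has_derivative[OF openU smooth_spray x y] by simp
      then have "((\<lambda>t. spray_coeff F m x (y + (t / 2) *\<^sub>R axis m 1)) has_real_derivative
          Dy m (spray_coeff F m) x y * (1 / 2)) (at 0)"
        by (rule DERIV_chain2) (auto intro!: derivative_eq_intros)
      then have D: "((\<lambda>t. 4 * spray_coeff F m x (y + (t / 2) *\<^sub>R axis m 1)) has_real_derivative
          2 * Dy m (spray_coeff F m) x y) (at 0)"
        by (auto intro!: derivative_eq_intros)
      have ev: "\<forall>\<^sub>F t in nhds 0. spray_coeff F m x (2 *\<^sub>R y + t *\<^sub>R axis m 1)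
          = 4 * spray_coeff F m x (y + (t / 2) *\<^sub>R axis m 1)"
      proof (rule eventually_mono[OF eventually_line[of "- {0}" y "axis m (1/2)"]])
        fix t :: real
        assume "y + t *\<^sub>R axis m (1 / 2) \<in> - {0}"
        moreover have "t *\<^sub>R axis m (1 / 2) = (t / 2) *\<^sub>R (axis m 1 :: real ^ 'n)"
          by (simp add: vec_eq_iff axis_def)
        ultimately have ne: "y + (t / 2) *\<^sub>R axis m 1 \<noteq> 0" by simp
        have "2 *\<^sub>R y + t *\<^sub>R axis m 1 = 2 *\<^sub>R (y + (t / 2) *\<^sub>R axis m 1)"
          by (simp add: scaleR_right_distrib)
        then show "spray_coeff F m x (2 *\<^sub>R y + t *\<^sub>R axis m 1)
          = 4 * spray_coeff F m x (y + (t / 2) *\<^sub>R axis m 1)"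
          using GG_homogeneous[OF x _ ne, of 2] ne by (simp add: spray_coeff_eq[OF x])
      qed (use y in auto)
      show ?thesis by (rule Dy_eqI) (use D DERIV_cong_ev[OF refl ev refl] in blast)
    qed
    then show ?thesis
      by (simp add: homogeneous(4)[OF x _ y] sum_distrib_left[symmetric] algebra_simps)
  qed
  show ?thesis
    using hessian_zero_linear[where f="\<lambda>x y. (\<Sum>m\<in>UNIV. Dy m (spray_coeff F m) x y) - C * F x y",
        OF openU slit_diff[OF openU s sF] x n H h]
    unfolding C_def .
qed

text \<open>The test vectors are \<open>y = (s/B) b \<plusminus> w v\<close> with \<open>w\<^sup>2 = 1 - s\<^sup>2/B\<close>, for which \<open>\<alpha> = 1\<close> and \<open>\<beta> = s\<close>. Adding and
  subtracting the equations for the two signs separates the components along \<open>b\<close> from those along \<open>v\<close>.\<close>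

lemma even_odd_parts:
  assumes x: "x \<in> U" and n: "CARD('n) \<ge> 2" and b0: "b x \<noteq> 0"
    and iso: "\<And>y j k. y \<noteq> 0 \<Longrightarrow> mean_berwald_curv F j k x y
      = (real CARD('n) + 1) / 2 * c * inverse (F x y) * angular_metric F j k x y"
    and v: "b x \<bullet> v = 0" "A x v = 1"
  obtains eb ev where
    "\<And>s. s^2 < bb x \<Longrightarrow> (let B = bb x; u = 1 - lam * s; q = u * (1 + (kp - lam) * s) + 2 * (B - s^2);
        N = NN (real CARD('n) + 1) B s in
      2 / q * (s / B * r00 x (bu x)) + N / q^2 * ((1 - s^2 / B) * r00 x v + s^2 / B^2 * r00 x (bu x))
        - (real CARD('n) + 1) * c * ph 1 s = s / B * eb \<and>
      2 / q * (v \<bullet> (rm x *v bu x) + s0 x v) + N / q^2 * (2 * (s / B) * (v \<bullet> (rm x *v bu x)) - 2 * (kp / u) * s0 x v) = ev)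
      \<and> 1 - lam * s > 0 \<and> 1 + (kp - lam) * s > 0 \<and> (1 - lam * s) * (1 + (kp - lam) * s) + 2 * (bb x - s^2) > 0"
proof -
  obtain e where e: "\<And>y. y \<noteq> 0 \<Longrightarrow>
      (\<Sum>m\<in>UNIV. Dy m (spray_coeff F m) x y) - (real CARD('n) + 1) * c * F x y = e \<bullet> y"
    using isotropic_divergence_linear[OF x n iso] by blast
  obtain g where g: "\<And>y. (\<Sum>m\<in>UNIV. Dy m (\<lambda>x y. Gb x y $ m) x y) = g \<bullet> y"
    using Gb_div_linear[of x] by blast
  define B where "B = bb x"
  have B: "B > 0" using bb_pos[OF x b0] by (simp add: B_def)
  define rb where "rb = r00 x (bu x)"
  define rv where "rv = r00 x v"
  define rc where "rc = v \<bullet> (rm x *v bu x)"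
  define sg where "sg = s0 x v"
  define C where "C = (real CARD('n) + 1) * c"
  \<comment> \<open>the linear form \<open>e\<close> less the divergence \<open>g\<close> of the spray of \<open>\<alpha>\<close>\<close>
  define k where "k = e - g"
  have main: "(let u = 1 - lam * s; q = u * (1 + (kp - lam) * s) + 2 * (B - s^2); N = NN (real CARD('n) + 1) B s in
      2 / q * (s / B * rb) + N / q^2 * ((1 - s^2 / B) * rv + s^2 / B^2 * rb) - C * ph 1 s = s / B * (k \<bullet> bu x) \<and>
      2 / q * (rc + sg) + N / q^2 * (2 * (s / B) * rc - 2 * (kp / u) * sg) = k \<bullet> v)
      \<and> 1 - lam * s > 0 \<and> 1 + (kp - lam) * s > 0 \<and> (1 - lam * s) * (1 + (kp - lam) * s) + 2 * (B - s^2) > 0"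
    if s: "s^2 < B" for s
  proof -
    define w where "w = sqrt (1 - s^2 / B)"
    have w: "w > 0" "w^2 = 1 - s^2 / B" using s B by (simp_all add: w_def)
    define u where "u = 1 - lam * s"
    define q where "q = u * (1 + (kp - lam) * s) + 2 * (B - s^2)"
    define N where "N = NN (real CARD('n) + 1) B s"
    have bv: "bu x \<bullet> (a x *v v) = 0" using be_inner[OF x, of v] v(1) by (simp add: be_def)
    define E where "E = 2 / q * (s / B * rb) + N / q^2 * ((1 - s^2 / B) * rv + s^2 / B^2 * rb)"
    define od where "od = 2 / q * (rc + sg) + N / q^2 * (2 * (s / B) * rc - 2 * (kp / u) * sg)"
    have eq: "E + z * od - C * ph 1 s
        = s / B * (k \<bullet> bu x) + z * (k \<bullet> v) \<and> u > 0 \<and> 1 + (kp - lam) * s > 0 \<and> q > 0"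
      if z: "z^2 = 1 - s^2 / B" for z
    proof -
      define y where "y = (s / B) *\<^sub>R bu x + z *\<^sub>R v"
      have "A x y = (s / B)^2 * B + z^2"
        unfolding y_def A_add[OF x] by (simp add: v bv A_bu[OF x] B_def[symmetric])
      also have "\<dots> = 1" unfolding z using B by (simp add: power2_eq_square field_simps)
      finally have A1: "A x y = 1" .
      then have y0: "y \<noteq> 0" by (auto simp: A_def)
      have al1: "al x y = 1" by (simp add: al_def A1)
      have be: "be x y = s" using B by (simp add: y_def be_def inner_add_right v bb_def[symmetric] B_def[symmetric])
      have uq: "uu x y = u" "vv x y = 1 + (kp - lam) * s" "qq x y = q" "F x y = ph 1 s" "PP x y = kp / u"
        by (simp_all add: uu_def vv_def qq_def F_eq[OF x] PP_def al1 be A1 u_def q_def B_def)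
      have r: "bu x \<bullet> (rm x *v y) = s / B * rb + z * rc"
        using rm_inner[of "bu x" x v]
        by (simp add: y_def matrix_vector_right_distrib matrix_vector_mult_scaleR inner_add_right rb_def r00_def rc_def)
      have r0: "r00 x y = z^2 * rv + 2 * z * (s / B) * rc + s^2 / B^2 * rb"
        using rm_inner[of "bu x" x v]
        by (simp add: y_def r00_def matrix_vector_right_distrib matrix_vector_mult_scaleR inner_add_right inner_add_left
            rb_def rc_def rv_def power2_eq_square) (simp add: algebra_simps add_divide_distrib)
      have S: "s0 x y = z * sg"
        by (simp add: y_def s0_linear s0_at_bu[OF x] sg_def)
      have "(\<Sum>m\<in>UNIV. Dy m (spray_coeff F m) x y) = (\<Sum>m\<in>UNIV. Dy m (\<lambda>x y. GG x y $ m) x y)"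
        by (rule sum.cong[OF refl], rule Dy_cong[OF _ y0]) (rule spray_coeff_eq[OF x])
      also have "\<dots> = g \<bullet> y + (2 / q * ((s / B * rb + z * rc) + z * sg)
        + N / q^2 * ((z^2 * rv + 2 * z * (s / B) * rc + s^2 / B^2 * rb) - 2 * (kp / u) * (z * sg)))"
        using div_normalised[OF x y0 al1] unfolding div_GG[OF x y0] g
        by (simp add: r r0 S XX_def uq be N_def B_def)
      finally have "g \<bullet> y + (2 / q * ((s / B * rb + z * rc) + z * sg)
        + N / q^2 * ((z^2 * rv + 2 * z * (s / B) * rc + s^2 / B^2 * rb) - 2 * (kp / u) * (z * sg))) - C * ph 1 s = e \<bullet> y"
        using e[OF y0] by (simp add: uq C_def)
      moreover have "e \<bullet> y - g \<bullet> y = s / B * (k \<bullet> bu x) + z * (k \<bullet> v)"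
        by (simp add: y_def k_def inner_add_right inner_diff_left algebra_simps)
      moreover have "2 / q * ((s / B * rb + z * rc) + z * sg)
        + N / q^2 * ((z^2 * rv + 2 * z * (s / B) * rc + s^2 / B^2 * rb) - 2 * (kp / u) * (z * sg)) = E + z * od"
        unfolding z E_def od_def by (simp add: algebra_simps add_divide_distrib)
      ultimately show ?thesis using pos[OF x y0] unfolding uq by linarith
    qed
    note p = eq[OF w(2)] and m = eq[of "- w", unfolded power2_minus, OF w(2)]
    have "w * od = w * (k \<bullet> v)" and E: "E - C * ph 1 s = s / B * (k \<bullet> bu x)"
      using conjunct1[OF p] conjunct1[OF m] by linarith+
    then have O: "od = k \<bullet> v" using w(1) by simp
    show ?thesis using p E O by (simp add: Let_def u_def q_def N_def E_def od_def)
  qed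
  show ?thesis
    by (rule that[of "k \<bullet> bu x" "k \<bullet> v"]) (use main in \<open>simp add: B_def rb_def rv_def rc_def sg_def C_def Let_def\<close>)
qed

end

text \<open>Multiplication by \<open>q\<^sup>2 B\<^sup>2\<close>, and below by \<open>q\<^sup>2 u B\<close>, brings the even and the odd part into the form of the
  polynomial identities.\<close>

lemma cleared_even:
  fixes q B s :: real
  assumes "q > 0" "B > 0"
    "2 / q * (s / B * rb) + N / q^2 * ((1 - s^2 / B) * rv + s^2 / B^2 * rb) - C = s / B * eb"
  shows "2 * s * B * rb * q + N * (B^2 * rv - s^2 * B * rv + s^2 * rb) - B^2 * C * q^2 - s * B * eb * q^2 = 0"
proof -
  have "2 * s * B * rb * q + N * (B^2 * rv - s^2 * B * rv + s^2 * rb) - B^2 * C * q^2 - s * B * eb * q^2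
    = B^2 * q^2 * (2 / q * (s / B * rb) + N / q^2 * ((1 - s^2 / B) * rv + s^2 / B^2 * rb) - C - s / B * eb)"
    using assms(1,2) by (simp add: field_simps power2_eq_square)
  then show ?thesis unfolding assms(3) by simp
qed

lemma cleared_odd:
  fixes q B s u :: real
  assumes "q > 0" "B > 0" "u > 0"
    "2 / q * (rc + sg) + N / q^2 * (2 * (s / B) * rc - 2 * (k / u) * sg) = ev"
  shows "2 * q * u * B * (rc + sg) + N * (2 * s * rc * u - 2 * k * B * sg) - ev * q^2 * u * B = 0"
proof -
  have "2 * q * u * B * (rc + sg) + N * (2 * s * rc * u - 2 * k * B * sg) - ev * q^2 * u * B
    = q^2 * u * B * (2 / q * (rc + sg) + N / q^2 * (2 * (s / B) * rc - 2 * (k / u) * sg) - ev)"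
    using assms(1-3) by (simp add: field_simps power2_eq_square)
  then show ?thesis unfolding assms(4) by simp
qed

context ab_metric begin

text \<open>Only here do the two metrics part: the explicit \<open>\<phi>\<close> turns the even and the odd part into the polynomial
  identities of one or the other.\<close>

lemma isotropic_unit:
  assumes x: "x \<in> U" and n: "CARD('n) \<ge> 2" and b0: "b x \<noteq> 0"
    and iso: "\<And>y j k. y \<noteq> 0 \<Longrightarrow> mean_berwald_curv F j k x y
      = (real CARD('n) + 1) / 2 * c * inverse (F x y) * angular_metric F j k x y"
    and v: "b x \<bullet> v = 0" "A x v = 1"
    and form: "kp = 2 \<and> lam = 1 \<and> (\<forall>s. ph 1 s = (1 + s)^2) \<or> kp = 1 \<and> lam = 2 \<and> (\<forall>s. ph 1 s = 1 / (1 - s))"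
  shows "r00 x v = 0 \<and> r00 x (bu x) = 0 \<and> v \<bullet> (rm x *v bu x) = 0 \<and> s0 x v = 0"
proof -
  define B where "B = bb x"
  define n1 where "n1 = real CARD('n) + 1"
  define rb where "rb = r00 x (bu x)"
  define rv where "rv = r00 x v"
  define rc where "rc = v \<bullet> (rm x *v bu x)"
  define sg where "sg = s0 x v"
  have B: "B > 0" using bb_pos[OF x b0] by (simp add: B_def)
  have n1: "n1 > 1" using n by (simp add: n1_def)
  obtain eb ev where E: "\<And>s. s^2 < B \<Longrightarrow> (let u = 1 - lam * s; q = u * (1 + (kp - lam) * s) + 2 * (B - s^2);
        N = NN n1 B s in
      2 / q * (s / B * rb) + N / q^2 * ((1 - s^2 / B) * rv + s^2 / B^2 * rb) - n1 * c * ph 1 s = s / B * eb \<and>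
      2 / q * (rc + sg) + N / q^2 * (2 * (s / B) * rc - 2 * (kp / u) * sg) = ev)
      \<and> 1 - lam * s > 0 \<and> 1 + (kp - lam) * s > 0 \<and> (1 - lam * s) * (1 + (kp - lam) * s) + 2 * (B - s^2) > 0"
    using even_odd_parts[OF x n b0 iso v] unfolding B_def n1_def rb_def rv_def rc_def sg_def Let_def by metis
  have clear: "2 * s * B * rb * q + NN n1 B s * (B^2 * rv - s^2 * B * rv + s^2 * rb)
        - B^2 * (n1 * c * ph 1 s) * q^2 - s * B * eb * q^2 = 0"
      "2 * q * (1 - lam * s) * B * (rc + sg) + NN n1 B s * (2 * s * rc * (1 - lam * s) - 2 * kp * B * sg)
        - ev * q^2 * (1 - lam * s) * B = 0"
      "1 + (kp - lam) * s > 0"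
    if "s^2 < B" "q = (1 - lam * s) * (1 + (kp - lam) * s) + 2 * (B - s^2)" for s q
  proof -
    note e = E[OF that(1), unfolded Let_def, folded that(2)]
    have p: "q > 0" "1 - lam * s > 0" using e by blast+
    show "2 * s * B * rb * q + NN n1 B s * (B^2 * rv - s^2 * B * rv + s^2 * rb)
        - B^2 * (n1 * c * ph 1 s) * q^2 - s * B * eb * q^2 = 0"
      by (rule cleared_even[OF p(1) B]) (use e in blast)
    show "2 * q * (1 - lam * s) * B * (rc + sg) + NN n1 B s * (2 * s * rc * (1 - lam * s) - 2 * kp * B * sg)
        - ev * q^2 * (1 - lam * s) * B = 0"
      by (rule cleared_odd[OF p(1) B p(2)]) (use e in blast)
    show "1 + (kp - lam) * s > 0" using e by blast
  qed
  have "rv = 0 \<and> rb = 0 \<and> rc = 0 \<and> sg = 0"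
    using form
  proof (elim disjE conjE)
    assume k: "kp = 2" "lam = 1" and ph: "\<forall>s. ph 1 s = (1 + s)^2"
    have B1: "B < 1" using small[OF x] by (simp add: k B_def)
    have q: "(1 - lam * s) * (1 + (kp - lam) * s) + 2 * (B - s^2) = 1 + 2 * B - 3 * s^2" for s
      by (simp add: k algebra_simps power2_eq_square)
    have N: "NN n1 B s = n1 * (1 - 2 * s) * (1 + 2 * B - 3 * s^2) + 6 * s * (B - s^2)" for s
      unfolding NN_def Let_def unfolding k by (simp add: field_simps power2_eq_square)
    have "rv = 0 \<and> rb = 0"
    proof (rule square_even[OF B B1, of n1 rb rv c eb])
      show "2 * s * B * rb * (1 + 2 * B - 3 * s^2)
        + (n1 * (1 - 2 * s) * (1 + 2 * B - 3 * s^2) + 6 * s * (B - s^2)) * (B^2 * rv - s^2 * B * rv + s^2 * rb)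
        - B^2 * n1 * c * (1 + s)^2 * (1 + 2 * B - 3 * s^2)^2 - s * B * eb * (1 + 2 * B - 3 * s^2)^2 = 0"
        if "s^2 < B" for s
        using clear(1)[OF that q[symmetric]] unfolding N by (simp add: ph mult.assoc)
    qed (use n1 in simp)
    moreover have "rc = 0 \<and> sg = 0"
    proof (rule square_odd[OF B B1, of rc sg n1 ev])
      show "2 * (1 + 2 * B - 3 * s^2) * (1 - s) * B * (rc + sg)
        + (n1 * (1 - 2 * s) * (1 + 2 * B - 3 * s^2) + 6 * s * (B - s^2)) * (2 * s * rc * (1 - s) - 4 * B * sg)
        - ev * (1 + 2 * B - 3 * s^2)^2 * (1 - s) * B = 0"
        if "s^2 < B" for s
        using clear(2)[OF that q[symmetric]] unfolding N by (simp add: k)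
    qed
    ultimately show ?thesis by simp
  next
    assume k: "kp = 1" "lam = 2" and ph: "\<forall>s. ph 1 s = 1 / (1 - s)"
    have B1: "B < 1/4" using small[OF x] by (simp add: k B_def)
    have q: "(1 - lam * s) * (1 + (kp - lam) * s) + 2 * (B - s^2) = 1 + 2 * B - 3 * s" for s
      by (simp add: k algebra_simps power2_eq_square)
    have N: "NN n1 B s = n1 * (1 - 4 * s) * (1 + 2 * B - 3 * s) / 2 + 3 * (B - s^2)" for s
      unfolding NN_def Let_def unfolding k by (simp add: field_simps power2_eq_square)
    have "rv = 0 \<and> rb = 0"
    proof (rule matsumoto_even[OF B B1, of n1 rb rv eb c])
      show "(2 * s * B * rb * (1 + 2 * B - 3 * s)
        + (n1 * (1 - 4 * s) * (1 + 2 * B - 3 * s) / 2 + 3 * (B - s^2)) * (B^2 * rv - s^2 * B * rv + s^2 * rb)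
        - s * B * eb * (1 + 2 * B - 3 * s)^2) * (1 - s) - B^2 * n1 * c * (1 + 2 * B - 3 * s)^2 = 0" (is "(?X + ?Y - ?Z) * (1 - s) - ?W = 0")
        if "s^2 < B" for s
      proof -
        have "1 - s > 0" using clear(3)[OF that q[symmetric]] by (simp add: k)
        then have "?W = (1 - s) * (B^2 * (n1 * c * ph 1 s) * (1 + 2 * B - 3 * s)^2)"
          by (simp add: ph)
        moreover have "?X + ?Y - ?Z = B^2 * (n1 * c * ph 1 s) * (1 + 2 * B - 3 * s)^2"
          using clear(1)[OF that q[symmetric]] unfolding N by linarith
        ultimately show ?thesis by (simp only: mult.commute diff_self)
      qed
    qed (use n1 in simp)
    moreover have "rc = 0 \<and> sg = 0"
    proof (rule matsumoto_odd[OF B B1 n1, of rc sg ev])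
      show "2 * (1 + 2 * B - 3 * s) * (1 - 2 * s) * B * (rc + sg)
        + (n1 * (1 - 4 * s) * (1 + 2 * B - 3 * s) / 2 + 3 * (B - s^2)) * (2 * s * rc * (1 - 2 * s) - 2 * B * sg)
        - ev * (1 + 2 * B - 3 * s)^2 * (1 - 2 * s) * B = 0"
        if "s^2 < B" for s
        using clear(2)[OF that q[symmetric]] unfolding N by (simp add: k)
    qed
    ultimately show ?thesis by simp
  qed
  then show ?thesis by (simp add: rv_def rb_def rc_def sg_def)
qed

text \<open>Every vector is the sum of a multiple of \<open>b\<close> and a vector orthogonal to \<open>b\<close>, and the unit vectors of the
  latter kind have been dealt with. Dimension at least two provides one of them.\<close>

theorem isotropic_rigid:
  assumes x: "x \<in> U" and n: "CARD('n) \<ge> 2" and b0: "b x \<noteq> 0"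
    and iso: "\<And>y j k. y \<noteq> 0 \<Longrightarrow> mean_berwald_curv F j k x y
      = (real CARD('n) + 1) / 2 * c * inverse (F x y) * angular_metric F j k x y"
    and form: "kp = 2 \<and> lam = 1 \<and> (\<forall>s. ph 1 s = (1 + s)^2) \<or> kp = 1 \<and> lam = 2 \<and> (\<forall>s. ph 1 s = 1 / (1 - s))"
  shows "r00 x y = 0" "s0 x y = 0"
proof -
  have unit: "r00 x v = 0 \<and> r00 x (bu x) = 0 \<and> v \<bullet> (rm x *v bu x) = 0 \<and> s0 x v = 0"
    if v: "b x \<bullet> v = 0" "v \<noteq> 0" for v
  proof -
    define t where "t = 1 / al x v"
    have t: "t > 0" using al_pos[OF x v(2)] by (simp add: t_def)
    have "A x (t *\<^sub>R v) = 1"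
      using al_pos[OF x v(2)] homogeneous(1)[OF x t v(2)] unfolding al_sq[OF x v(2), symmetric]
      by (simp add: t_def power_divide)
    then have "r00 x (t *\<^sub>R v) = 0 \<and> r00 x (bu x) = 0 \<and> (t *\<^sub>R v) \<bullet> (rm x *v bu x) = 0 \<and> s0 x (t *\<^sub>R v) = 0"
      using isotropic_unit[OF x n b0 iso _ _ form, of "t *\<^sub>R v"] v(1) by simp
    then show ?thesis using t by (simp add: r00_def matrix_vector_mult_scaleR s0_linear)
  qed
  obtain v0 where v0: "v0 \<noteq> 0" "orthogonal (b x) v0"
    using orthogonal_to_vector_exists[of "b x"] n by (auto simp: DIM_cart)
  then have rb: "r00 x (bu x) = 0" using unit[of v0] by (simp add: orthogonal_def)
  define t where "t = be x y / bb x"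
  define v where "v = y - t *\<^sub>R bu x"
  have y: "y = v + t *\<^sub>R bu x" by (simp add: v_def)
  have bv: "b x \<bullet> v = 0"
    using bb_pos[OF x b0] by (simp add: v_def t_def inner_diff_right be_def bb_def[symmetric])
  have v: "r00 x v = 0 \<and> v \<bullet> (rm x *v bu x) = 0 \<and> s0 x v = 0"
    using unit[OF bv] by (cases "v = 0") (auto simp: r00_def s0_def su_def)
  show "s0 x y = 0" unfolding y by (simp add: s0_linear v s0_at_bu[OF x])
  show "r00 x y = 0"
    using v rb rm_inner[of "bu x" x v]
    by (simp add: y r00_def matrix_vector_right_distrib matrix_vector_mult_scaleR inner_add_left inner_add_right)
qed

end

section \<open>The generalised Douglas--Weyl condition\<close>

text \<open>This is \<open>P\<close> along the line \<open>y + t b\<close> with \<open>\<beta>(y) = 0\<close>, where \<open>\<alpha>\<^sup>2 = A + t\<^sup>2 B\<close> and \<open>\<beta> = t B\<close>. The value of the third derivative can be predicted from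
  \<open>P = \<kappa> (\<alpha> + \<lambda> \<beta> + \<lambda>\<^sup>2 \<beta>\<^sup>2 / \<alpha> + \<lambda>\<^sup>3 \<beta>\<^sup>3 / \<alpha>\<^sup>2 + \<dots>)\<close>: as \<open>\<alpha>\<close> is even in \<open>t\<close>, only the cubic term
  contributes at \<open>t = 0\<close>.\<close>

lemma third_derivative_P:
  fixes k la B A :: real
  assumes A: "A > 0" and B: "B > 0" and la: "la^2 * B < 1"
  defines "g \<equiv> \<lambda>t. sqrt (A + t^2 * B)"
  shows "\<exists>p1 p2. (\<forall>t. ((\<lambda>t. k * (A + t^2 * B) / (g t - la * (t * B))) has_real_derivative p1 t) (at t))
    \<and> (\<forall>t. (p1 has_real_derivative p2 t) (at t)) \<and> (p2 has_real_derivative 6 * k * la^3 * B^3 / A) (at 0)"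
proof -
  define u where "u = (\<lambda>t. g t - la * (t * B))"
  define p1 where "p1 = (\<lambda>t. k * B * (t * g t - 2 * la * B * t^2 + la * (g t)^2) / (u t)^2)"
  define p2 where "p2 = (\<lambda>t. k * B * ((g t + B * t^2 / g t - 2 * la * B * t) * u t
      - 2 * (t * g t - 2 * la * B * t^2 + la * (g t)^2) * (B * t / g t - la * B)) / (u t)^3)"
  have gpos: "g t > 0" for t using A B by (simp add: g_def add_pos_nonneg)
  have gsq: "(g t)^2 = A + t^2 * B" for t using A B by (simp add: g_def add_pos_nonneg less_imp_le)
  have upos: "u t > 0" for t
  proof -
    have "(la * (t * B))^2 = la^2 * B * (t^2 * B)" by (simp add: power2_eq_square)
    also have "\<dots> \<le> 1 * (t^2 * B)" using la B by (intro mult_right_mono) auto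
    also have "\<dots> < (g t)^2" using A by (simp add: gsq)
    finally have "la * (t * B) < g t" using gpos[of t] by (meson less_imp_le power2_less_imp_less)
    then show ?thesis by (simp add: u_def)
  qed
  have Dg: "(g has_real_derivative B * t / g t) (at t)" for t
  proof -
    have "(sqrt has_real_derivative inverse (sqrt (A + t^2 * B)) / 2) (at (A + t^2 * B))"
      using A B by (intro DERIV_real_sqrt) (simp add: add_pos_nonneg)
    moreover have "((\<lambda>t. A + t^2 * B) has_real_derivative 2 * t * B) (at t)"
      by (auto intro!: derivative_eq_intros)
    ultimately have "((\<lambda>t. sqrt (A + t^2 * B)) has_real_derivative inverse (sqrt (A + t^2 * B)) / 2 * (2 * t * B)) (at t)"
      by (rule DERIV_chain2)
    then show ?thesis by (simp add: g_def field_simps)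
  qed
  have Du: "(u has_real_derivative B * t / g t - la * B) (at t)" for t
    unfolding u_def by (rule derivative_eq_intros Dg refl)+ simp
  define N where "N = (\<lambda>t. t * g t - 2 * la * B * t^2 + la * (g t)^2)"
  have DN: "(N has_real_derivative g t + B * t^2 / g t - 2 * la * B * t) (at t)" for t
    unfolding N_def
    by (rule derivative_eq_intros Dg refl)+ (use gpos[of t] in \<open>simp add: field_simps power2_eq_square\<close>)
  have "((\<lambda>t. k * (g t)^2 / u t) has_real_derivative p1 t) (at t)" for t
  proof (rule DERIV_cong)
    show "((\<lambda>t. k * (g t)^2 / u t) has_real_derivative
        (k * (2 * g t * (B * t / g t)) * u t - k * (g t)^2 * (B * t / g t - la * B)) / (u t * u t)) (at t)"
      by (rule derivative_eq_intros Dg Du refl)+ (use upos[of t] in simp_all)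
    have "k * (2 * g t * (B * t / g t)) * u t - k * (g t)^2 * (B * t / g t - la * B)
        = k * B * (t * g t - 2 * la * B * t^2 + la * (g t)^2)"
      using gpos[of t] by (simp add: u_def power2_eq_square field_simps)
    then show "(k * (2 * g t * (B * t / g t)) * u t - k * (g t)^2 * (B * t / g t - la * B)) / (u t * u t) = p1 t"
      by (simp add: p1_def power2_eq_square)
  qed
  then have 1: "((\<lambda>t. k * (A + t^2 * B) / u t) has_real_derivative p1 t) (at t)" for t by (simp add: gsq)
  have 2: "(p1 has_real_derivative p2 t) (at t)" for t
  proof (rule DERIV_cong)
    show "(p1 has_real_derivative (k * B * (g t + B * t^2 / g t - 2 * la * B * t) * (u t)^2
        - k * B * N t * (2 * u t * (B * t / g t - la * B))) / ((u t)^2 * (u t)^2)) (at t)"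
      unfolding p1_def N_def[symmetric]
      by (rule derivative_eq_intros DN[unfolded N_def] DN Du refl)+ (use upos[of t] in \<open>simp_all add: N_def\<close>)
    show "(k * B * (g t + B * t^2 / g t - 2 * la * B * t) * (u t)^2
        - k * B * N t * (2 * u t * (B * t / g t - la * B))) / ((u t)^2 * (u t)^2) = p2 t"
    proof -
      have "(K * n' * v^2 - K * n * (2 * v * d)) / (v^2 * v^2) = K * (n' * v - 2 * n * d) / v^3"
        if "v > 0" for K n n' v d :: real
        using that by (simp add: field_simps eval_nat_numeral)
      from this[OF upos[of t]] show ?thesis unfolding p2_def N_def .
    qed
  qed
  have g0: "g 0 > 0" "u 0 = g 0" "(g 0)^2 = A" using gpos[of 0] gsq[of 0] by (simp_all add: u_def)
  have Dg0: "(g has_real_derivative 0) (at 0)" using Dg[of 0] by simp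
  have Du0: "(u has_real_derivative - la * B) (at 0)" using Du[of 0] by simp
  have DN0: "(N has_real_derivative g 0) (at 0)" using DN[of 0] by simp
  have ne: "g 0 \<noteq> 0" "u 0 \<noteq> 0" "(u 0)^3 \<noteq> 0" using g0 by simp_all
  define n' where "n' = (\<lambda>t. g t + B * t^2 / g t - 2 * la * B * t)"
  define d where "d = (\<lambda>t. B * t / g t - la * B)"
  have Dn': "(n' has_real_derivative - 2 * la * B) (at 0)"
    unfolding n'_def by (rule derivative_eq_intros Dg0 ne refl)+ simp
  have Dd: "(d has_real_derivative B / g 0) (at 0)"
    unfolding d_def by (rule derivative_eq_intros Dg0 ne refl)+ (use ne in simp)
  have v0: "n' 0 = g 0" "d 0 = - la * B" "N 0 = la * (g 0)^2" by (simp_all add: n'_def d_def N_def)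
  have "p2 = (\<lambda>t. k * B * (n' t * u t - 2 * N t * d t) / (u t)^3)"
    by (simp add: p2_def n'_def d_def N_def fun_eq_iff)
  moreover have "((\<lambda>t. k * B * (n' t * u t - 2 * N t * d t) / (u t)^3) has_real_derivative
      6 * k * la^3 * B^3 / (g 0)^2) (at 0)"
    by (rule derivative_eq_intros Dn' Dd Du0 DN0 ne refl)+
      (use ne in \<open>simp add: v0 g0(2) field_simps eval_nat_numeral\<close>)
  ultimately have "(p2 has_real_derivative 6 * k * la^3 * B^3 / (g 0)^2) (at 0)" by simp
  then have "(p2 has_real_derivative 6 * k * la^3 * B^3 / A) (at 0)" by (simp add: g0)
  then show ?thesis using 1 2 unfolding u_def by blast
qed

text \<open>An identity \<open>b\<^sub>i f\<^sup>i = 0\<close> may be differentiated; in the fibre direction \<open>b\<close> is constant, in the base direction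
  its derivative appears.\<close>

lemma contraction_zero:
  fixes f :: "'n::finite \<Rightarrow> 'n tfun"
  assumes U: "open U" and b: "\<And>i. smooth_on U (\<lambda>x. b x $ i)" and f: "\<And>i. smooth_slit U (f i)"
    and z: "\<And>x y. x \<in> U \<Longrightarrow> y \<noteq> 0 \<Longrightarrow> (\<Sum>i\<in>UNIV. b x $ i * f i x y) = 0"
    and xy: "x \<in> U" "y \<noteq> 0"
  shows "(\<Sum>i\<in>UNIV. b x $ i * Dy k (f i) x y) = 0"
    and "(\<Sum>i\<in>UNIV. b x $ i * Dx k (f i) x y) = - (\<Sum>i\<in>UNIV. pd k (\<lambda>x. b x $ i) x * f i x y)"
proof -
  have "Dy k (\<lambda>x y. \<Sum>i\<in>UNIV. b x $ i * f i x y) x y = (\<Sum>i\<in>UNIV. b x $ i * Dy k (f i) x y)"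
    by (rule Dy_eqI) (intro DERIV_sum DERIV_cmult Dy_has_derivative[OF U f xy])
  moreover have "Dy k (\<lambda>x y. \<Sum>i\<in>UNIV. b x $ i * f i x y) x y = Dy k (\<lambda>x y. 0) x y"
    by (rule Dy_cong[OF _ xy(2)]) (rule z[OF xy(1)])
  ultimately show "(\<Sum>i\<in>UNIV. b x $ i * Dy k (f i) x y) = 0" by (simp add: Dy_def)
  have "Dx k (\<lambda>x y. \<Sum>i\<in>UNIV. b x $ i * f i x y) x y
      = (\<Sum>i\<in>UNIV. pd k (\<lambda>x. b x $ i) x * f i x y + Dx k (f i) x y * b x $ i)"
  proof (rule Dx_eqI, rule DERIV_sum)
    fix i
    show "((\<lambda>t. b (x + t *\<^sub>R axis k 1) $ i * f i (x + t *\<^sub>R axis k 1) y) has_real_derivative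
        pd k (\<lambda>x. b x $ i) x * f i x y + Dx k (f i) x y * b x $ i) (at 0)"
      using DERIV_mult[OF pd_DERIV[OF b xy(1), of k i] Dx_has_derivative[OF U f xy, of i k]] by simp
  qed
  moreover have "Dx k (\<lambda>x y. \<Sum>i\<in>UNIV. b x $ i * f i x y) x y = Dx k (\<lambda>x y. 0) x y"
    by (rule Dx_cong[OF U _ xy]) (rule z)
  ultimately show "(\<Sum>i\<in>UNIV. b x $ i * Dx k (f i) x y) = - (\<Sum>i\<in>UNIV. pd k (\<lambda>x. b x $ i) x * f i x y)"
    by (simp add: Dx_def sum.distrib mult.commute)
qed

context ab_metric begin

text \<open>From here on the consequences of isotropy, \<open>r\<^sub>0\<^sub>0 = 0\<close> and \<open>s\<^sub>0 = 0\<close>, are assumed on the whole of \<open>U\<close>.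
  They make \<open>p\<close> and \<open>\<mu>\<close> vanish.\<close>

context
  assumes r00_0: "\<And>x y. x \<in> U \<Longrightarrow> r00 x y = 0" and s0_0: "\<And>x y. x \<in> U \<Longrightarrow> s0 x y = 0"
begin

lemma GG_flat: "x \<in> U \<Longrightarrow> GG x y = Gb x y + PP x y *\<^sub>R su x y"
  by (simp add: GG_def XX_def pp_def mm_def r00_0 s0_0)

lemma div_spray_flat:
  assumes "x \<in> U" "y \<noteq> 0"
  shows "(\<Sum>m\<in>UNIV. Dy m (spray_coeff F m) x y) = (\<Sum>m\<in>UNIV. Dy m (\<lambda>x y. Gb x y $ m) x y)"
proof -
  have X: "XX x y = 0" for y by (simp add: XX_def r00_0 s0_0 assms(1))
  have "Dy m (spray_coeff F m) x y = Dy m (\<lambda>x y. GG x y $ m) x y" for m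
    by (rule Dy_cong[OF _ assms(2)]) (rule spray_coeff_eq[OF assms(1)])
  moreover have "grad_y mm x y = 0" by (simp add: grad_y_def vec_eq_iff Dy_def mm_def X)
  ultimately show ?thesis using div_GG[OF assms] by (simp add: pp_def X s0_0[OF assms(1)])
qed

text \<open>The divergence of the spray is now that of the spray of \<open>\<alpha>\<close>, hence linear on the fibre, so that apart from
  \<open>P s\<^sup>i\<^sub>0\<close> everything under the three derivatives is quadratic.\<close>

lemma douglas_curv_flat:
  assumes x: "x \<in> U" and y: "y \<noteq> 0"
  shows "douglas_curv F i j k l x y = Dy j (Dy k (Dy l (\<lambda>x y. PP x y * su x y $ i))) x y"
proof -
  define n where "n = real CARD('n) + 1"
  define f where "f = (\<lambda>x y. spray_coeff F i x y - 1 / n * (\<Sum>m\<in>UNIV. Dy m (spray_coeff F m) x y) * y $ i)"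
  define T where "T = (\<lambda>x y. PP x y * su x y $ i)"
  have sf: "smooth_slit U f"
    unfolding f_def by (intro slit_intros openU smooth_spray slit_Dy)
  have sT: "smooth_slit U T" unfolding T_def by (intro slit_intros openU smooth_PP smooth_su)
  obtain g where g: "\<And>y. (\<Sum>m\<in>UNIV. Dy m (\<lambda>x y. Gb x y $ m) x y) = g \<bullet> y"
    using Gb_div_linear[of x] by blast
  define M where "M = (\<chi> p q. gam i p q x - (if q = i then 1 / n * g $ p else 0))"
  have "f x y - T x y = y \<bullet> (M *v y)" if "y \<noteq> 0" for y
  proof -
    have "f x y - T x y = Gb x y $ i - 1 / n * (g \<bullet> y) * y $ i"
      by (simp add: f_def T_def spray_coeff_eq[OF x that] GG_flat[OF x] div_spray_flat[OF x that] g)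
    also have "\<dots> = (\<Sum>p\<in>UNIV. \<Sum>q\<in>UNIV. gam i p q x * y $ p * y $ q)
        - (\<Sum>p\<in>UNIV. \<Sum>q\<in>UNIV. (if q = i then 1 / n * g $ p else 0) * y $ p * y $ q)"
    proof -
      have "(\<Sum>q\<in>UNIV. (if q = i then 1 / n * g $ p else 0) * y $ p * y $ q) = 1 / n * (g $ p * y $ p) * y $ i" for p
      proof -
        have "(\<Sum>q\<in>UNIV. (if q = i then 1 / n * g $ p else 0) * y $ p * y $ q)
            = (\<Sum>q\<in>UNIV. if q = i then 1 / n * g $ p * y $ p * y $ q else 0)"
          by (intro sum.cong) auto
        then show ?thesis by (simp add: mult_ac)
      qed
      then show ?thesis by (simp add: Gb_def inner_vec_def sum_distrib_left sum_distrib_right)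
    qed
    also have "\<dots> = y \<bullet> (M *v y)"
      by (simp add: M_def inner_vec_def matrix_vector_mult_def sum_subtractf[symmetric] sum_distrib_left)
        (intro sum.cong refl, simp add: algebra_simps)
    finally show ?thesis .
  qed
  then have "Dy j (Dy k (Dy l (\<lambda>x y. f x y - T x y))) x y = 0"
    by (rule Dy3_quadratic[OF _ y])
  then have "Dy j (Dy k (Dy l f)) x y = Dy j (Dy k (Dy l T)) x y"
    by (simp add: Dy3_diff[OF openU x sf sT y])
  then show ?thesis by (simp add: douglas_curv_def f_def T_def n_def)
qed

lemma smooth_douglas: "smooth_slit U (douglas_curv F i j k l)"
proof (rule slit_cong[OF openU])
  show "smooth_slit U (Dy j (Dy k (Dy l (\<lambda>x y. PP x y * su x y $ i))))"
    by (intro slit_Dy slit_intros openU smooth_PP smooth_su)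
qed (rule douglas_curv_flat[symmetric])

lemma b_douglas:
  assumes "x \<in> U" "y \<noteq> 0"
  shows "(\<Sum>i\<in>UNIV. b x $ i * douglas_curv F i j k l x y) = 0"
proof -
  have s: "smooth_slit U (\<lambda>x y. PP x y * su x y $ i)" for i
    by (intro slit_intros openU smooth_PP smooth_su)
  have 0: "(\<Sum>i\<in>UNIV. b x $ i * (PP x y * su x y $ i)) = 0" if "x \<in> U" for x y
  proof -
    have "(\<Sum>i\<in>UNIV. b x $ i * (PP x y * su x y $ i)) = PP x y * s0 x y"
      by (simp add: s0_def inner_vec_def sum_distrib_left mult_ac)
    then show ?thesis by (simp add: s0_0[OF that])
  qed
  note c = contraction_zero(1)[OF openU smooth_b']
  have 1: "(\<Sum>i\<in>UNIV. b x $ i * Dy l (\<lambda>x y. PP x y * su x y $ i) x y) = 0" if "x \<in> U" "y \<noteq> 0" for x y l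
    by (rule c[OF s 0 that])
  have 2: "(\<Sum>i\<in>UNIV. b x $ i * Dy k (Dy l (\<lambda>x y. PP x y * su x y $ i)) x y) = 0" if "x \<in> U" "y \<noteq> 0" for x y k l
    by (rule c[OF slit_Dy[OF openU s] 1 that])
  show ?thesis unfolding douglas_curv_flat[OF assms]
    by (rule c[OF slit_Dy[OF openU slit_Dy[OF openU s]] 2 assms])
qed

text \<open>\<open>b\<^sub>i G\<^sup>i\<close> is a quadratic form in \<open>y\<close> with known coefficients, because \<open>r\<^sub>0\<^sub>0 = 0\<close> expresses \<open>b\<^sub>i\<close> times the
  spray of \<open>\<alpha>\<close> by derivatives of \<open>b\<close>.\<close>

lemma b_nonlinear_conn:
  assumes "x \<in> U" "y \<noteq> 0"
  shows "(\<Sum>i\<in>UNIV. b x $ i * nonlinear_conn F i r x y)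
    = 1/2 * (\<Sum>k\<in>UNIV. (pd k (\<lambda>x. b x $ r) x + pd r (\<lambda>x. b x $ k) x) * y $ k)"
proof -
  have "Dy r (\<lambda>x y. \<Sum>i\<in>UNIV. b x $ i * spray_coeff F i x y) x y = (\<Sum>i\<in>UNIV. b x $ i * nonlinear_conn F i r x y)"
    unfolding nonlinear_conn_def
    by (rule Dy_eqI) (intro DERIV_sum DERIV_cmult Dy_has_derivative[OF openU smooth_spray assms])
  moreover have "Dy r (\<lambda>x y. \<Sum>i\<in>UNIV. b x $ i * spray_coeff F i x y) x y
      = Dy r (\<lambda>x y. 1/2 * (\<Sum>j\<in>UNIV. \<Sum>k\<in>UNIV. pd k (\<lambda>x. b x $ j) x * y $ j * y $ k)) x y"
  proof (rule Dy_cong[OF _ assms(2)])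
    fix y :: "real ^ 'n" assume y: "y \<noteq> 0"
    have "(\<Sum>i\<in>UNIV. b x $ i * spray_coeff F i x y) = b x \<bullet> GG x y"
      by (simp add: spray_coeff_eq[OF assms(1) y] inner_vec_def)
    also have "\<dots> = b x \<bullet> Gb x y + PP x y * s0 x y"
      by (simp add: GG_flat[OF assms(1)] inner_add_right s0_def)
    finally show "(\<Sum>i\<in>UNIV. b x $ i * spray_coeff F i x y)
        = 1/2 * (\<Sum>j\<in>UNIV. \<Sum>k\<in>UNIV. pd k (\<lambda>x. b x $ j) x * y $ j * y $ k)"
      using b_Gb[of x y] by (simp add: s0_0[OF assms(1)] r00_0[OF assms(1)])
  qed
  moreover have "Dy r (\<lambda>x y. 1/2 * (\<Sum>j\<in>UNIV. \<Sum>k\<in>UNIV. pd k (\<lambda>x. b x $ j) x * y $ j * y $ k)) x y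
      = 1/2 * (\<Sum>j\<in>UNIV. \<Sum>k\<in>UNIV. pd k (\<lambda>x. b x $ j) x * axis r 1 $ j * y $ k + pd k (\<lambda>x. b x $ j) x * y $ j * axis r 1 $ k)"
    by (rule Dy_eqI) (auto intro!: derivative_eq_intros sum.cong simp: algebra_simps)
  moreover have "(\<Sum>j\<in>UNIV. \<Sum>k\<in>UNIV. pd k (\<lambda>x. b x $ j) x * axis r 1 $ j * y $ k) = (\<Sum>k\<in>UNIV. pd k (\<lambda>x. b x $ r) x * y $ k)"
    by (subst sum.swap) (simp add: axis_def if_distrib[of "\<lambda>z. z * _"] if_distrib[of "\<lambda>z. _ * z"] cong: if_cong)
  moreover have "(\<Sum>j\<in>UNIV. \<Sum>k\<in>UNIV. pd k (\<lambda>x. b x $ j) x * y $ j * axis r 1 $ k) = (\<Sum>j\<in>UNIV. pd r (\<lambda>x. b x $ j) x * y $ j)"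
    by (simp add: axis_def if_distrib[of "\<lambda>z. z * _"] if_distrib[of "\<lambda>z. _ * z"] cong: if_cong)
  ultimately show ?thesis by (simp add: sum.distrib distrib_right)
qed

text \<open>The contraction of the horizontal derivative of the Douglas tensor with \<open>b\<close> differentiates
  only \<open>b\<close>, because \<open>b\<close> annihilates the Douglas tensor identically.\<close>

lemma b_douglas_hderiv:
  assumes "x \<in> U" "y \<noteq> 0"
  shows "(\<Sum>i\<in>UNIV. b x $ i * douglas_hderiv F i j k l x y) = - (\<Sum>i\<in>UNIV. (sm x *v y) $ i * douglas_curv F i j k l x y)"
proof -
  define D where "D i = douglas_curv F i j k l x y" for i
  have X: "(\<Sum>i\<in>UNIV. b x $ i * (\<Sum>m\<in>UNIV. y $ m * Dx m (douglas_curv F i j k l) x y))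
      = - (\<Sum>i\<in>UNIV. (\<Sum>m\<in>UNIV. y $ m * pd m (\<lambda>x. b x $ i) x) * D i)"
  proof -
    have "(\<Sum>i\<in>UNIV. b x $ i * (\<Sum>m\<in>UNIV. y $ m * Dx m (douglas_curv F i j k l) x y))
      = (\<Sum>m\<in>UNIV. y $ m * (\<Sum>i\<in>UNIV. b x $ i * Dx m (douglas_curv F i j k l) x y))"
      by (simp add: sum_distrib_left mult_ac, subst sum.swap, simp)
    also have "\<dots> = (\<Sum>m\<in>UNIV. y $ m * - (\<Sum>i\<in>UNIV. pd m (\<lambda>x. b x $ i) x * D i))"
      unfolding D_def using contraction_zero(2)[OF openU smooth_b' smooth_douglas b_douglas assms] by simp
    also have "\<dots> = - (\<Sum>i\<in>UNIV. (\<Sum>m\<in>UNIV. y $ m * pd m (\<lambda>x. b x $ i) x) * D i)"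
      by (simp add: sum_distrib_left sum_distrib_right sum_negf mult_ac, subst sum.swap, simp)
    finally show ?thesis .
  qed
  have swap: "(\<Sum>i\<in>UNIV. b x $ i * (\<Sum>r\<in>UNIV. c r * E i r)) = (\<Sum>r\<in>UNIV. c r * (\<Sum>i\<in>UNIV. b x $ i * E i r))"
    for c :: "'n \<Rightarrow> real" and E
    by (simp add: sum_distrib_left mult_ac, subst sum.swap, simp)
  have Y: "(\<Sum>i\<in>UNIV. b x $ i * (\<Sum>m\<in>UNIV. spray_coeff F m x y * Dy m (douglas_curv F i j k l) x y)) = 0"
    unfolding swap using contraction_zero(1)[OF openU smooth_b' smooth_douglas b_douglas assms] by simp
  have Z: "(\<Sum>i\<in>UNIV. b x $ i * (\<Sum>r\<in>UNIV. nonlinear_conn F r j x y * douglas_curv F i r k l x y)) = 0"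
    "(\<Sum>i\<in>UNIV. b x $ i * (\<Sum>r\<in>UNIV. nonlinear_conn F r k x y * douglas_curv F i j r l x y)) = 0"
    "(\<Sum>i\<in>UNIV. b x $ i * (\<Sum>r\<in>UNIV. nonlinear_conn F r l x y * douglas_curv F i j k r x y)) = 0"
    unfolding swap by (simp_all add: b_douglas[OF assms])
  have W: "(\<Sum>i\<in>UNIV. b x $ i * (\<Sum>r\<in>UNIV. nonlinear_conn F i r x y * D r))
      = (\<Sum>r\<in>UNIV. (1/2 * (\<Sum>k\<in>UNIV. (pd k (\<lambda>x. b x $ r) x + pd r (\<lambda>x. b x $ k) x) * y $ k)) * D r)"
  proof -
    have "(\<Sum>i\<in>UNIV. b x $ i * (\<Sum>r\<in>UNIV. nonlinear_conn F i r x y * D r))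
      = (\<Sum>r\<in>UNIV. (\<Sum>i\<in>UNIV. b x $ i * nonlinear_conn F i r x y) * D r)"
      by (simp add: sum_distrib_left sum_distrib_right mult_ac, subst sum.swap, simp)
    then show ?thesis by (simp only: b_nonlinear_conn[OF assms])
  qed
  have "(\<Sum>i\<in>UNIV. b x $ i * douglas_hderiv F i j k l x y)
      = (\<Sum>i\<in>UNIV. b x $ i * (\<Sum>m\<in>UNIV. y $ m * Dx m (douglas_curv F i j k l) x y))
      - 2 * (\<Sum>i\<in>UNIV. b x $ i * (\<Sum>m\<in>UNIV. spray_coeff F m x y * Dy m (douglas_curv F i j k l) x y))
      + (\<Sum>i\<in>UNIV. b x $ i * (\<Sum>r\<in>UNIV. nonlinear_conn F i r x y * D r))
      - (\<Sum>i\<in>UNIV. b x $ i * (\<Sum>r\<in>UNIV. nonlinear_conn F r j x y * douglas_curv F i r k l x y))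
      - (\<Sum>i\<in>UNIV. b x $ i * (\<Sum>r\<in>UNIV. nonlinear_conn F r k x y * douglas_curv F i j r l x y))
      - (\<Sum>i\<in>UNIV. b x $ i * (\<Sum>r\<in>UNIV. nonlinear_conn F r l x y * douglas_curv F i j k r x y))"
  proof -
    have split: "(\<Sum>i\<in>UNIV. c i * (X i - 2 * Y i + W i - Z1 i - Z2 i - Z3 i))
      = (\<Sum>i\<in>UNIV. c i * X i) - 2 * (\<Sum>i\<in>UNIV. c i * Y i) + (\<Sum>i\<in>UNIV. c i * W i)
        - (\<Sum>i\<in>UNIV. c i * Z1 i) - (\<Sum>i\<in>UNIV. c i * Z2 i) - (\<Sum>i\<in>UNIV. c i * Z3 i)"
      for c X Y W Z1 Z2 Z3 :: "'n \<Rightarrow> real"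
      unfolding sum_distrib_left[of 2] sum_subtractf[symmetric] sum.distrib[symmetric]
      by (intro sum.cong refl) (simp add: algebra_simps)
    show ?thesis unfolding douglas_hderiv_def D_def by (rule split)
  qed
  also have "\<dots> = (\<Sum>r\<in>UNIV. (1/2 * (\<Sum>k\<in>UNIV. (pd k (\<lambda>x. b x $ r) x + pd r (\<lambda>x. b x $ k) x) * y $ k)
      - (\<Sum>m\<in>UNIV. y $ m * pd m (\<lambda>x. b x $ r) x)) * D r)"
    unfolding X Y Z W by (simp add: left_diff_distrib sum_subtractf)
  also have "\<dots> = (\<Sum>r\<in>UNIV. (- (sm x *v y) $ r) * D r)"
  proof (intro sum.cong refl arg_cong2[of _ _ _ _ "(*)"])
    fix r
    show "1/2 * (\<Sum>k\<in>UNIV. (pd k (\<lambda>x. b x $ r) x + pd r (\<lambda>x. b x $ k) x) * y $ k)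
      - (\<Sum>m\<in>UNIV. y $ m * pd m (\<lambda>x. b x $ r) x) = - (sm x *v y) $ r"
      unfolding sm_def matrix_vector_mult_def sum_distrib_left
      by (simp add: sum_subtractf[symmetric] sum_negf[symmetric]) (intro sum.cong refl, simp add: field_simps)
  qed
  finally show ?thesis by (simp add: D_def sum_negf)
qed

lemma sm_bu:
  assumes "x \<in> U"
  shows "sm x *v bu x = 0"
proof -
  have "(sm x *v bu x) \<bullet> (sm x *v bu x) = 0"
    using sm_inner[of "sm x *v bu x" x "bu x"] s0_bu[OF assms, of "sm x *v bu x"] s0_0[OF assms] by simp
  then show ?thesis by simp
qed

text \<open>As \<open>s\<^sub>i\<^sub>j b\<^sup>j = 0\<close>, the vector \<open>s\<^sup>i\<^sub>0\<close> does not change in the direction of \<open>b\<close>, and the three derivatives of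
  \<open>P s\<^sup>i\<^sub>0\<close> along \<open>b\<close> fall on \<open>P\<close>.\<close>

lemma douglas_bbb:
  assumes x: "x \<in> U" and y: "y \<noteq> 0" and b0: "b x \<noteq> 0" and by0: "be x y = 0"
  shows "(\<Sum>j\<in>UNIV. bu x $ j * (\<Sum>k\<in>UNIV. bu x $ k * (\<Sum>l\<in>UNIV. bu x $ l * douglas_curv F i j k l x y)))
    = 6 * kp * lam^3 * (bb x)^3 / A x y * su x y $ i"
proof -
  define B where "B = bb x"
  define c where "c t = y + t *\<^sub>R bu x" for t
  have B: "B > 0" using bb_pos[OF x b0] by (simp add: B_def)
  have c0: "c t \<noteq> 0" for t
  proof
    assume "c t = 0"
    then have "be x (c t) = 0" by (simp add: be_def)
    moreover have "be x (c t) = t * B"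
      using by0 by (simp add: c_def be_def inner_add_right bb_def[symmetric] B_def)
    ultimately have "t = 0" using B by simp
    then show False using \<open>c t = 0\<close> y by (simp add: c_def)
  qed
  define T where "T = (\<lambda>x y. PP x y * su x y $ i)"
  have sT: "smooth_slit U T" unfolding T_def by (intro slit_intros openU smooth_PP smooth_su)
  have dir: "((\<lambda>t. f x (c t)) has_real_derivative (\<Sum>l\<in>UNIV. bu x $ l * Dy l f x (c t))) (at t)"
    if "smooth_slit U f" for f t
    using slit_DERIV_y[OF openU that x, of y t "bu x"] c0[of t]
    by (simp add: c_def grad_y_def inner_vec_def mult.commute)
  have bu_su: "su x (c t) = su x y" for t
    by (simp add: c_def su_linear su_def[of x "bu x"] sm_bu[OF x])
  have small': "lam^2 * B < 1" using small[OF x] by (simp add: B_def)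
  obtain q1 q2 where D:
    "\<And>t. ((\<lambda>t. kp * (A x y + t^2 * B) / (sqrt (A x y + t^2 * B) - lam * (t * B))) has_real_derivative q1 t) (at t)"
    "\<And>t. (q1 has_real_derivative q2 t) (at t)" "(q2 has_real_derivative 6 * kp * lam^3 * B^3 / A x y) (at 0)"
    using third_derivative_P[OF A_pos[OF x y] B small', of kp] by blast
  have Tc: "T x (c t) = kp * (A x y + t^2 * B) / (sqrt (A x y + t^2 * B) - lam * (t * B)) * su x y $ i" for t
  proof -
    have "A x (c t) = A x y + t^2 * B"
      using A_add[OF x, of 1 y t "bu x"] be_inner[OF x, of y] a_inner[OF x, of y "bu x"] by0
      by (simp add: c_def A_bu[OF x] B_def)
    moreover have "be x (c t) = t * B"
      using by0 by (simp add: c_def be_def inner_add_right bb_def[symmetric] B_def)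
    ultimately show ?thesis by (simp add: T_def PP_def uu_def al_def bu_su)
  qed
  define p1 where "p1 t = (\<Sum>l\<in>UNIV. bu x $ l * Dy l T x (c t))" for t
  define p2 where "p2 t = (\<Sum>k\<in>UNIV. bu x $ k * (\<Sum>l\<in>UNIV. bu x $ l * Dy k (Dy l T) x (c t)))" for t
  define p3 where "p3 t = (\<Sum>j\<in>UNIV. bu x $ j * (\<Sum>k\<in>UNIV. bu x $ k * (\<Sum>l\<in>UNIV. bu x $ l * Dy j (Dy k (Dy l T)) x (c t))))" for t
  have 1: "((\<lambda>t. T x (c t)) has_real_derivative p1 t) (at t)" for t
    unfolding p1_def by (rule dir[OF sT])
  have 2: "(p1 has_real_derivative p2 t) (at t)" for t
  proof -
    have "(p1 has_real_derivative (\<Sum>l\<in>UNIV. bu x $ l * (\<Sum>k\<in>UNIV. bu x $ k * Dy k (Dy l T) x (c t)))) (at t)"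
      unfolding p1_def by (intro DERIV_sum DERIV_cmult dir slit_Dy openU sT)
    also have "(\<Sum>l\<in>UNIV. bu x $ l * (\<Sum>k\<in>UNIV. bu x $ k * Dy k (Dy l T) x (c t))) = p2 t"
      unfolding p2_def by (simp add: sum_distrib_left mult_ac, subst sum.swap, simp add: mult_ac)
    finally show ?thesis .
  qed
  have 3: "(p2 has_real_derivative p3 t) (at t)" for t
  proof -
    have "(p2 has_real_derivative (\<Sum>k\<in>UNIV. bu x $ k * (\<Sum>l\<in>UNIV. bu x $ l *
        (\<Sum>j\<in>UNIV. bu x $ j * Dy j (Dy k (Dy l T)) x (c t))))) (at t)"
      unfolding p2_def by (intro DERIV_sum DERIV_cmult dir slit_Dy openU sT)
    also have "(\<Sum>k\<in>UNIV. bu x $ k * (\<Sum>l\<in>UNIV. bu x $ l * (\<Sum>j\<in>UNIV. bu x $ j * Dy j (Dy k (Dy l T)) x (c t))))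
        = (\<Sum>k\<in>UNIV. \<Sum>j\<in>UNIV. bu x $ j * (bu x $ k * (\<Sum>l\<in>UNIV. bu x $ l * Dy j (Dy k (Dy l T)) x (c t))))"
      by (intro sum.cong refl) (simp add: sum_distrib_left mult_ac, subst sum.swap, simp add: mult_ac)
    also have "\<dots> = p3 t"
      unfolding p3_def by (subst sum.swap) (simp add: sum_distrib_left)
    finally show ?thesis .
  qed
  define z where "z = su x y $ i"
  have "p1 t = q1 t * z" for t
    using DERIV_unique[OF 1[of t]] DERIV_cmult_right[OF D(1)[of t], of z] unfolding Tc z_def by blast
  then have e1: "p1 = (\<lambda>t. q1 t * z)" by blast
  have "p2 t = q2 t * z" for t
    using DERIV_unique[OF 2[of t]] DERIV_cmult_right[OF D(2)[of t], of z] unfolding e1 by blast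
  then have e2: "p2 = (\<lambda>t. q2 t * z)" by blast
  have "p3 0 = 6 * kp * lam^3 * B^3 / A x y * z"
    using DERIV_unique[OF 3[of 0]] DERIV_cmult_right[OF D(3), of z] unfolding e2 by blast
  moreover have "c 0 = y" by (simp add: c_def)
  ultimately show ?thesis
    by (simp add: p3_def douglas_curv_flat[OF x y] T_def z_def B_def)
qed

text \<open>For \<open>\<beta>(y) = 0\<close> the contraction of the right-hand side with \<open>b\<^sub>i\<close> vanishes, so \<open>s\<^sub>i\<^sub>0 D\<^sup>i\<^sub>j\<^sub>k\<^sub>l = 0\<close>, and the
  contraction with three vectors \<open>b\<close> makes this a nonzero multiple of \<open>s\<^sub>i\<^sub>0 s\<^sup>i\<^sub>0\<close>. The direction of \<open>b\<close> is
  covered by \<open>s\<^sub>i\<^sub>j b\<^sup>j = 0\<close>.\<close>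

theorem douglas_rigid:
  assumes x: "x \<in> U" and b0: "b x \<noteq> 0"
    and gdw: "\<And>y i j k l. y \<noteq> 0 \<Longrightarrow> douglas_hderiv F i j k l x y = T j k l y * y $ i"
  shows "sm x *v y = 0"
proof -
  have perp: "sm x *v v = 0" if v: "be x v = 0" "v \<noteq> 0" for v
  proof -
    have z: "(\<Sum>i\<in>UNIV. (sm x *v v) $ i * douglas_curv F i j k l x v) = 0" for j k l
    proof -
      have "(\<Sum>i\<in>UNIV. b x $ i * douglas_hderiv F i j k l x v) = T j k l v * be x v"
        by (simp add: gdw[OF v(2)] be_def inner_vec_def sum_distrib_left mult_ac)
      then show ?thesis using b_douglas_hderiv[OF x v(2), of j k l] v(1) by simp
    qed
    define K where "K = 6 * kp * lam^3 * (bb x)^3 / A x v"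
    have K: "K > 0" using kp_lam(2,3) bb_pos[OF x b0] A_pos[OF x v(2)] by (simp add: K_def)
    have sw: "(\<Sum>i\<in>UNIV. f i * (\<Sum>j\<in>UNIV. g j * h i j)) = (\<Sum>j\<in>UNIV. g j * (\<Sum>i\<in>UNIV. f i * h i j))"
      for f g :: "'n \<Rightarrow> real" and h
      by (simp add: sum_distrib_left mult_ac, subst sum.swap, simp)
    have "K * ((sm x *v v) \<bullet> su x v) = (\<Sum>i\<in>UNIV. (sm x *v v) $ i * (K * su x v $ i))"
      by (simp add: inner_vec_def sum_distrib_left mult_ac)
    also have "\<dots> = (\<Sum>i\<in>UNIV. (sm x *v v) $ i * (\<Sum>j\<in>UNIV. bu x $ j * (\<Sum>k\<in>UNIV. bu x $ k *
        (\<Sum>l\<in>UNIV. bu x $ l * douglas_curv F i j k l x v))))"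
      unfolding douglas_bbb[OF x v(2) b0 v(1)] K_def ..
    also have "\<dots> = 0"
    proof -
      have 1: "(\<Sum>i\<in>UNIV. (sm x *v v) $ i * (\<Sum>l\<in>UNIV. bu x $ l * douglas_curv F i j k l x v)) = 0" for j k
        by (subst sw) (simp add: z)
      have 2: "(\<Sum>i\<in>UNIV. (sm x *v v) $ i * (\<Sum>k\<in>UNIV. bu x $ k * (\<Sum>l\<in>UNIV. bu x $ l * douglas_curv F i j k l x v))) = 0" for j
        by (subst sw) (simp add: 1)
      show ?thesis by (subst sw) (simp add: 2)
    qed
    finally have "(sm x *v v) \<bullet> su x v = 0" using K by simp
    then have "A x (su x v) = 0" by (simp add: A_def a_su[OF x] inner_commute)
    then have "su x v = 0" using A_pos[OF x] by force
    then show ?thesis using a_su[OF x, of v] by simp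
  qed
  define t where "t = be x y / bb x"
  define v where "v = y - t *\<^sub>R bu x"
  have y: "y = v + t *\<^sub>R bu x" by (simp add: v_def)
  have "be x v = 0"
    using bb_pos[OF x b0] by (simp add: v_def t_def inner_diff_right be_def bb_def[symmetric])
  then have "sm x *v v = 0" using perp by (cases "v = 0") auto
  then show ?thesis by (simp add: y matrix_vector_right_distrib matrix_vector_mult_scaleR sm_bu[OF x])
qed

end

end

section \<open>Rigidity in a chart\<close>

context riem_form begin

lemma b_zero_nearby:
  assumes "open W" "x \<in> W" "W \<subseteq> U" "\<And>z. z \<in> W \<Longrightarrow> b z = 0"
  shows "r00 x y = 0" "sm x *v y = 0"
proof -
  have pd0: "pd k (\<lambda>x. b x $ i) x = 0" for k i
  proof -
    have "((\<lambda>t. b (x + t *\<^sub>R axis k 1) $ i) has_real_derivative pd k (\<lambda>x. b x $ i) x) (at 0)"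
      using pd_DERIV[OF smooth_b'] assms(2,3) by blast
    moreover have ev: "\<forall>\<^sub>F t in nhds 0. b (x + t *\<^sub>R axis k 1) $ i = 0"
      by (rule eventually_mono[OF eventually_line[OF assms(1,2), of "axis k 1"]]) (simp add: assms(4))
    ultimately have "((\<lambda>t. 0) has_real_derivative pd k (\<lambda>x. b x $ i) x) (at 0)"
      by (simp only: DERIV_cong_ev[OF refl ev refl])
    then show ?thesis using DERIV_unique DERIV_const by blast
  qed
  have "rm x = 0" "sm x = 0" by (simp_all add: rm_def sm_def pd0 assms(4)[OF assms(2)] vec_eq_iff)
  then show "r00 x y = 0" "sm x *v y = 0" by (simp_all add: r00_def)
qed

text \<open>If \<open>h x \<noteq> 0\<close>, then \<open>h\<close> has no zero near \<open>x\<close>, so \<open>b\<close> vanishes near \<open>x\<close>, which makes \<open>h x = 0\<close>.\<close>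

lemma vanishing_extends:
  assumes "smooth_on U h" "\<And>z. z \<in> U \<Longrightarrow> b z \<noteq> 0 \<Longrightarrow> h z = (0::real)"
    "\<And>W z. open W \<Longrightarrow> z \<in> W \<Longrightarrow> W \<subseteq> U \<Longrightarrow> (\<And>z. z \<in> W \<Longrightarrow> b z = 0) \<Longrightarrow> h z = 0" "x \<in> U"
  shows "h x = 0"
proof (rule ccontr)
  assume "h x \<noteq> 0"
  define W where "W = U \<inter> h -` (- {0})"
  have "open W"
    unfolding W_def by (rule continuous_open_preimage[OF smooth_on_imp_continuous_on[OF assms(1)] openU]) auto
  moreover have "x \<in> W" using \<open>h x \<noteq> 0\<close> assms(4) by (simp add: W_def)
  moreover have "b z = 0" if "z \<in> W" for z using assms(2) that by (auto simp: W_def)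
  ultimately have "h x = 0" using assms(3)[of W x] by (auto simp: W_def)
  then show False using \<open>h x \<noteq> 0\<close> by simp
qed

end

context ab_metric begin

lemma restrict:
  assumes "open V" "V \<subseteq> U"
  shows "ab_metric V a b kp lam ph F"
proof
  show "smooth_on V a" "smooth_on V b"
    using smooth_on_subset[OF openU assms] smooth_a smooth_b by blast+
  show "smooth_slit V F" by (rule slit_subset[OF openU assms F_smooth])
qed (use assms sym_a pos_a kplam small F_eq ph_pos ph_hom ph_DERIV in auto)

lemma spray_homogeneous:
  assumes "x \<in> U" "t > 0" "y \<noteq> 0"
  shows "spray_coeff F i x (t *\<^sub>R y) = t^2 * spray_coeff F i x y"
  using assms by (simp add: spray_coeff_eq GG_homogeneous)

text \<open>On each of the two rays of the fibre the spray is a multiple of \<open>y\<^sup>2\<close> by homogeneity.\<close>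

theorem one_dimensional_berwald:
  assumes n: "CARD('n) = 1" and x: "x \<in> U" and y0: "y0 \<noteq> 0"
  shows "berwald_curv F i j k l x y0 = 0"
proof -
  obtain i0 :: 'n where "UNIV = {i0}" using n card_1_singletonE by blast
  then have i0: "p = i0" for p by blast
  define S where "S = {y :: real ^ 'n. y $ i0 * y0 $ i0 > 0}"
  have y00: "y0 $ i0 \<noteq> 0" using y0 i0 by (metis vec_eq_iff zero_index)
  have S: "open S" "y0 \<in> S"
  proof -
    show "open S" unfolding S_def by (intro open_Collect_less continuous_intros)
    show "y0 \<in> S" using y00 by (simp add: S_def power2_eq_square[symmetric])
  qed
  define c where "c = spray_coeff F i x y0 / (y0 $ i0)^2"
  define f :: "'n tfun" where "f = (\<lambda>x y. c * (y $ i0)^2)"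
  have 0: "spray_coeff F i x y = f x y" if "y \<in> S" for y
  proof -
    define t where "t = y $ i0 / y0 $ i0"
    have "t > 0" using that by (auto simp: S_def t_def zero_less_mult_iff zero_less_divide_iff)
    moreover have "y $ p = (t *\<^sub>R y0) $ p" for p
      using y00 i0[of p] by (simp add: t_def)
    then have "y = t *\<^sub>R y0" unfolding vec_eq_iff by blast
    ultimately have "spray_coeff F i x y = t^2 * spray_coeff F i x y0"
      using spray_homogeneous[OF x _ y0] by simp
    then show ?thesis using y00 by (simp add: f_def c_def t_def power_divide)
  qed
  have 1: "Dy l (spray_coeff F i) x y = Dy l f x y" if "y \<in> S" for y
    by (rule Dy_cong_open[OF S(1) _ that]) (rule 0)
  have 2: "Dy k (Dy l (spray_coeff F i)) x y = Dy k (Dy l f) x y" if "y \<in> S" for y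
    by (rule Dy_cong_open[OF S(1) _ that]) (rule 1)
  have "Dy j (Dy k (Dy l (spray_coeff F i))) x y0 = Dy j (Dy k (Dy l f)) x y0"
    by (rule Dy_cong_open[OF S(1) _ S(2)]) (rule 2)
  also have "\<dots> = 0"
    by (rule Dy3_quadratic[OF _ y0, of _ _ "\<chi> p q. c"])
      (simp add: f_def inner_vec_def matrix_vector_mult_def \<open>UNIV = {i0}\<close> power2_eq_square)
  finally show ?thesis by (simp add: berwald_curv_def)
qed

text \<open>The spray of \<open>F\<close> then coincides with the quadratic spray of \<open>\<alpha>\<close> over \<open>x\<close>.\<close>

lemma parallel_berwald:
  assumes x: "x \<in> U" and y: "y \<noteq> 0" and par: "\<And>y. r00 x y = 0" "\<And>y. sm x *v y = 0"
  shows "berwald_curv F i j k l x y = 0"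
  unfolding berwald_curv_def
proof (rule Dy3_quadratic[OF _ y])
  fix y :: "real ^ 'n" assume y: "y \<noteq> 0"
  have su: "su x z = 0" for z by (simp add: su_def par)
  have "GG x y = Gb x y" by (simp add: GG_def XX_def pp_def mm_def s0_def par su)
  then show "spray_coeff F i x y = y \<bullet> ((\<chi> p q. gam i p q x) *v y)"
    by (simp add: spray_coeff_eq[OF x y] Gb_def inner_vec_def matrix_vector_mult_def sum_distrib_left mult_ac)
qed

text \<open>Both rigidity theorems require \<open>b \<noteq> 0\<close>, and the second one needs the conclusion of the first on an open
  set, so they are applied on the open set \<open>V\<close> where \<open>b\<close> does not vanish.\<close>

theorem parallel:
  assumes n: "CARD('n) \<ge> 2"
    and form: "kp = 2 \<and> lam = 1 \<and> (\<forall>s. ph 1 s = (1 + s)^2) \<or> kp = 1 \<and> lam = 2 \<and> (\<forall>s. ph 1 s = 1 / (1 - s))"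
    and iso: "\<And>x. x \<in> U \<Longrightarrow> \<exists>c. \<forall>y j k. y \<noteq> 0 \<longrightarrow> mean_berwald_curv F j k x y
      = (real CARD('n) + 1) / 2 * c * inverse (F x y) * angular_metric F j k x y"
    and gdw: "\<And>x y i j k l. x \<in> U \<Longrightarrow> y \<noteq> 0 \<Longrightarrow> douglas_hderiv F i j k l x y = T j k l x y * y $ i"
    and x: "x \<in> U"
  shows "r00 x y = 0" "sm x *v y = 0"
proof -
  define V where "V = U \<inter> b -` (- {0})"
  have V: "open V" "V \<subseteq> U"
    unfolding V_def by (rule continuous_open_preimage[OF smooth_on_imp_continuous_on[OF smooth_b] openU]) auto
  interpret V: ab_metric V a b kp lam ph F by (rule restrict[OF V])
  have rs: "r00 z w = 0" "s0 z w = 0" if z: "z \<in> V" for z w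
  proof -
    have zU: "z \<in> U" and b0: "b z \<noteq> 0" using z by (auto simp: V_def)
    obtain c where c: "\<And>y j k. y \<noteq> 0 \<Longrightarrow> mean_berwald_curv F j k z y
      = (real CARD('n) + 1) / 2 * c * inverse (F z y) * angular_metric F j k z y"
      using iso[OF zU] by blast
    show "r00 z w = 0" by (rule isotropic_rigid(1)[OF zU n b0 c form])
    show "s0 z w = 0" by (rule isotropic_rigid(2)[OF zU n b0 c form])
  qed
  have sm: "sm z *v w = 0" if z: "z \<in> V" for z w
    by (rule V.douglas_rigid[OF rs z, where T="\<lambda>j k l. T j k l z"]) (use z V gdw in \<open>auto simp: V_def\<close>)
  show "r00 x y = 0"
  proof (rule vanishing_extends[where h="\<lambda>x. r00 x y", OF _ _ _ x])
    show "smooth_on U (\<lambda>x. r00 x y)"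
      unfolding r00_def matrix_vector_mult_def inner_vec_def
      by simp (intro smooth_on_sum smooth_on_mult smooth_on_const openU smooth_rm)
  qed (use rs in \<open>auto simp: V_def intro: b_zero_nearby\<close>)
  have "(sm x *v y) $ i = 0" for i
  proof (rule vanishing_extends[where h="\<lambda>x. (sm x *v y) $ i", OF _ _ _ x])
    show "smooth_on U (\<lambda>x. (sm x *v y) $ i)"
      unfolding matrix_vector_mult_def
      by simp (intro smooth_on_sum smooth_on_mult smooth_on_const openU smooth_sm)
  next
    fix W z
    assume "open W" "z \<in> W" "W \<subseteq> U" "\<And>z. z \<in> W \<Longrightarrow> b z = 0"
    then have "sm z *v y = 0" by (rule b_zero_nearby(2))
    then show "(sm z *v y) $ i = 0" by simp
  qed (use sm in \<open>auto simp: V_def\<close>)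
  then show "sm x *v y = 0" by (simp add: vec_eq_iff)
qed

theorem berwald:
  assumes form: "kp = 2 \<and> lam = 1 \<and> (\<forall>s. ph 1 s = (1 + s)^2) \<or> kp = 1 \<and> lam = 2 \<and> (\<forall>s. ph 1 s = 1 / (1 - s))"
    and iso: "\<And>x. x \<in> U \<Longrightarrow> \<exists>c. \<forall>y j k. y \<noteq> 0 \<longrightarrow> mean_berwald_curv F j k x y
      = (real CARD('n) + 1) / 2 * c * inverse (F x y) * angular_metric F j k x y"
    and gdw: "\<And>x y i j k l. x \<in> U \<Longrightarrow> y \<noteq> 0 \<Longrightarrow> douglas_hderiv F i j k l x y = T j k l x y * y $ i"
    and x: "x \<in> U" and y: "y \<noteq> 0"
  shows "berwald_curv F i j k l x y = 0"
proof (cases "CARD('n) = 1")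
  case True
  then show ?thesis by (rule one_dimensional_berwald[OF _ x y])
next
  case False
  moreover have "CARD('n) > 0" by simp
  ultimately have "CARD('n) \<ge> 2" by linarith
  then show ?thesis using parallel[OF _ form iso gdw x] by (intro parallel_berwald[OF x y]) blast+
qed

end

section \<open>Square metrics and Matsumoto metrics\<close>

context riem_form begin

lemma alpha_eq: "alpha a x y = al x y"
  by (simp add: alpha_def al_def A_sum)

lemma beta_eq: "beta b x y = be x y"
  by (simp add: beta_def be_sum)

lemma beta_norm_eq: "beta_norm a b x = sqrt (bb x)"
  by (simp add: beta_norm_def bb_def bu_def inner_vec_def matrix_vector_mult_def sum_distrib_left mult_ac)

text \<open>The case \<open>m = 2\<close>, \<open>\<epsilon> = 1\<close>: the function of \<open>(\<alpha>, \<beta>)\<close> is \<open>(\<alpha> + \<beta>)\<^sup>2 / \<alpha>\<close>.\<close>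

lemma square_ab_metric:
  assumes F: "\<And>x y. x \<in> U \<Longrightarrow> F x y = alpha a x y + 2 * beta b x y + (beta b x y)\<^sup>2 / alpha a x y"
    and nb: "\<And>x. x \<in> U \<Longrightarrow> beta_norm a b x < 1"
  shows "ab_metric U a b 2 1 (\<lambda>p s. p + 2 * s + s^2 / p) F"
proof
  show "1\<^sup>2 * bb x < 1" if "x \<in> U" for x
    using nb[OF that] by (simp add: beta_norm_eq)
  show Fe: "F x y = al x y + 2 * be x y + (be x y)^2 / al x y" if "x \<in> U" for x y
    by (simp add: F[OF that] alpha_eq beta_eq)
  have "al x y \<noteq> 0" if "x \<in> U" "y \<noteq> 0" for x y using al_pos[OF that] by simp
  then have "smooth_slit U (\<lambda>x y. al x y + 2 * be x y + be x y * be x y / al x y)"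
    by (intro slit_divide slit_intros openU smooth_al smooth_be)
  then show "smooth_slit U F"
    by (rule slit_cong[OF openU, rotated]) (simp add: Fe power2_eq_square)
  show "p + 2 * s + s^2 / p > 0" if "p > 0" "1 * \<bar>s\<bar> < p" for p s :: real
  proof -
    have "p + 2 * s + s^2 / p = (p + s)^2 / p"
      using that by (simp add: field_simps power2_eq_square)
    moreover have "p + s > 0" using that by simp
    ultimately show ?thesis using that(1) by simp
  qed
  show "t * p + 2 * (t * s) + (t * s)^2 / (t * p) = t * (p + 2 * s + s^2 / p)" if "t > 0" for t p s :: real
    using that by (simp add: power2_eq_square algebra_simps)
  show "((\<lambda>t. f t + 2 * g t + (g t)^2 / f t) has_real_derivative
      (f 0 + 2 * g 0 + (g 0)^2 / f 0) * ((f 0 - 1 * g 0) / (f 0 * (f 0 + (2 - 1) * g 0)) * f' + 2 / (f 0 + (2 - 1) * g 0) * g')) (at 0)"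
    if D: "(f has_real_derivative f') (at 0)" "(g has_real_derivative g') (at 0)" and p: "f 0 > 0" "1 * \<bar>g 0\<bar> < f 0"
    for f g :: "real \<Rightarrow> real" and f' g'
  proof (rule DERIV_cong)
    have ne: "f 0 \<noteq> 0" "f 0 + g 0 \<noteq> 0" using p by auto
    show "((\<lambda>t. f t + 2 * g t + (g t)^2 / f t) has_real_derivative
        f' + 2 * g' + (2 * g 0 * g' * f 0 - (g 0)^2 * f') / (f 0 * f 0)) (at 0)"
      by (rule derivative_eq_intros D ne refl)+ simp
    have R: "r^2 / p * ((p - s) / (p * r) * f' + 2 / r * g') = (r * (p - s) * f' + 2 * p * r * g') / (p * p)"
      if "p \<noteq> 0" "r \<noteq> 0" for p r s :: real
      using that by (simp add: field_simps power2_eq_square)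
    have "f 0 + 2 * g 0 + (g 0)^2 / f 0 = (f 0 + g 0)^2 / f 0"
      using ne by (simp add: field_simps power2_eq_square)
    then have e: "(f 0 + 2 * g 0 + (g 0)^2 / f 0)
        * ((f 0 - 1 * g 0) / (f 0 * (f 0 + (2 - 1) * g 0)) * f' + 2 / (f 0 + (2 - 1) * g 0) * g')
      = (f 0 + g 0)^2 / f 0 * ((f 0 - g 0) / (f 0 * (f 0 + g 0)) * f' + 2 / (f 0 + g 0) * g')"
      by simp
    show "f' + 2 * g' + (2 * g 0 * g' * f 0 - (g 0)^2 * f') / (f 0 * f 0) = (f 0 + 2 * g 0 + (g 0)^2 / f 0)
        * ((f 0 - 1 * g 0) / (f 0 * (f 0 + (2 - 1) * g 0)) * f' + 2 / (f 0 + (2 - 1) * g 0) * g')"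
      unfolding e R[OF ne] using ne(1) by (simp add: field_simps power2_eq_square)
  qed
qed auto

text \<open>The case \<open>m = -1\<close>, \<open>\<epsilon> = -1\<close>.\<close>

lemma matsumoto_ab_metric:
  assumes F: "\<And>x y. x \<in> U \<Longrightarrow> F x y = (alpha a x y)\<^sup>2 / (alpha a x y - beta b x y)"
    and nb: "\<And>x. x \<in> U \<Longrightarrow> beta_norm a b x < 1 / 2"
  shows "ab_metric U a b 1 2 (\<lambda>p s. p^2 / (p - s)) F"
proof
  have bb: "bb x < 1 / 4" if "x \<in> U" for x
  proof -
    have "sqrt (bb x) < sqrt ((1 / 2)^2)" using nb[OF that] by (simp add: beta_norm_eq)
    then show ?thesis unfolding real_sqrt_less_iff by (simp add: power2_eq_square)
  qed
  show "2\<^sup>2 * bb x < 1" if "x \<in> U" for x using bb[OF that] by simp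
  show Fe: "F x y = (al x y)^2 / (al x y - be x y)" if "x \<in> U" for x y
    by (simp add: F[OF that] alpha_eq beta_eq)
  have ne: "al x y - be x y \<noteq> 0" if xy: "x \<in> U" "y \<noteq> 0" for x y
  proof
    assume "al x y - be x y = 0"
    then have "A x y \<le> bb x * A x y" using be_sq_le[OF xy(1), of y] al_sq[OF xy] by simp
    moreover have "bb x * A x y < 1 * A x y"
      by (rule mult_strict_right_mono) (use bb[OF xy(1)] A_pos[OF xy] in auto)
    ultimately show False by simp
  qed
  have "smooth_slit U (\<lambda>x y. al x y * al x y / (al x y - be x y))"
    by (intro slit_divide slit_intros openU smooth_al smooth_be ne)
  then show "smooth_slit U F"
    by (rule slit_cong[OF openU, rotated]) (simp add: Fe power2_eq_square)
  show "p^2 / (p - s) > 0" if "p > 0" "2 * \<bar>s\<bar> < p" for p s :: real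
    using that by (intro divide_pos_pos) auto
  show "(t * p)^2 / (t * p - t * s) = t * (p^2 / (p - s))" if "t > 0" for t p s :: real
    using that by (simp add: power2_eq_square flip: right_diff_distrib)
  show "((\<lambda>t. (f t)^2 / (f t - g t)) has_real_derivative
      ((f 0)^2 / (f 0 - g 0)) * ((f 0 - 2 * g 0) / (f 0 * (f 0 + (1 - 2) * g 0)) * f' + 1 / (f 0 + (1 - 2) * g 0) * g')) (at 0)"
    if D: "(f has_real_derivative f') (at 0)" "(g has_real_derivative g') (at 0)" and p: "f 0 > 0" "2 * \<bar>g 0\<bar> < f 0"
    for f g :: "real \<Rightarrow> real" and f' g'
  proof (rule DERIV_cong)
    have ne: "f 0 \<noteq> 0" "f 0 - g 0 \<noteq> 0" using p by auto
    show "((\<lambda>t. (f t)^2 / (f t - g t)) has_real_derivative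
        (2 * f 0 * f' * (f 0 - g 0) - (f 0)^2 * (f' - g')) / ((f 0 - g 0) * (f 0 - g 0))) (at 0)"
      by (rule derivative_eq_intros D ne refl)+ simp
    have R: "p^2 / r * ((p - 2 * s) / (p * r) * f' + 1 / r * g') = (p * (p - 2 * s) * f' + p^2 * g') / (r * r)"
      if "p \<noteq> 0" "r \<noteq> 0" for p r s :: real
      using that by (simp add: field_simps power2_eq_square)
    have e: "f 0 + (1 - 2) * g 0 = f 0 - g 0" by simp
    show "(2 * f 0 * f' * (f 0 - g 0) - (f 0)^2 * (f' - g')) / ((f 0 - g 0) * (f 0 - g 0)) = ((f 0)^2 / (f 0 - g 0))
        * ((f 0 - 2 * g 0) / (f 0 * (f 0 + (1 - 2) * g 0)) * f' + 1 / (f 0 + (1 - 2) * g 0) * g')"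
      unfolding e R[OF ne]
      by (rule arg_cong[where f="\<lambda>z. z / _"]) (simp add: algebra_simps power2_eq_square)
  qed
qed auto

end

theorem corollary1p1:
  fixes X :: "'m topology"
    and \<A> :: "('m, 'n::finite) chart set"
    and a :: "('m, 'n) chart \<Rightarrow> real ^ 'n \<Rightarrow> real ^ 'n ^ 'n"
    and b :: "('m, 'n) chart \<Rightarrow> real ^ 'n \<Rightarrow> real ^ 'n"
    and F :: "('m, 'n) chart \<Rightarrow> real ^ 'n \<Rightarrow> real ^ 'n \<Rightarrow> real"
  assumes "smooth_manifold X \<A>"
    and "riemannian_metric \<A> a"
    and "one_form \<A> b"
    and "square_metric \<A> a b F \<or> matsumoto_metric \<A> a b F"
    and "generalized_douglas_weyl \<A> F"
    and "isotropic_mean_berwald \<A> F"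
  shows "berwald_metric \<A> F"
  unfolding berwald_metric_def
proof (intro ballI allI impI)
  fix C x y i j k l
  assume C: "C \<in> \<A>" and x: "x \<in> chart_image C" and y: "y \<noteq> (0 :: real ^ 'n)"
  have "riem_form (chart_image C) (a C) (b C)"
    using assms(1-3) C
    by (auto simp: riem_form_def smooth_manifold_def is_chart_def riemannian_metric_def one_form_def)
  then interpret riem_form "chart_image C" "a C" "b C" .
  obtain T where T: "\<And>x y i j k l. x \<in> chart_image C \<Longrightarrow> y \<noteq> 0 \<Longrightarrow>
      douglas_hderiv (F C) i j k l x y = T C j k l x y * y $ i"
    using assms(5) C unfolding generalized_douglas_weyl_def by metis
  have E: "\<exists>c. \<forall>y j k. y \<noteq> 0 \<longrightarrow> mean_berwald_curv (F C) j k x y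
      = (real CARD('n) + 1) / 2 * c * inverse (F C x y) * angular_metric (F C) j k x y"
    if xC: "x \<in> chart_image C" for x
  proof -
    obtain p where "p \<in> fst C" "x = snd C p" using xC by (auto simp: chart_image_def)
    then show ?thesis using assms(6) C unfolding isotropic_mean_berwald_def by metis
  qed
  from assms(4) show "berwald_curv (F C) i j k l x y = 0"
  proof
    assume "square_metric \<A> a b F"
    then have "ab_metric (chart_image C) (a C) (b C) 2 1 (\<lambda>p s. p + 2 * s + s^2 / p) (F C)"
      using C by (intro square_ab_metric) (auto simp: square_metric_def)
    then interpret ab_metric "chart_image C" "a C" "b C" 2 1 "\<lambda>p s. p + 2 * s + s^2 / p" "F C" .
    show ?thesis
      by (rule berwald[where T="T C"]) (use E T x y in \<open>auto simp: power2_eq_square algebra_simps\<close>)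
  next
    assume "matsumoto_metric \<A> a b F"
    then have "ab_metric (chart_image C) (a C) (b C) 1 2 (\<lambda>p s. p^2 / (p - s)) (F C)"
      using C by (intro matsumoto_ab_metric) (auto simp: matsumoto_metric_def)
    then interpret ab_metric "chart_image C" "a C" "b C" 1 2 "\<lambda>p s. p^2 / (p - s)" "F C" .
    show ?thesis
      by (rule berwald[where T="T C"]) (use E T x y in auto)
  qed
qed

end
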